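(* Assume $\log n\ll b<a$ and consider $\mathcal S_k^\nu$ with $\nu=1$ (balanced communities). Let $\alpha\in(\frac12,1)$, $s=s_n=n^{1-\alpha}$, and consider the signal strength $A=A_n=\sqrt{\frac{C\log n}{\sigma_{n0}^2}}$, where $\sigma_{n0}^2=\frac nk\cdot\frac an(1-\frac an)+\frac{(k-1)n}{k}\cdot\frac bn(1-\frac bn)$. (i) The test based on $HC(1,1)$ is asymptotically powerful if $C>C_{\mathrm{HC}}(\alpha)$, where $$C_{\mathrm{HC}}(\alpha)=\begin{cases}2\rho_k(1,1)\left(\alpha-\frac12\right)&\text{for }\frac12<\alpha<\frac34,\\ 2\rho_k(1,1)\left(1-\sqrt{1-\alpha}\right)^2&\text{for }\alpha\ge\frac34.\end{cases}$$ (ii) For $\alpha\ge\frac34$, the test based on $d_{\max}(1,1)$ is asymptotically powerful if $C>C_{\max}(\alpha):=2\rho_k(1,1)\left(1-\sqrt{1-\alpha}\right)^2$. (iii) Assume in addition $a,b\gg(\log n)^3$. For $\alpha\ge\frac34$, the test based on $d_{\max}(1,1)$ is asymptotically powerless if $C<C_{\max}(\alpha)$.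
   Context: **Model.** $k$ is a fixed number of communities. A community assignment is a partition $\mathcal{C}=\{\tilde S_1,\dots,\tilde S_k\}$ of $[n]$; $\mathcal S_k^\nu$ is the set of those with $|\tilde S_l|\in[n/(k\nu),n\nu/k]$ for all $l$, so for $\nu=1$ all blocks have size exactly $n/k$. For $\mathbf\Theta\in\mathbb{R}_+^n$ and sequences $a=a_n,b=b_n$, $\mathbb{P}^{(\mathcal C)}_{\mathbf\Theta,a,b}$ (variance $\mathrm{Var}^{(\mathcal C)}_{\mathbf\Theta,a,b}$) is the law of the simple random graph on $[n]$ with adjacency matrix $\mathbf Y=(Y_{ij})$ (symmetric, zero diagonal), edges independent, $\mathbb{P}(Y_{ij}=1)=\min(\theta_i\theta_j\frac an,1)$ if $i,j$ are in the same block and $\min(\theta_i\theta_j\frac bn,1)$ otherwise. **Standing assumptions.** $0<b<a\le n/2$; $0<\liminf \frac ba\le\limsup\frac ba<1$; limits $\tau_a=\lim a/n$, $\tau_b=\lim b/n$ exist; $a,b$ known. $x_n\ll y_n$ (equivalently $y_n\gg x_n$) means $x_n/y_n\to0$. **Testing problem.** $\Xi(s,A)=\{\mathbf\Theta\in\mathbb{R}_+^n: |S(\mathbf\Theta)|=s,\ \theta_i\ge 1+A\ \forall i\in S(\mathbf\Theta)\}$, $S(\mathbf\Theta)=\{i:\theta_i\ne1\}$, $A>0$. One tests $H_0:\mathbf\Theta=\mathbf 1$ vs $H_1:\mathbf\Theta\in\Xi(s_n,A_n)$. The risk of a $\{0,1\}$-valued test $T_n(\mathbf Y)$ (1 = reject)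 is $\max_{\mathcal C\in\mathcal S_k^\nu}\mathbb{P}^{(\mathcal C)}_{\mathbf 1,a,b}(T_n=1)+\sup_{\mathbf\Theta\in\Xi(s_n,A_n)}\max_{\mathcal C\in\mathcal S_k^\nu}\mathbb{P}^{(\mathcal C)}_{\mathbf\Theta,a,b}(T_n=0)$. Tests are asymptotically powerful if $\limsup$ of the risk is 0, asymptotically powerless if $\liminf$ of the risk is $\ge1$. **The constant.** $\rho_k(1,1)=\dfrac{\left(\frac1k\tau_a(1-\tau_a)+\frac{k-1}{k}\tau_b(1-\tau_b)\right)^2}{\left(\frac1k\tau_a+\frac{k-1}{k}\tau_b\right)^2}$, with $\rho_k(1,1)=1$ when $\tau_a=\tau_b=0$. **Tests.** Let $d_i=\sum_{j\ne i}Y_{ij}$ and let $D_i=\big(d_i-\mu\big)/\sigma$ with $\mu=(\frac nk-1)\frac an+(n-\frac nk)\frac bn$ and $\sigma^2=(\frac nk-1)\frac an(1-\frac an)+(n-\frac nk)\frac bn(1-\frac bn)$ the null mean and variance of $d_i$ (independent of $\mathcal C\in\mathcal S_k^1$ and $i$). - $HC(1,1;t)=\sum_{i=1}^n\big(\mathbf 1\{D_i>t\}-\mathbb{P}^{(\mathcal C)}_{\mathbf 1,a,b}(D_i>t)\big)$, $GHC(1,1;t)=HC(1,1;t)/\sqrt{\mathrm{Var}^{(\mathcal C)}_{\mathbf 1,a,b}(HC(1,1;t))}$ (the null quantities do not depend on $\mathcal C\in\mathcal S_k^1$), and $HC(1,1)=\sup\{GHC(1,1;t):t\in\{\sqrt{2r\log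 n}:r\in(0,5)\}\cap\mathbb N\}$. The test based on $HC(1,1)$ rejects iff $HC(1,1)>\sqrt{\log n}$. - $d_{\max}(1,1)=\max_{i}D_i$. A test based on $d_{\max}(1,1)$ rejects for large values of it, equivalently for large values of $\max_i d_i$, i.e. iff $\max_i d_i>k_n$ for a deterministic cutoff sequence $k_n$. "Powerful" means powerful for a suitable choice of the cutoffs (namely rejecting when $d_{\max}(1,1)>\sqrt{2(1+\delta)\log n}$ for a suitable $\delta>0$); "powerless" means powerless for every choice of cutoffs. *)

theory Defs
  imports "HOL-Probability.Probability"
begin

text \<open>
  The vertex set is \<open>{1..n}\<close>. In the definitions about a single graph size \<open>n\<close>, the
  parameters \<open>a\<close> and \<open>b\<close> are the real numbers $a_n$ and $b_n$; in those about tests and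
  asymptotics they are the sequences.
\<close>

type_synonym adjacency = "nat \<Rightarrow> nat \<Rightarrow> bool"

definition communities :: "nat \<Rightarrow> nat \<Rightarrow> real \<Rightarrow> nat set set set" where
  "communities n k \<nu> =
     {\<C>. partition_on {1..n} \<C> \<and> card \<C> = k \<and>
         (\<forall>B\<in>\<C>. real (card B) \<in> {real n / (real k * \<nu>) .. real n * \<nu> / real k})}"

definition edge_prob ::
  "nat \<Rightarrow> nat set set \<Rightarrow> (nat \<Rightarrow> real) \<Rightarrow> real \<Rightarrow> real \<Rightarrow> nat \<Rightarrow> nat \<Rightarrow> real" where
  "edge_prob n \<C> \<theta> a b i j =
     min (\<theta> i * \<theta> j * ((if \<exists>B\<in>\<C>. i \<in> B \<and> j \<in> B then a else b) / real n)) 1"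

text \<open>
  One independent Bernoulli variable is drawn for each pair \<open>i < j\<close> and then symmetrised. Entries
  with an index outside \<open>{1..n}\<close> and diagonal entries take the default value \<open>False\<close>.
\<close>

definition dcbm ::
  "nat \<Rightarrow> nat set set \<Rightarrow> (nat \<Rightarrow> real) \<Rightarrow> real \<Rightarrow> real \<Rightarrow> adjacency pmf" where
  "dcbm n \<C> \<theta> a b =
     map_pmf (\<lambda>E i j. E (min i j, max i j))
       (Pi_pmf {(i, j). 1 \<le> i \<and> i < j \<and> j \<le> n} False
         (\<lambda>(i, j). bernoulli_pmf (edge_prob n \<C> \<theta> a b i j)))"

abbreviation null_law :: "nat \<Rightarrow> nat set set \<Rightarrow> real \<Rightarrow> real \<Rightarrow> adjacency pmf" where
  "null_law n \<C> a b \<equiv> dcbm n \<C> (\<lambda>_. 1) a b"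

text \<open>
  Vectors in $\mathbb{R}_+^n$ are functions on \<open>nat\<close> of which only the values on \<open>{1..n}\<close> matter.
\<close>

definition heterogeneous :: "nat \<Rightarrow> (nat \<Rightarrow> real) \<Rightarrow> nat set" where
  "heterogeneous n \<theta> = {i \<in> {1..n}. \<theta> i \<noteq> 1}"

definition alternatives :: "nat \<Rightarrow> nat \<Rightarrow> real \<Rightarrow> (nat \<Rightarrow> real) set" where
  "alternatives n s A =
     {\<theta> \<in> {1..n} \<rightarrow> {0..}. card (heterogeneous n \<theta>) = s \<and>
        (\<forall>i\<in>heterogeneous n \<theta>. \<theta> i \<ge> 1 + A)}"

definition risk ::
  "nat \<Rightarrow> nat \<Rightarrow> real \<Rightarrow> real \<Rightarrow> real \<Rightarrow> nat \<Rightarrow> real \<Rightarrow> (adjacency \<Rightarrow> bool) \<Rightarrow> real" where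
  "risk n k \<nu> a b s A T =
     (MAX \<C>\<in>communities n k \<nu>. measure_pmf.prob (null_law n \<C> a b) {Y. T Y}) +
     (SUP \<theta>\<in>alternatives n s A. MAX \<C>\<in>communities n k \<nu>.
        measure_pmf.prob (dcbm n \<C> \<theta> a b) {Y. \<not> T Y})"

text \<open>
  Exactly balanced assignments (\<open>\<nu> = 1\<close>) exist only if \<open>k\<close> divides \<open>n\<close>, so every limit is taken
  as \<open>n\<close> tends to infinity along the multiples of \<open>k\<close>.
\<close>

definition multiples :: "nat \<Rightarrow> nat filter" where
  "multiples k = inf sequentially (principal {n. k dvd n})"

definition powerful ::
  "nat \<Rightarrow> (nat \<Rightarrow> real) \<Rightarrow> (nat \<Rightarrow> real) \<Rightarrow> (nat \<Rightarrow> nat) \<Rightarrow> (nat \<Rightarrow> real)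
     \<Rightarrow> (nat \<Rightarrow> adjacency \<Rightarrow> bool) \<Rightarrow> bool" where
  "powerful k a b s A T \<longleftrightarrow>
     Limsup (multiples k) (\<lambda>n. ereal (risk n k 1 (a n) (b n) (s n) (A n) (T n))) = 0"

definition powerless ::
  "nat \<Rightarrow> (nat \<Rightarrow> real) \<Rightarrow> (nat \<Rightarrow> real) \<Rightarrow> (nat \<Rightarrow> nat) \<Rightarrow> (nat \<Rightarrow> real)
     \<Rightarrow> (nat \<Rightarrow> adjacency \<Rightarrow> bool) \<Rightarrow> bool" where
  "powerless k a b s A T \<longleftrightarrow>
     Liminf (multiples k) (\<lambda>n. ereal (risk n k 1 (a n) (b n) (s n) (A n) (T n))) \<ge> 1"

definition deg :: "nat \<Rightarrow> adjacency \<Rightarrow> nat \<Rightarrow> real" where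
  "deg n Y i = (\<Sum>j\<in>{1..n} - {i}. of_bool (Y i j))"

definition null_mean :: "nat \<Rightarrow> nat \<Rightarrow> real \<Rightarrow> real \<Rightarrow> real" where
  "null_mean n k a b =
     (real n / real k - 1) * (a / real n) + (real n - real n / real k) * (b / real n)"

definition null_variance :: "nat \<Rightarrow> nat \<Rightarrow> real \<Rightarrow> real \<Rightarrow> real" where
  "null_variance n k a b =
     (real n / real k - 1) * (a / real n) * (1 - a / real n) +
     (real n - real n / real k) * (b / real n) * (1 - b / real n)"

definition std_deg :: "nat \<Rightarrow> nat \<Rightarrow> real \<Rightarrow> real \<Rightarrow> adjacency \<Rightarrow> nat \<Rightarrow> real" where
  "std_deg n k a b Y i = (deg n Y i - null_mean n k a b) / sqrt (null_variance n k a b)"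

text \<open>
  The null quantities that centre and scale the higher criticism statistic do not depend on the
  balanced assignment, so they are computed under an arbitrary one; in particular the statistic
  does not use the unknown assignment that generates the graph.
\<close>

definition ref_communities :: "nat \<Rightarrow> nat \<Rightarrow> nat set set" where
  "ref_communities n k = (SOME \<C>. \<C> \<in> communities n k 1)"

definition HC_at :: "nat \<Rightarrow> nat \<Rightarrow> real \<Rightarrow> real \<Rightarrow> real \<Rightarrow> adjacency \<Rightarrow> real" where
  "HC_at n k a b t Y =
     (\<Sum>i=1..n. of_bool (std_deg n k a b Y i > t) -
        measure_pmf.prob (null_law n (ref_communities n k) a b) {Y'. std_deg n k a b Y' i > t})"

definition GHC_at :: "nat \<Rightarrow> nat \<Rightarrow> real \<Rightarrow> real \<Rightarrow> real \<Rightarrow> adjacency \<Rightarrow> real" where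
  "GHC_at n k a b t Y =
     HC_at n k a b t Y /
       sqrt (measure_pmf.variance (null_law n (ref_communities n k) a b) (HC_at n k a b t))"

definition HC :: "nat \<Rightarrow> nat \<Rightarrow> real \<Rightarrow> real \<Rightarrow> adjacency \<Rightarrow> real" where
  "HC n k a b Y =
     (SUP t\<in>{sqrt (2 * r * ln (real n)) | r. r \<in> {0<..<5}} \<inter> \<nat>. GHC_at n k a b t Y)"

definition d_max :: "nat \<Rightarrow> nat \<Rightarrow> real \<Rightarrow> real \<Rightarrow> adjacency \<Rightarrow> real" where
  "d_max n k a b Y = (MAX i\<in>{1..n}. std_deg n k a b Y i)"

definition HC_test ::
  "nat \<Rightarrow> (nat \<Rightarrow> real) \<Rightarrow> (nat \<Rightarrow> real) \<Rightarrow> nat \<Rightarrow> adjacency \<Rightarrow> bool" where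
  "HC_test k a b n Y \<longleftrightarrow> HC n k (a n) (b n) Y > sqrt (ln (real n))"

text \<open>
  A cutoff \<open>c n\<close> for the standardised maximum is the same as the cutoff
  \<open>null_mean + c n * sqrt null_variance\<close> for the maximal degree itself.
\<close>

definition d_max_test ::
  "nat \<Rightarrow> (nat \<Rightarrow> real) \<Rightarrow> (nat \<Rightarrow> real) \<Rightarrow> (nat \<Rightarrow> real) \<Rightarrow> nat \<Rightarrow> adjacency \<Rightarrow> bool" where
  "d_max_test k a b c n Y \<longleftrightarrow> d_max n k (a n) (b n) Y > c n"

definition sigma0_sq :: "nat \<Rightarrow> nat \<Rightarrow> real \<Rightarrow> real \<Rightarrow> real" where
  "sigma0_sq n k a b =
     real n / real k * (a / real n) * (1 - a / real n) +
     (real k - 1) * real n / real k * (b / real n) * (1 - b / real n)"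

definition signal :: "nat \<Rightarrow> (nat \<Rightarrow> real) \<Rightarrow> (nat \<Rightarrow> real) \<Rightarrow> real \<Rightarrow> nat \<Rightarrow> real" where
  "signal k a b C n = sqrt (C * ln (real n) / sigma0_sq n k (a n) (b n))"

definition rho :: "nat \<Rightarrow> real \<Rightarrow> real \<Rightarrow> real" where
  "rho k \<tau>a \<tau>b =
     (if \<tau>a = 0 \<and> \<tau>b = 0 then 1
      else (1 / real k * \<tau>a * (1 - \<tau>a) + (real k - 1) / real k * \<tau>b * (1 - \<tau>b))\<^sup>2 /
           (1 / real k * \<tau>a + (real k - 1) / real k * \<tau>b)\<^sup>2)"

definition C_max :: "nat \<Rightarrow> real \<Rightarrow> real \<Rightarrow> real \<Rightarrow> real" where
  "C_max k \<tau>a \<tau>b \<alpha> = 2 * rho k \<tau>a \<tau>b * (1 - sqrt (1 - \<alpha>))\<^sup>2"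

definition C_HC :: "nat \<Rightarrow> real \<Rightarrow> real \<Rightarrow> real \<Rightarrow> real" where
  "C_HC k \<tau>a \<tau>b \<alpha> =
     (if \<alpha> < 3 / 4 then 2 * rho k \<tau>a \<tau>b * (\<alpha> - 1 / 2)
      else 2 * rho k \<tau>a \<tau>b * (1 - sqrt (1 - \<alpha>))\<^sup>2)"

end

theory Submission
  imports Defs
begin


text \<open>Write \<open>L = ln n\<close>, let \<open>\<mu>\<close> and \<open>\<sigma>\<close> be the null mean and standard deviation of a degree, and let
\<open>D i\<close> be the standardised degrees. Raising \<open>\<theta> i\<close> from 1 to \<open>1 + A\<close> moves the mean of \<open>D i\<close> by
about \<open>v * sqrt L\<close>, where \<open>v\<^sup>2 = C / rho\<close>: the constant \<open>rho\<close> is the limit of \<open>(\<sigma>\<^sup>2 / \<mu>)\<^sup>2\<close>.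
Because \<open>ln n\<close> is negligible against \<open>b\<close>, the logarithmic moment generating function of \<open>D i\<close> at
\<open>l * sqrt L\<close> is \<open>L * (l * v + l\<^sup>2 / 2 + o(1))\<close>, as for a normal variable, and by the argument of
Gaertner and Ellis (\<open>gaussian_upper_tail\<close>, \<open>gaussian_lower_tail\<close>) \<open>D i\<close> exceeds \<open>x * sqrt L\<close>
with probability \<open>n powr (- (x - v)\<^sup>2 / 2 + o(1))\<close> for \<open>x > v\<close>. Hence at this threshold there are about
\<open>n powr (1 - x\<^sup>2 / 2)\<close> null exceedances and \<open>n powr (1 - \<alpha> - (x - v)\<^sup>2 / 2)\<close> exceedances on the set \<open>S\<close> of
boosted vertices. The maximal degree succeeds if the second exponent is positive at \<open>x = sqrt 2\<close>, and
higher criticism succeeds if for some \<open>x \<le> sqrt 2\<close> it is more than half of the first one. Solving for \<open>C\<close>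
gives the two constants.

Degrees are dependent, which matters in three places. Under the null, two stars share a single edge, so
that the covariance of two exceedances factorises (\<open>cov_exceed\<close>); an integration by parts
(\<open>sum_jump\<close>) bounds the factors, and the number of exceedances has the variance of an independent sum up
to \<open>n powr o(1)\<close>. On \<open>S\<close>, only the edges to the complement of \<open>S\<close> are counted. They are independent
for different vertices, and few enough edges are lost because \<open>\<alpha> > 1 / 2\<close> (\<open>R_over_sg\<close>). Finally, all
graphs are coupled monotonically. This reduces the alternatives to \<open>\<theta> = 1 + A\<close> on \<open>S\<close>
(\<open>alternative_dominated\<close>) and compares the vertices outside \<open>S\<close> with the null graph: below the
boundary, for \<open>x\<close> slightly less than \<open>sqrt 2\<close>, the null maximum is above \<open>x * sqrt L\<close>
(\<open>null_max_exceeds\<close>), the degrees on \<open>S\<close> stay below it (\<open>alt_max_on_S\<close>), and no vertex outside \<open>S\<close>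
that is above it receives an additional edge (\<open>added_edges_total\<close>). So no cutoff separates the two
hypotheses (\<open>d_max_powerless\<close>).\<close>

abbreviation E :: "'a pmf \<Rightarrow> ('a \<Rightarrow> real) \<Rightarrow> real" where
  "E M f \<equiv> measure_pmf.expectation M f"

abbreviation Pr :: "'a pmf \<Rightarrow> ('a \<Rightarrow> bool) \<Rightarrow> real" where
  "Pr M P \<equiv> measure_pmf.prob M {x. P x}"

section \<open>Tail probabilities from a nearly Gaussian moment generating function\<close>

lemma Pr_eq_E: "Pr M P = E M (\<lambda>x. of_bool (P x))"
proof -
  have "(\<lambda>x. of_bool (P x) :: real) = indicator {x. P x}"
    by (auto simp: indicator_def fun_eq_iff)
  then show ?thesis by (simp only:) simp
qed

lemma E_mono:
  assumes "finite (set_pmf M)" "\<And>x. x \<in> set_pmf M \<Longrightarrow> f x \<le> g x"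
  shows "E M f \<le> E M g"
  by (rule integral_mono_AE) (use assms in \<open>auto intro!: integrable_measure_pmf_finite simp: AE_measure_pmf_iff\<close>)

lemma E_cong:
  assumes "\<And>x. x \<in> set_pmf M \<Longrightarrow> f x = g x"
  shows "E M f = E M g"
  by (rule integral_cong_AE) (use assms in \<open>auto simp: AE_measure_pmf_iff\<close>)

lemma E_add:
  assumes "finite (set_pmf M)"
  shows "E M (\<lambda>x. f x + g x) = E M f + E M g"
  by (rule Bochner_Integration.integral_add) (auto intro!: integrable_measure_pmf_finite assms)

lemma E_diff:
  assumes "finite (set_pmf M)"
  shows "E M (\<lambda>x. f x - g x) = E M f - E M g"
  by (rule Bochner_Integration.integral_diff) (auto intro!: integrable_measure_pmf_finite assms)

lemma E_sum:
  assumes "finite (set_pmf M)"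
  shows "E M (\<lambda>x. \<Sum>i\<in>I. f i x) = (\<Sum>i\<in>I. E M (f i))"
  by (rule Bochner_Integration.integral_sum) (auto intro!: integrable_measure_pmf_finite assms)

lemma Pr_mono:
  assumes "\<And>x. x \<in> set_pmf M \<Longrightarrow> P x \<Longrightarrow> Q x"
  shows "Pr M P \<le> Pr M Q"
  by (rule measure_pmf.finite_measure_mono_AE) (use assms in \<open>auto simp: AE_measure_pmf_iff\<close>)

lemma Pr_disj: "Pr M (\<lambda>x. P x \<or> Q x) \<le> Pr M P + Pr M Q"
proof -
  have "{x. P x \<or> Q x} = {x. P x} \<union> {x. Q x}" by auto
  then show ?thesis using measure_Un_le[of "{x. P x}" M "{x. Q x}"] by simp
qed

lemma Pr_Bex:
  assumes "finite I"
  shows "Pr M (\<lambda>x. \<exists>i\<in>I. P i x) \<le> (\<Sum>i\<in>I. Pr M (P i))"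
proof -
  have "{x. \<exists>i\<in>I. P i x} = (\<Union>i\<in>I. {x. P i x})" by auto
  then show ?thesis using measure_pmf.finite_measure_subadditive_finite[OF assms, of "\<lambda>i. {x. P i x}" M] by simp
qed

lemma Pr_not: "Pr M (\<lambda>x. \<not> P x) = 1 - Pr M P"
proof -
  have "{x. \<not> P x} = space M - {x. P x}" by auto
  then show ?thesis using measure_pmf.prob_compl[of "{x. P x}" M] by simp
qed

lemma Pr_map: "Pr (map_pmf f M) P = Pr M (\<lambda>x. P (f x))"
  by (simp add: vimage_def)

text \<open>Here \<open>W\<close> stands for \<open>sqrt L\<close> times a standardised variable, so that \<open>l\<close> and \<open>v\<close> are measured on the scale
\<open>sqrt L\<close> of moderate deviations; if \<open>W / sqrt L\<close> is normal with mean \<open>v * sqrt L\<close> and variance 1, the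
bounds hold with \<open>\<eta> = 0\<close>.\<close>

definition near_gaussian ::
  "'a pmf \<Rightarrow> ('a \<Rightarrow> real) \<Rightarrow> real \<Rightarrow> real \<Rightarrow> real \<Rightarrow> real \<Rightarrow> bool" where
  "near_gaussian M W L K \<eta> v \<longleftrightarrow>
     (\<forall>l\<in>{0..K}. exp (L * (l * v + l\<^sup>2 / 2 - \<eta>)) \<le> E M (\<lambda>\<omega>. exp (l * W \<omega>)) \<and>
                 E M (\<lambda>\<omega>. exp (l * W \<omega>)) \<le> exp (L * (l * v + l\<^sup>2 / 2 + \<eta>)))"

lemma chernoff:
  assumes "finite (set_pmf M)" "0 \<le> l"
  shows "Pr M (\<lambda>\<omega>. W \<omega> > m) \<le> exp (- l * m) * E M (\<lambda>\<omega>. exp (l * W \<omega>))"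
proof -
  have "Pr M (\<lambda>\<omega>. W \<omega> > m) \<le> E M (\<lambda>\<omega>. exp (- l * m) * exp (l * W \<omega>))"
    unfolding Pr_eq_E
  proof (rule E_mono[OF assms(1)])
    fix \<omega>
    show "of_bool (W \<omega> > m) \<le> exp (- l * m) * exp (l * W \<omega>)"
      using assms(2) mult_left_mono[of m "W \<omega>" l] by (auto simp: exp_add[symmetric])
  qed
  then show ?thesis by simp
qed

text \<open>Chernoff's bound at the optimal \<open>l = x - v\<close>. All constants are chosen before \<open>L\<close>, \<open>M\<close> and \<open>W\<close>, which
makes the tail bounds uniform over vertices, assignments and alternatives.\<close>

lemma gaussian_upper_tail:
  assumes "v < x" "\<beta> < (x - v)\<^sup>2 / 2"
  shows "\<exists>\<eta>>0. \<exists>K>0. \<forall>L\<ge>0. \<forall>M (W::'a \<Rightarrow> real). finite (set_pmf M) \<longrightarrow>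
           near_gaussian M W L K \<eta> v \<longrightarrow> Pr M (\<lambda>\<omega>. W \<omega> > x * L) \<le> exp (- \<beta> * L)"
proof -
  define y where "y = x - v"
  define \<eta> where "\<eta> = y\<^sup>2 / 2 - \<beta>"
  have y: "y > 0" and \<eta>: "\<eta> > 0" using assms by (auto simp: y_def \<eta>_def)
  have "Pr M (\<lambda>\<omega>. W \<omega> > x * L) \<le> exp (- \<beta> * L)"
    if "L \<ge> 0" "finite (set_pmf M)" "near_gaussian M W L y \<eta> v" for L M and W :: "'a \<Rightarrow> real"
  proof -
    have "E M (\<lambda>\<omega>. exp (y * W \<omega>)) \<le> exp (L * (y * v + y\<^sup>2 / 2 + \<eta>))"
      using that(3) y unfolding near_gaussian_def by auto
    then have "exp (- y * (x * L)) * E M (\<lambda>\<omega>. exp (y * W \<omega>))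
        \<le> exp (- y * (x * L)) * exp (L * (y * v + y\<^sup>2 / 2 + \<eta>))"
      by (rule mult_left_mono) simp
    then have "Pr M (\<lambda>\<omega>. W \<omega> > x * L) \<le> exp (- y * (x * L)) * exp (L * (y * v + y\<^sup>2 / 2 + \<eta>))"
      using chernoff[OF that(2) less_imp_le[OF y], of "x * L" W] by (rule order_trans[rotated])
    also have "\<dots> = exp (- \<beta> * L)"
      unfolding exp_add[symmetric]
      by (simp add: y_def \<eta>_def field_simps power2_eq_square)
    finally show ?thesis .
  qed
  then show ?thesis using y \<eta> by blast
qed

text \<open>Bounding the factor \<open>W / sqrt L\<close> by its exponential costs only a factor \<open>exp (l * W)\<close> with
  \<open>l = 1 / sqrt L\<close> tending to 0, hence no change of the exponent.\<close>

lemma gaussian_truncated_mean: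
  assumes "0 < x" "\<beta> < x\<^sup>2 / 2"
  shows "\<exists>\<eta>>0. \<exists>K>0. \<exists>L0>0. \<forall>L\<ge>L0. \<forall>M (W::'a \<Rightarrow> real). finite (set_pmf M) \<longrightarrow>
           near_gaussian M W L K \<eta> 0 \<longrightarrow>
           E M (\<lambda>\<omega>. W \<omega> / sqrt L * of_bool (W \<omega> > x * L)) \<le> exp (- \<beta> * L)"
proof -
  define g where "g = x\<^sup>2 / 2 - \<beta>"
  have g: "g > 0" using assms by (auto simp: g_def)
  define \<zeta> where "\<zeta> = min 1 (g / (2 * (1 + x)))"
  have \<zeta>: "0 < \<zeta>" "\<zeta> \<le> 1" "\<zeta> \<le> g / (2 * (1 + x))" using g assms by (auto simp: \<zeta>_def)
  define \<eta> where "\<eta> = g / 2"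
  define K where "K = x + \<zeta>"
  define L0 where "L0 = 1 / \<zeta>\<^sup>2"
  have b: "E M (\<lambda>\<omega>. W \<omega> / sqrt L * of_bool (W \<omega> > x * L)) \<le> exp (- \<beta> * L)"
    if L: "L \<ge> L0" and fin: "finite (set_pmf M)" and ng: "near_gaussian M W L K \<eta> 0"
    for L M and W :: "'a \<Rightarrow> real"
  proof -
    have L0: "L0 > 0" using \<zeta> by (simp add: L0_def)
    then have Lp: "L > 0" using L by simp
    have "1 / \<zeta> \<le> sqrt L" using L \<zeta> by (auto simp: L0_def intro!: real_le_rsqrt simp: power_divide)
    then have sL: "1 / sqrt L \<le> \<zeta>" using \<zeta> Lp by (simp add: field_simps)
    have "E M (\<lambda>\<omega>. W \<omega> / sqrt L * of_bool (W \<omega> > x * L))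
          \<le> E M (\<lambda>\<omega>. exp (- x * (x * L)) * exp (K * W \<omega>))"
    proof (rule E_mono[OF fin])
      fix \<omega>
      show "W \<omega> / sqrt L * of_bool (W \<omega> > x * L) \<le> exp (- x * (x * L)) * exp (K * W \<omega>)"
      proof (cases "W \<omega> > x * L")
        case True
        then have W: "W \<omega> > 0" using mult_pos_pos[OF assms(1) Lp] by linarith
        have "W \<omega> / sqrt L \<le> exp (W \<omega> / sqrt L)" using exp_ge_add_one_self[of "W \<omega> / sqrt L"] by linarith
        also have "\<dots> \<le> exp (\<zeta> * W \<omega>)" using mult_right_mono[OF sL, of "W \<omega>"] W by simp
        also have "\<dots> \<le> exp (\<zeta> * W \<omega> + x * (W \<omega> - x * L))" using True assms by simp
        also have "\<dots> = exp (- x * (x * L)) * exp (K * W \<omega>)"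
          by (simp add: K_def exp_add[symmetric] algebra_simps)
        finally show ?thesis using True by simp
      qed simp
    qed
    also have "\<dots> = exp (- x * (x * L)) * E M (\<lambda>\<omega>. exp (K * W \<omega>))" by simp
    also have "\<dots> \<le> exp (- x * (x * L)) * exp (L * (K * 0 + K\<^sup>2 / 2 + \<eta>))"
      using ng assms \<zeta> unfolding near_gaussian_def by (intro mult_left_mono) (auto simp: K_def)
    also have "\<dots> = exp (L * (- (x\<^sup>2 / 2) + x * \<zeta> + \<zeta>\<^sup>2 / 2 + \<eta>))"
      by (simp add: exp_add[symmetric] K_def field_simps power2_eq_square)
    also have "\<dots> \<le> exp (L * (- \<beta>))"
    proof -
      have "x * \<zeta> + \<zeta>\<^sup>2 / 2 \<le> (1 + x) * \<zeta>"
        using \<zeta> mult_left_mono[of \<zeta> 1 \<zeta>] by (simp add: power2_eq_square algebra_simps)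
      also have "\<dots> \<le> g / 2" using \<zeta>(3) assms by (simp add: field_simps)
      finally have "- (x\<^sup>2 / 2) + x * \<zeta> + \<zeta>\<^sup>2 / 2 + \<eta> \<le> - \<beta>" using \<eta>_def g_def by linarith
      then show ?thesis using Lp by (simp only: exp_le_cancel_iff) (intro mult_left_mono, auto)
    qed
    finally show ?thesis by (simp add: mult.commute)
  qed
  show ?thesis
    by (rule exI[of _ \<eta>], intro conjI, simp add: \<eta>_def g, rule exI[of _ K], intro conjI,
        use assms \<zeta> in \<open>simp add: K_def\<close>, rule exI[of _ L0], intro conjI,
        use \<zeta> in \<open>simp add: L0_def\<close>, use b in blast)
qed

text \<open>The law tilted by \<open>exp (l * W)\<close> with \<open>l\<close> slightly above \<open>x - v\<close> concentrates on a window just above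
\<open>x * L\<close>. The mass outside of the window is controlled by the moment generating function at two
neighbouring points, so that no central limit theorem for the tilted law is needed.\<close>

lemma gaussian_lower_tail:
  assumes "v < x" "(x - v)\<^sup>2 / 2 < \<beta>"
  shows "\<exists>\<eta>>0. \<exists>K>0. \<exists>L0>0. \<forall>L\<ge>L0. \<forall>M (W::'a \<Rightarrow> real). finite (set_pmf M) \<longrightarrow>
           near_gaussian M W L K \<eta> v \<longrightarrow> exp (- \<beta> * L) \<le> Pr M (\<lambda>\<omega>. W \<omega> > x * L)"
proof -
  define y where "y = x - v"
  have y: "y > 0" using assms by (simp add: y_def)
  have "((\<lambda>\<epsilon>. y\<^sup>2 / 2 * ((1 + \<epsilon>) * (1 + 3 * \<epsilon>)) + 2 * (\<epsilon>\<^sup>2 * y\<^sup>2 / 8)) \<longlongrightarrow>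
         y\<^sup>2 / 2) (at_right 0)"
    by (auto intro!: tendsto_eq_intros)
  then have "\<forall>\<^sub>F \<epsilon> in at_right 0. y\<^sup>2 / 2 * ((1 + \<epsilon>) * (1 + 3 * \<epsilon>)) + 2 * (\<epsilon>\<^sup>2 * y\<^sup>2 / 8) < \<beta>"
    by (rule order_tendstoD(2)) (use assms in \<open>simp add: y_def\<close>)
  then have "\<forall>\<^sub>F \<epsilon> in at_right 0. (0::real) < \<epsilon> \<and>
      y\<^sup>2 / 2 * ((1 + \<epsilon>) * (1 + 3 * \<epsilon>)) + 2 * (\<epsilon>\<^sup>2 * y\<^sup>2 / 8) < \<beta>"
    by (intro eventually_conj eventually_at_right_less) auto
  then obtain \<epsilon> where \<epsilon>: "\<epsilon> > 0" "y\<^sup>2 / 2 * ((1 + \<epsilon>) * (1 + 3 * \<epsilon>)) + 2 * (\<epsilon>\<^sup>2 * y\<^sup>2 / 8) < \<beta>"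
    using eventually_happens[of _ "at_right (0::real)"] by (auto simp: trivial_limit_at_right_real)
  define \<eta> where "\<eta> = \<epsilon>\<^sup>2 * y\<^sup>2 / 8"
  have \<eta>: "\<eta> > 0" using \<epsilon> y by (simp add: \<eta>_def)
  define l where "l = (1 + \<epsilon>) * y"
  define l2 where "l2 = (1 + 2 * \<epsilon>) * y"
  define m' where "m' = v + (1 + 2 * \<epsilon>) * y"
  define L0 where "L0 = ln 4 / (2 * \<eta>)"
  have L0: "L0 > 0" using \<eta> by (simp add: L0_def)
  have b: "exp (- \<beta> * L) \<le> Pr M (\<lambda>\<omega>. W \<omega> > x * L)"
    if L: "L \<ge> L0" and fin: "finite (set_pmf M)" and ng: "near_gaussian M W L l2 \<eta> v"
    for L M and W :: "'a \<Rightarrow> real"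
  proof -
    have Lp: "L > 0" using L L0 by simp
    have mgf: "exp (L * (u * v + u\<^sup>2 / 2 - \<eta>)) \<le> E M (\<lambda>\<omega>. exp (u * W \<omega>))"
       "E M (\<lambda>\<omega>. exp (u * W \<omega>)) \<le> exp (L * (u * v + u\<^sup>2 / 2 + \<eta>))" if "0 \<le> u" "u \<le> l2" for u
      using ng that unfolding near_gaussian_def by auto
    have ord: "0 \<le> y" "y \<le> l2" "0 \<le> l" "l \<le> l2" "0 \<le> l2" using y \<epsilon> by (auto simp: l_def l2_def)
    define c where "c = l * v + y\<^sup>2 * (1 / 2 + \<epsilon>) + \<eta>"
    \<comment> \<open>Under the law tilted by \<open>exp (l * W)\<close>, the mass below \<open>x * L\<close> and above \<open>m' * L\<close> is negligible.\<close>
    have low: "exp (\<epsilon> * y * (x * L)) * E M (\<lambda>\<omega>. exp (y * W \<omega>)) \<le> exp (L * c)"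
    proof -
      have "exp (\<epsilon> * y * (x * L)) * E M (\<lambda>\<omega>. exp (y * W \<omega>))
          \<le> exp (\<epsilon> * y * (x * L)) * exp (L * (y * v + y\<^sup>2 / 2 + \<eta>))"
        by (intro mult_left_mono mgf ord) auto
      also have "\<dots> = exp (L * c)" unfolding exp_add[symmetric] c_def l_def
        by (simp add: y_def field_simps power2_eq_square)
      finally show ?thesis .
    qed
    have high: "exp (- \<epsilon> * y * (m' * L)) * E M (\<lambda>\<omega>. exp (l2 * W \<omega>)) \<le> exp (L * c)"
    proof -
      have "exp (- \<epsilon> * y * (m' * L)) * E M (\<lambda>\<omega>. exp (l2 * W \<omega>))
          \<le> exp (- \<epsilon> * y * (m' * L)) * exp (L * (l2 * v + l2\<^sup>2 / 2 + \<eta>))"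
        by (intro mult_left_mono mgf ord) auto
      also have "\<dots> = exp (L * c)" unfolding exp_add[symmetric] c_def l_def l2_def m'_def
        by (simp add: field_simps power2_eq_square)
      finally show ?thesis .
    qed
    have "E M (\<lambda>\<omega>. exp (l * W \<omega>)) \<le> E M (\<lambda>\<omega>. exp (l * (m' * L)) * of_bool (W \<omega> > x * L) +
         (exp (\<epsilon> * y * (x * L)) * exp (y * W \<omega>) + exp (- \<epsilon> * y * (m' * L)) * exp (l2 * W \<omega>)))"
    proof (rule E_mono[OF fin])
      fix \<omega>
      have nn: "0 \<le> exp (\<epsilon> * y * (x * L)) * exp (y * W \<omega>)"
        "0 \<le> exp (- \<epsilon> * y * (m' * L)) * exp (l2 * W \<omega>)" "0 \<le> exp (l * (m' * L)) * of_bool (W \<omega> > x * L)"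
        by auto
      consider "W \<omega> \<le> x * L" | "x * L < W \<omega>" "W \<omega> \<le> m' * L" | "m' * L < W \<omega>" by linarith
      then show "exp (l * W \<omega>) \<le> exp (l * (m' * L)) * of_bool (W \<omega> > x * L) +
         (exp (\<epsilon> * y * (x * L)) * exp (y * W \<omega>) + exp (- \<epsilon> * y * (m' * L)) * exp (l2 * W \<omega>))"
      proof cases
        case 1
        have "l * W \<omega> \<le> \<epsilon> * y * (x * L) + y * W \<omega>"
          using mult_left_mono[OF 1, of "\<epsilon> * y"] y \<epsilon> by (simp add: l_def algebra_simps)
        then have "exp (l * W \<omega>) \<le> exp (\<epsilon> * y * (x * L)) * exp (y * W \<omega>)"
          by (simp add: exp_add[symmetric])
        then show ?thesis using nn by linarith
      next
        case 2
        have "exp (l * W \<omega>) \<le> exp (l * (m' * L))" using 2 ord by (auto intro!: mult_left_mono)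
        then show ?thesis using 2 nn by (auto intro: add_increasing2)
      next
        case 3
        have "l * W \<omega> \<le> - \<epsilon> * y * (m' * L) + l2 * W \<omega>"
          using mult_left_mono[OF less_imp_le[OF 3], of "\<epsilon> * y"] y \<epsilon> by (simp add: l_def l2_def algebra_simps)
        then have "exp (l * W \<omega>) \<le> exp (- \<epsilon> * y * (m' * L)) * exp (l2 * W \<omega>)"
          by (simp add: exp_add[symmetric])
        then show ?thesis using nn by linarith
      qed
    qed
    also have "\<dots> = exp (l * (m' * L)) * Pr M (\<lambda>\<omega>. W \<omega> > x * L) +
       (exp (\<epsilon> * y * (x * L)) * E M (\<lambda>\<omega>. exp (y * W \<omega>)) + exp (- \<epsilon> * y * (m' * L)) * E M (\<lambda>\<omega>. exp (l2 * W \<omega>)))"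
      by (simp add: E_add[OF fin] Pr_eq_E)
    finally have 1: "exp (L * (l * v + l\<^sup>2 / 2 - \<eta>)) \<le>
        exp (l * (m' * L)) * Pr M (\<lambda>\<omega>. W \<omega> > x * L) + 2 * exp (L * c)"
      using mgf(1)[of l] ord low high by linarith
    have "4 * exp (L * c) \<le> exp (L * (l * v + l\<^sup>2 / 2 - \<eta>))"
    proof -
      have gap: "l * v + l\<^sup>2 / 2 - \<eta> = c + 2 * \<eta>"
        by (simp add: c_def l_def \<eta>_def field_simps power2_eq_square)
      have "ln 4 \<le> L * (2 * \<eta>)" using L \<eta> by (simp add: L0_def field_simps)
      then have "4 \<le> exp (L * (2 * \<eta>))" by (metis exp_le_cancel_iff exp_ln zero_less_numeral)
      then show ?thesis unfolding gap by (simp add: distrib_left exp_add)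
    qed
    then have "exp (L * (l * v + l\<^sup>2 / 2 - \<eta>)) / 2 \<le> exp (l * (m' * L)) * Pr M (\<lambda>\<omega>. W \<omega> > x * L)"
      using 1 by linarith
    then have 2: "exp (- (l * (m' * L))) * (exp (L * (l * v + l\<^sup>2 / 2 - \<eta>)) / 2) \<le> Pr M (\<lambda>\<omega>. W \<omega> > x * L)"
      by (simp add: exp_minus field_simps)
    have "exp (- \<beta> * L) \<le> exp (- (l * (m' * L))) * (exp (L * (l * v + l\<^sup>2 / 2 - \<eta>)) / 2)"
    proof -
      have e: "- (l * m') + (l * v + l\<^sup>2 / 2 - \<eta>) = - (y\<^sup>2 / 2 * ((1 + \<epsilon>) * (1 + 3 * \<epsilon>))) - \<eta>"
        by (simp add: l_def m'_def field_simps power2_eq_square)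
      have "- \<beta> \<le> - (l * m') + (l * v + l\<^sup>2 / 2 - \<eta>) - \<eta>"
        using \<epsilon>(2) e unfolding \<eta>_def[symmetric] by linarith
      then have "L * (- \<beta>) \<le> L * (- (l * m') + (l * v + l\<^sup>2 / 2 - \<eta>) - \<eta>)"
        using Lp by (intro mult_left_mono) auto
      moreover have "ln 2 \<le> L * \<eta>"
      proof -
        have "ln 4 = 2 * ln (2::real)" using ln_realpow[of 2 2] by simp
        then show ?thesis using L \<eta> by (simp add: L0_def field_simps)
      qed
      ultimately have "- \<beta> * L \<le> - (l * (m' * L)) + L * (l * v + l\<^sup>2 / 2 - \<eta>) - ln 2"
        by (simp add: algebra_simps)
      then have "exp (- \<beta> * L) \<le> exp (- (l * (m' * L)) + L * (l * v + l\<^sup>2 / 2 - \<eta>) - ln 2)"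
        by (simp only: exp_le_cancel_iff)
      also have "\<dots> = exp (- (l * (m' * L))) * (exp (L * (l * v + l\<^sup>2 / 2 - \<eta>)) / 2)"
        by (simp only: exp_add exp_diff exp_ln)
      finally show ?thesis .
    qed
    then show ?thesis using 2 by linarith
  qed
  have l2: "l2 > 0" using y \<epsilon> by (simp add: l2_def)
  show ?thesis using b \<eta> l2 L0 by blast
qed


section \<open>Bernoulli fields\<close>

lemma E_pair_prod:
  assumes "finite (set_pmf P)" "finite (set_pmf Q)"
  shows "E (pair_pmf P Q) (\<lambda>z. f (fst z) * g (snd z)) = E P f * E Q g"
proof -
  have "E (pair_pmf P Q) (\<lambda>z. f (fst z) * g (snd z)) =
      (\<Sum>z\<in>set_pmf P \<times> set_pmf Q. f (fst z) * g (snd z) * pmf (pair_pmf P Q) z)"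
    by (rule integral_measure_pmf_real) (use assms in auto)
  also have "\<dots> = (\<Sum>x\<in>set_pmf P. \<Sum>y\<in>set_pmf Q. (f x * pmf P x) * (g y * pmf Q y))"
    by (subst sum.cartesian_product) (auto simp: pmf_pair intro!: sum.cong)
  also have "\<dots> = (\<Sum>x\<in>set_pmf P. f x * pmf P x) * (\<Sum>y\<in>set_pmf Q. g y * pmf Q y)"
    by (simp add: sum_product)
  also have "(\<Sum>x\<in>set_pmf P. f x * pmf P x) = E P f"
    by (rule integral_measure_pmf_real[symmetric]) (use assms in auto)
  also have "(\<Sum>x\<in>set_pmf Q. g x * pmf Q x) = E Q g"
    by (rule integral_measure_pmf_real[symmetric]) (use assms in auto)
  finally show ?thesis .
qed

lemma finite_set_Pi_pmf:
  assumes "finite J" "\<And>j. j \<in> J \<Longrightarrow> finite (set_pmf (p j))"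
  shows "finite (set_pmf (Pi_pmf J d p))"
  unfolding set_Pi_pmf[OF assms(1)] by (rule finite_PiE_dflt) (use assms in auto)

definition depends_on :: "'i set \<Rightarrow> (('i \<Rightarrow> 'v) \<Rightarrow> real) \<Rightarrow> bool" where
  "depends_on A f \<longleftrightarrow> (\<forall>x y. (\<forall>j\<in>A. x j = y j) \<longrightarrow> f x = f y)"

lemma E_Pi_indep:
  fixes p :: "'i \<Rightarrow> 'v pmf"
  assumes J: "finite J" "\<And>j. j \<in> J \<Longrightarrow> finite (set_pmf (p j))"
    and A: "A \<subseteq> J" "A \<inter> B = {}" and f: "depends_on A f" and g: "depends_on B g"
  shows "E (Pi_pmf J d p) (\<lambda>x. f x * g x) = E (Pi_pmf J d p) f * E (Pi_pmf J d p) g"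
proof -
  let ?m = "\<lambda>z j. if j \<in> A then fst z j else snd z j :: 'v"
  let ?P = "Pi_pmf A d p" and ?Q = "Pi_pmf (J - A) d p"
  have fin: "finite (set_pmf ?P)" "finite (set_pmf ?Q)"
    using J A by (auto intro!: finite_set_Pi_pmf intro: finite_subset)
  have "Pi_pmf J d p = Pi_pmf (A \<union> (J - A)) d p" using A by (simp add: Un_absorb1)
  also have "\<dots> = map_pmf (\<lambda>(f,g) x. if x \<in> A then f x else g x) (pair_pmf ?P ?Q)"
    using J A by (intro Pi_pmf_union) (auto intro: finite_subset)
  also have "\<dots> = map_pmf ?m (pair_pmf ?P ?Q)" by (intro map_pmf_cong) auto
  finally have M: "Pi_pmf J d p = map_pmf ?m (pair_pmf ?P ?Q)" .
  have ff: "f (?m z) = f (fst z)" for z 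
    by (rule f[unfolded depends_on_def, rule_format]) auto
  have gg: "g (?m z) = g (snd z)" for z 
    by (rule g[unfolded depends_on_def, rule_format]) (use A(2) in auto)
  have "E (Pi_pmf J d p) (\<lambda>x. f x * g x) = E ?P f * E ?Q g"
    unfolding M integral_map_pmf ff gg by (rule E_pair_prod[OF fin])
  moreover have "E (Pi_pmf J d p) f = E ?P f"
    using E_pair_prod[OF fin, of f "\<lambda>_. 1"] unfolding M integral_map_pmf ff by simp
  moreover have "E (Pi_pmf J d p) g = E ?Q g"
    using E_pair_prod[OF fin, of "\<lambda>_. 1" g] unfolding M integral_map_pmf gg by simp
  ultimately show ?thesis by simp
qed

definition bern :: "'i set \<Rightarrow> ('i \<Rightarrow> real) \<Rightarrow> ('i \<Rightarrow> bool) pmf" where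
  "bern J p = Pi_pmf J False (\<lambda>j. bernoulli_pmf (p j))"

definition cnt :: "'i set \<Rightarrow> ('i \<Rightarrow> bool) \<Rightarrow> real" where
  "cnt I x = (\<Sum>i\<in>I. of_bool (x i))"

lemma cnt_insert: "finite I \<Longrightarrow> i \<notin> I \<Longrightarrow> cnt (insert i I) x = of_bool (x i) + cnt I x"
  unfolding cnt_def by (rule sum.insert)

lemma finite_set_bern [simp]: "finite J \<Longrightarrow> finite (set_pmf (bern J p))"
  unfolding bern_def by (rule finite_set_Pi_pmf) auto

lemma depends_on_cnt: "I \<subseteq> A \<Longrightarrow> depends_on A (\<lambda>x. h (cnt I x))"
  unfolding depends_on_def cnt_def by (auto intro!: arg_cong[of _ _ h] sum.cong)

lemma depends_on_coord: "j \<in> A \<Longrightarrow> depends_on A (\<lambda>x. h (x j))"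
  unfolding depends_on_def by auto

lemma depends_on_mult:
  "depends_on A f \<Longrightarrow> depends_on A g \<Longrightarrow> depends_on A (\<lambda>x. f x * g x)"
  unfolding depends_on_def by metis

lemma E_bern_indep:
  assumes "finite J" "A \<subseteq> J" "A \<inter> B = {}" "depends_on A f" "depends_on B g"
  shows "E (bern J p) (\<lambda>x. f x * g x) = E (bern J p) f * E (bern J p) g"
  unfolding bern_def by (rule E_Pi_indep) (use assms in auto)

lemma E_bern_coord:
  assumes "finite J" "j \<in> J" "p j \<in> {0..1}"
  shows "E (bern J p) (\<lambda>x. h (x j)) = p j * h True + (1 - p j) * h False"
proof -
  have "E (bern J p) (\<lambda>x. h (x j)) = E (map_pmf (\<lambda>x. x j) (bern J p)) h" by simp
  also have "map_pmf (\<lambda>x. x j) (bern J p) = bernoulli_pmf (p j)"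
    unfolding bern_def by (subst Pi_pmf_component) (use assms in auto)
  finally show ?thesis using assms by simp
qed

lemma mgf_bern:
  assumes J: "finite J" "I \<subseteq> J" and p: "\<And>j. j \<in> I \<Longrightarrow> p j \<in> {0..1}"
  shows "E (bern J p) (\<lambda>x. exp (l * cnt I x)) = (\<Prod>i\<in>I. 1 - p i + p i * exp l)"
proof -
  have "finite I" using J finite_subset by auto
  then show ?thesis using J(2) p
  proof (induction I rule: finite_induct)
    case empty
    then show ?case by (simp add: cnt_def)
  next
    case (insert i I)
    have "E (bern J p) (\<lambda>x. exp (l * cnt (insert i I) x)) =
        E (bern J p) (\<lambda>x. exp (l * of_bool (x i)) * exp (l * cnt I x))"
      using insert.hyps by (simp add: cnt_insert distrib_left exp_add)
    also have "\<dots> = E (bern J p) (\<lambda>x. exp (l * of_bool (x i))) * E (bern J p) (\<lambda>x. exp (l * cnt I x))"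
      by (rule E_bern_indep[where A = "{i}" and B = I])
         (use insert.hyps insert.prems J in \<open>auto intro!: depends_on_cnt depends_on_coord\<close>)
    also have "E (bern J p) (\<lambda>x. exp (l * of_bool (x i))) = 1 - p i + p i * exp l"
      using E_bern_coord[OF J(1), of i p "\<lambda>y. exp (l * of_bool y)"] insert.prems by simp
    finally show ?case using insert by simp
  qed
qed

text \<open>A second order Taylor expansion. The derivative of the error is the deviation of the tilted success
probability from its linearisation, and is at most \<open>3 * p * t\<^sup>2\<close>.\<close>

lemma bernoulli_log_mgf:
  fixes p l :: real
  assumes p: "0 \<le> p" "p \<le> 1" and l: "0 \<le> l" "l \<le> 1"
  shows "\<bar>ln (1 - p + p * exp l) - (l * p + l\<^sup>2 * (p * (1 - p)) / 2)\<bar> \<le> p * l ^ 3"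
proof -
  define g where "g = (\<lambda>t. ln (1 - p + p * exp t) - (t * p + t\<^sup>2 * (p * (1 - p)) / 2))"
  define g' where "g' = (\<lambda>t. p * exp t / (1 - p + p * exp t) - (p + t * (p * (1 - p))))"
  have pos: "1 - p + p * exp t \<ge> 1" if "t \<ge> 0" for t
    using mult_left_mono[of 1 "exp t" p] p that by simp
  have g: "(g has_real_derivative g' t) (at t)" if "t \<ge> 0" for t
    unfolding g_def g'_def using pos[OF that]
    by (auto intro!: derivative_eq_intros simp: power2_eq_square field_simps)
  have g'_bound: "\<bar>g' t\<bar> \<le> 3 * p * t\<^sup>2" if t: "0 \<le> t" "t \<le> 1" for t
  proof -
    define u where "u = exp t - 1"
    have u: "t \<le> u" "u \<le> t + t\<^sup>2"
      using exp_ge_add_one_self[of t] exp_bound[OF t] unfolding u_def by linarith+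
    have d: "1 + p * u \<ge> 1" using p u t by simp
    have eq: "g' t = p * (1 - p) * ((u - t - t * p * u) / (1 + p * u))"
      using d unfolding g'_def u_def by (simp add: field_simps)
    have tt: "t * u \<le> 2 * t\<^sup>2"
      using mult_left_mono[OF u(2), of t] mult_left_mono[of "t\<^sup>2" t t] mult_left_mono[of t 1 t] t
      by (simp add: power2_eq_square algebra_simps)
    have "t * p * u \<le> t * u" using p t u mult_right_mono[of p 1 "t * u"] by (simp add: mult_ac)
    moreover have "0 \<le> t * p * u" using p t u by auto
    ultimately have n: "\<bar>u - t - t * p * u\<bar> \<le> 2 * t\<^sup>2"
      using u tt zero_le_power2[of t] unfolding abs_le_iff by linarith
    have "\<bar>(u - t - t * p * u) / (1 + p * u)\<bar> \<le> \<bar>u - t - t * p * u\<bar>"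
      using frac_le[of "\<bar>u - t - t * p * u\<bar>" "\<bar>u - t - t * p * u\<bar>" 1 "1 + p * u"] d by simp
    then have "\<bar>(u - t - t * p * u) / (1 + p * u)\<bar> \<le> 2 * t\<^sup>2" using n by linarith
    then have "\<bar>g' t\<bar> \<le> (p * (1 - p)) * (2 * t\<^sup>2)"
      unfolding eq abs_mult using p by (intro mult_mono) (auto simp: abs_mult)
    also have "\<dots> \<le> p * (2 * t\<^sup>2)" using p by (intro mult_right_mono) (auto simp: mult_left_le)
    also have "\<dots> \<le> 3 * p * t\<^sup>2" using p by (simp add: mult_right_mono)
    finally show ?thesis .
  qed
  have "g 0 - p * 0 ^ 3 \<ge> g l - p * l ^ 3"
  proof (rule DERIV_nonpos_imp_nonincreasing[OF l(1)])
    fix t assume "0 \<le> t" "t \<le> l"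
    then show "\<exists>y. ((\<lambda>t. g t - p * t ^ 3) has_real_derivative y) (at t) \<and> y \<le> 0"
      using g[of t] g'_bound[of t] l
      by (intro exI[of _ "g' t - 3 * p * t\<^sup>2"]) (auto intro!: derivative_eq_intros)
  qed
  moreover have "g 0 + p * 0 ^ 3 \<le> g l + p * l ^ 3"
  proof (rule DERIV_nonneg_imp_nondecreasing[OF l(1)])
    fix t assume "0 \<le> t" "t \<le> l"
    then show "\<exists>y. ((\<lambda>t. g t + p * t ^ 3) has_real_derivative y) (at t) \<and> y \<ge> 0"
      using g[of t] g'_bound[of t] l
      by (intro exI[of _ "g' t + 3 * p * t\<^sup>2"]) (auto intro!: derivative_eq_intros)
  qed
  moreover have "g 0 = 0" by (simp add: g_def)
  ultimately have "\<bar>g l\<bar> \<le> p * l ^ 3" by (simp add: abs_le_iff)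
  then show ?thesis by (simp add: g_def)
qed

lemma mgf_bern_bounds:
  assumes J: "finite J" "I \<subseteq> J" and p: "\<And>j. j \<in> I \<Longrightarrow> p j \<in> {0..1}" and l: "0 \<le> l" "l \<le> 1"
  defines "M \<equiv> \<Sum>i\<in>I. p i" and "V \<equiv> \<Sum>i\<in>I. p i * (1 - p i)"
  shows "exp (l * M + l\<^sup>2 * V / 2 - l ^ 3 * M) \<le> E (bern J p) (\<lambda>x. exp (l * cnt I x))"
    and "E (bern J p) (\<lambda>x. exp (l * cnt I x)) \<le> exp (l * M + l\<^sup>2 * V / 2 + l ^ 3 * M)"
proof -
  have fI: "finite I" using J finite_subset by auto
  have pos: "1 - p i + p i * exp l > 0" if "i \<in> I" for i
    using mult_left_mono[of 1 "exp l" "p i"] p[OF that] l by simp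
  have ln: "\<bar>ln (1 - p i + p i * exp l) - (l * p i + l\<^sup>2 * (p i * (1 - p i)) / 2)\<bar> \<le> p i * l ^ 3" if "i \<in> I" for i
    using bernoulli_log_mgf[of "p i" l] p[OF that] l by auto
  have eq: "E (bern J p) (\<lambda>x. exp (l * cnt I x)) = exp (\<Sum>i\<in>I. ln (1 - p i + p i * exp l))"
    unfolding exp_sum[OF fI] 
    by (subst mgf_bern[OF J]) (erule p, auto simp: pos intro!: prod.cong)
  have lo: "l * M + l\<^sup>2 * V / 2 - l ^ 3 * M = (\<Sum>i\<in>I. (l * p i + l\<^sup>2 * (p i * (1 - p i)) / 2) - p i * l ^ 3)"
    unfolding M_def V_def by (simp add: sum_subtractf sum.distrib sum_distrib_left sum_distrib_right sum_divide_distrib mult_ac)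
  have hi: "l * M + l\<^sup>2 * V / 2 + l ^ 3 * M = (\<Sum>i\<in>I. (l * p i + l\<^sup>2 * (p i * (1 - p i)) / 2) + p i * l ^ 3)"
    unfolding M_def V_def by (simp add: sum.distrib sum_distrib_left sum_distrib_right sum_divide_distrib mult_ac)
  have "l * M + l\<^sup>2 * V / 2 - l ^ 3 * M \<le> (\<Sum>i\<in>I. ln (1 - p i + p i * exp l))"
    unfolding lo by (rule sum_mono) (use ln in \<open>force simp: abs_le_iff\<close>)
  then show "exp (l * M + l\<^sup>2 * V / 2 - l ^ 3 * M) \<le> E (bern J p) (\<lambda>x. exp (l * cnt I x))"
    unfolding eq by simp
  have "(\<Sum>i\<in>I. ln (1 - p i + p i * exp l)) \<le> l * M + l\<^sup>2 * V / 2 + l ^ 3 * M"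
    unfolding hi by (rule sum_mono) (use ln in \<open>force simp: abs_le_iff\<close>)
  then show "E (bern J p) (\<lambda>x. exp (l * cnt I x)) \<le> exp (l * M + l\<^sup>2 * V / 2 + l ^ 3 * M)"
    unfolding eq by simp
qed


text \<open>The cubic Taylor error is of order \<open>L * sqrt L * M / \<sigma> ^ 3\<close>, which is \<open>o(L)\<close> as soon as \<open>L\<close> is
negligible against the variance and \<open>M\<close> is comparable to it.\<close>

lemma near_gaussian_cnt:
  assumes J: "finite J" "I \<subseteq> J" and p: "\<And>j. j \<in> I \<Longrightarrow> p j \<in> {0..1}"
  defines "M \<equiv> \<Sum>i\<in>I. p i" and "V \<equiv> \<Sum>i\<in>I. p i * (1 - p i)"
  assumes L: "L > 0" and \<sigma>: "\<sigma> > 0" and K: "K \<ge> 0" "K * sqrt L \<le> \<sigma>"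
    and shift: "\<bar>(M - \<mu>) / (\<sigma> * sqrt L) - v\<bar> \<le> h" and var: "\<bar>V / \<sigma>\<^sup>2 - 1\<bar> \<le> h"
    and rest: "sqrt L * M / \<sigma> ^ 3 \<le> h" and h: "h * (K + K\<^sup>2 + K ^ 3) \<le> \<eta>"
  shows "near_gaussian (bern J p) (\<lambda>x. sqrt L * ((cnt I x - \<mu>) / \<sigma>)) L K \<eta> v"
  unfolding near_gaussian_def
proof (intro ballI)
  fix l assume l: "l \<in> {0..K}"
  define l' where "l' = l * sqrt L / \<sigma>"
  define s where "s = sqrt L"
  have s: "s > 0" "L = s\<^sup>2" using L by (auto simp: s_def)
  have h0: "h \<ge> 0" using var by linarith
  have "l * sqrt L \<le> K * sqrt L" using l L by (intro mult_right_mono) auto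
  with K(2) have "l * sqrt L \<le> \<sigma>" by linarith
  then have l': "0 \<le> l'" "l' \<le> 1"
    using l L \<sigma> by (auto simp: l'_def divide_le_eq)
  have M0: "M \<ge> 0" unfolding M_def using p by (intro sum_nonneg) auto
  have eq: "E (bern J p) (\<lambda>x. exp (l * (sqrt L * ((cnt I x - \<mu>) / \<sigma>)))) =
      exp (- l' * \<mu>) * E (bern J p) (\<lambda>x. exp (l' * cnt I x))"
  proof -
    have "(\<lambda>x. exp (l * (sqrt L * ((cnt I x - \<mu>) / \<sigma>)))) = (\<lambda>x. exp (- l' * \<mu>) * exp (l' * cnt I x))"
      unfolding exp_add[symmetric] using \<sigma> by (intro ext arg_cong[of _ _ exp]) (simp add: l'_def field_simps)
    then show ?thesis by (simp only:) simp
  qed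
  define d1 d2 d3 where "d1 = (M - \<mu>) / (\<sigma> * sqrt L) - v" and "d2 = V / \<sigma>\<^sup>2 - 1"
    and "d3 = sqrt L * M / \<sigma> ^ 3"
  have d: "\<bar>d1\<bar> \<le> h" "\<bar>d2\<bar> \<le> h" "0 \<le> d3" "d3 \<le> h"
    using shift var rest M0 L \<sigma> by (auto simp: d1_def d2_def d3_def)
  have "l * \<bar>d1\<bar> + l\<^sup>2 / 2 * \<bar>d2\<bar> + l ^ 3 * d3 \<le> K * h + K\<^sup>2 * h + K ^ 3 * h"
    using l d h0 by (intro add_mono mult_mono power_mono order_trans[OF _ power_mono[of l K 2]]) auto
  then have D: "l * \<bar>d1\<bar> + l\<^sup>2 / 2 * \<bar>d2\<bar> + l ^ 3 * d3 \<le> \<eta>" using h by (simp add: algebra_simps)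
  have a1: "\<bar>l * d1\<bar> \<le> l * \<bar>d1\<bar>" and a2: "\<bar>l\<^sup>2 / 2 * d2\<bar> \<le> l\<^sup>2 / 2 * \<bar>d2\<bar>" using l by (auto simp: abs_mult)
  have eM: "l' * (M - \<mu>) = L * (l * (v + d1))"
    using \<sigma> s(1) unfolding d1_def l'_def s_def[symmetric] s(2) by (simp add: field_simps power2_eq_square)
  have eV: "l'\<^sup>2 * V / 2 = L * (l\<^sup>2 / 2 * (1 + d2))"
    using \<sigma> s(1) unfolding d2_def l'_def s_def[symmetric] s(2) by (simp add: field_simps power2_eq_square)
  have e3: "l' ^ 3 * M = L * (l ^ 3 * d3)"
    using \<sigma> s(1) unfolding d3_def l'_def s_def[symmetric] s(2) by (simp add: field_simps power2_eq_square power3_eq_cube)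
  have lo: "L * (l * v + l\<^sup>2 / 2 - \<eta>) \<le> - l' * \<mu> + (l' * M + l'\<^sup>2 * V / 2 - l' ^ 3 * M)"
  proof -
    have "l * v + l\<^sup>2 / 2 - \<eta> \<le> l * (v + d1) + l\<^sup>2 / 2 * (1 + d2) - l ^ 3 * d3"
      using D a1 a2 unfolding distrib_left abs_le_iff by linarith
    then have "L * (l * v + l\<^sup>2 / 2 - \<eta>) \<le> L * (l * (v + d1) + l\<^sup>2 / 2 * (1 + d2) - l ^ 3 * d3)"
      using L by (intro mult_left_mono) auto
    also have "\<dots> = l' * (M - \<mu>) + l'\<^sup>2 * V / 2 - l' ^ 3 * M"
      unfolding eM eV e3 by (simp only: distrib_left right_diff_distrib)
    finally show ?thesis by (simp add: algebra_simps)
  qed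
  have hi: "- l' * \<mu> + (l' * M + l'\<^sup>2 * V / 2 + l' ^ 3 * M) \<le> L * (l * v + l\<^sup>2 / 2 + \<eta>)"
  proof -
    have "l * (v + d1) + l\<^sup>2 / 2 * (1 + d2) + l ^ 3 * d3 \<le> l * v + l\<^sup>2 / 2 + \<eta>"
      using D a1 a2 unfolding distrib_left abs_le_iff by linarith
    then have "L * (l * (v + d1) + l\<^sup>2 / 2 * (1 + d2) + l ^ 3 * d3) \<le> L * (l * v + l\<^sup>2 / 2 + \<eta>)"
      using L by (intro mult_left_mono) auto
    also have "L * (l * (v + d1) + l\<^sup>2 / 2 * (1 + d2) + l ^ 3 * d3) = l' * (M - \<mu>) + l'\<^sup>2 * V / 2 + l' ^ 3 * M"
      unfolding eM eV e3 by (simp only: distrib_left)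
    finally show ?thesis by (simp add: algebra_simps)
  qed
  have mgf: "exp (l' * M + l'\<^sup>2 * V / 2 - l' ^ 3 * M) \<le> E (bern J p) (\<lambda>x. exp (l' * cnt I x))"
     "E (bern J p) (\<lambda>x. exp (l' * cnt I x)) \<le> exp (l' * M + l'\<^sup>2 * V / 2 + l' ^ 3 * M)"
    unfolding M_def V_def using mgf_bern_bounds[OF J _ l', of p] p by auto
  show "exp (L * (l * v + l\<^sup>2 / 2 - \<eta>)) \<le> E (bern J p) (\<lambda>x. exp (l * (sqrt L * ((cnt I x - \<mu>) / \<sigma>)))) \<and>
        E (bern J p) (\<lambda>x. exp (l * (sqrt L * ((cnt I x - \<mu>) / \<sigma>)))) \<le> exp (L * (l * v + l\<^sup>2 / 2 + \<eta>))"
  proof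
    have "exp (L * (l * v + l\<^sup>2 / 2 - \<eta>)) \<le> exp (- l' * \<mu>) * exp (l' * M + l'\<^sup>2 * V / 2 - l' ^ 3 * M)"
      unfolding exp_add[symmetric] exp_le_cancel_iff by (rule lo)
    also have "\<dots> \<le> exp (- l' * \<mu>) * E (bern J p) (\<lambda>x. exp (l' * cnt I x))"
      by (rule mult_left_mono[OF mgf(1)]) auto
    finally show "exp (L * (l * v + l\<^sup>2 / 2 - \<eta>)) \<le> E (bern J p) (\<lambda>x. exp (l * (sqrt L * ((cnt I x - \<mu>) / \<sigma>))))"
      unfolding eq .
    have "exp (- l' * \<mu>) * E (bern J p) (\<lambda>x. exp (l' * cnt I x)) \<le>
        exp (- l' * \<mu>) * exp (l' * M + l'\<^sup>2 * V / 2 + l' ^ 3 * M)"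
      by (rule mult_left_mono[OF mgf(2)]) auto
    also have "\<dots> \<le> exp (L * (l * v + l\<^sup>2 / 2 + \<eta>))"
      unfolding exp_add[symmetric] exp_le_cancel_iff by (rule hi)
    finally show "E (bern J p) (\<lambda>x. exp (l * (sqrt L * ((cnt I x - \<mu>) / \<sigma>)))) \<le> exp (L * (l * v + l\<^sup>2 / 2 + \<eta>))"
      unfolding eq .
  qed
qed

text \<open>By how much the presence of \<open>e\<close> raises the probability that the count of \<open>I\<close> exceeds \<open>u\<close>.\<close>

definition jump :: "'i set \<Rightarrow> ('i \<Rightarrow> real) \<Rightarrow> 'i set \<Rightarrow> real \<Rightarrow> 'i \<Rightarrow> real" where
  "jump J p I u e = Pr (bern J p) (\<lambda>x. cnt (I - {e}) x > u - 1) - Pr (bern J p) (\<lambda>x. cnt (I - {e}) x > u)"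

lemma exceed_split:
  assumes "finite I" "e \<in> I"
  shows "of_bool (cnt I x > u) = of_bool (x e) * of_bool (cnt (I - {e}) x > u - 1)
           + (of_bool (\<not> x e) * of_bool (cnt (I - {e}) x > u) :: real)"
proof -
  have "cnt I x = of_bool (x e) + cnt (I - {e}) x"
    using cnt_insert[of "I - {e}" e x] assms by (simp add: insert_absorb)
  then show ?thesis by (cases "x e") auto
qed

text \<open>Given the common coordinate \<open>e\<close> the two counts are independent, so that their exceedances are correlated
only through the variance \<open>p e * (1 - p e)\<close> of that coordinate.\<close>

lemma cov_exceed:
  assumes J: "finite J" "I1 \<subseteq> J" "I2 \<subseteq> J" and e: "I1 \<inter> I2 = {e}" and p: "p e \<in> {0..1}"
  shows "E (bern J p) (\<lambda>x. of_bool (cnt I1 x > u) * of_bool (cnt I2 x > u))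
           - Pr (bern J p) (\<lambda>x. cnt I1 x > u) * Pr (bern J p) (\<lambda>x. cnt I2 x > u)
         = p e * (1 - p e) * jump J p I1 u e * jump J p I2 u e"
proof -
  let ?M = "bern J p"
  define A where "A = (\<lambda>I w x. of_bool (cnt (I - {e}) x > w) :: real)"
  have fin: "finite I1" "finite I2" "e \<in> I1" "e \<in> I2" "e \<in> J" using J e finite_subset by auto
  have finM: "finite (set_pmf ?M)" using J by simp
  have dep: "depends_on (I - {e}) (A I w)" for I w
    unfolding A_def by (rule depends_on_cnt) auto
  have coord: "depends_on {e} (\<lambda>x. of_bool (x e) :: real)" "depends_on {e} (\<lambda>x. of_bool (\<not> x e) :: real)"
    by (auto simp: depends_on_def)
  have E1: "E ?M (\<lambda>x. of_bool (x e)) = p e" "E ?M (\<lambda>x. of_bool (\<not> x e)) = 1 - p e"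
    using E_bern_coord[of J e p "\<lambda>b. of_bool b"] E_bern_coord[of J e p "\<lambda>b. of_bool (\<not> b)"] J fin p by auto
  have AA: "E ?M (\<lambda>x. A I1 w x * A I2 w x) = E ?M (A I1 w) * E ?M (A I2 w)" for w
    by (rule E_bern_indep[OF J(1) _ _ dep dep]) (use J e in auto)
  have tri1: "E ?M (\<lambda>x. of_bool (x e) * (A I1 w x * A I2 w x)) = p e * (E ?M (A I1 w) * E ?M (A I2 w))" for w
    unfolding AA[symmetric] E1(1)[symmetric]
    by (rule E_bern_indep[where A = "{e}" and B = "(I1 \<union> I2) - {e}"])
       (use J fin coord in \<open>auto intro!: depends_on_mult depends_on_cnt simp: A_def\<close>)
  have tri2: "E ?M (\<lambda>x. of_bool (\<not> x e) * (A I1 w x * A I2 w x)) = (1 - p e) * (E ?M (A I1 w) * E ?M (A I2 w))" for w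
    unfolding AA[symmetric] E1(2)[symmetric]
    by (rule E_bern_indep[where A = "{e}" and B = "(I1 \<union> I2) - {e}"])
       (use J fin coord in \<open>auto intro!: depends_on_mult depends_on_cnt simp: A_def\<close>)
  have si: "E ?M (\<lambda>x. of_bool (x e) * A I w x) = p e * E ?M (A I w)" for I w
    unfolding E1(1)[symmetric] by (rule E_bern_indep[OF J(1) _ _ coord(1) dep]) (use fin in auto)
  have si': "E ?M (\<lambda>x. of_bool (\<not> x e) * A I w x) = (1 - p e) * E ?M (A I w)" for I w
    unfolding E1(2)[symmetric] by (rule E_bern_indep[OF J(1) _ _ coord(2) dep]) (use fin in auto)
  have P: "Pr ?M (\<lambda>x. cnt I x > u) = p e * E ?M (A I (u - 1)) + (1 - p e) * E ?M (A I u)"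
    if "I \<subseteq> J" "e \<in> I" for I
  proof -
    have "finite I" by (rule finite_subset[OF that(1) J(1)])
    show ?thesis
      unfolding Pr_eq_E exceed_split[OF \<open>finite I\<close> that(2)] E_add[OF finM]
      using si[of I "u - 1"] si'[of I u] unfolding A_def by (simp only:)
  qed
  have "E ?M (\<lambda>x. of_bool (cnt I1 x > u) * of_bool (cnt I2 x > u)) =
     E ?M (\<lambda>x. of_bool (x e) * (A I1 (u - 1) x * A I2 (u - 1) x) + of_bool (\<not> x e) * (A I1 u x * A I2 u x))"
  proof (rule E_cong)
    fix x show "of_bool (cnt I1 x > u) * of_bool (cnt I2 x > u) =
       of_bool (x e) * (A I1 (u - 1) x * A I2 (u - 1) x) + of_bool (\<not> x e) * (A I1 u x * A I2 u x)"
      unfolding exceed_split[OF fin(1,3), of u x] exceed_split[OF fin(2,4), of u x] A_def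
      by (cases "x e") auto
  qed
  also have "\<dots> = p e * (E ?M (A I1 (u - 1)) * E ?M (A I2 (u - 1))) + (1 - p e) * (E ?M (A I1 u) * E ?M (A I2 u))"
    unfolding E_add[OF finM] tri1 tri2 ..
  finally have EE: "E ?M (\<lambda>x. of_bool (cnt I1 x > u) * of_bool (cnt I2 x > u)) = \<dots>" .
  have jE: "jump J p I u e = E ?M (A I (u - 1)) - E ?M (A I u)" for I
    unfolding jump_def Pr_eq_E A_def ..
  show ?thesis unfolding EE P[OF J(2) fin(3)] P[OF J(3) fin(4)] jE
    by (simp add: algebra_simps)
qed

text \<open>An integration by parts for Bernoulli fields: the weighted jumps add up to the covariance of the
  count with the indicator of its exceedance. It bounds each jump by about
  \<open>Pr (cnt > u) / sigma\<close> without a local limit theorem.\<close>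

lemma sum_jump:
  assumes J: "finite J" "I \<subseteq> J" and p: "\<And>j. j \<in> I \<Longrightarrow> p j \<in> {0..1}"
  shows "(\<Sum>e\<in>I. p e * (1 - p e) * jump J p I u e)
         = E (bern J p) (\<lambda>x. (cnt I x - (\<Sum>e\<in>I. p e)) * of_bool (cnt I x > u))"
proof -
  let ?M = "bern J p"
  have fin: "finite I" by (rule finite_subset[OF J(2,1)])
  have finM: "finite (set_pmf ?M)" using J by simp
  have term_eq: "p e * (1 - p e) * jump J p I u e = E ?M (\<lambda>x. (of_bool (x e) - p e) * of_bool (cnt I x > u))"
    if e: "e \<in> I" for e
  proof -
    define A where "A = (\<lambda>w x. of_bool (cnt (I - {e}) x > w) :: real)"
    have dep: "depends_on (I - {e}) (A w)" for w
      unfolding A_def by (rule depends_on_cnt) auto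
    have coord: "depends_on {e} (\<lambda>x. of_bool (x e) * (1 - p e))" "depends_on {e} (\<lambda>x. of_bool (\<not> x e) * p e)"
      by (auto simp: depends_on_def)
    have "E ?M (\<lambda>x. (of_bool (x e) - p e) * of_bool (cnt I x > u)) =
      E ?M (\<lambda>x. (of_bool (x e) * (1 - p e)) * A (u - 1) x - (of_bool (\<not> x e) * p e) * A u x)"
      unfolding exceed_split[OF fin e] A_def by (intro E_cong) auto
    also have "\<dots> = E ?M (\<lambda>x. of_bool (x e) * (1 - p e)) * E ?M (A (u - 1))
        - E ?M (\<lambda>x. of_bool (\<not> x e) * p e) * E ?M (A u)"
      unfolding E_diff[OF finM]
      by (intro arg_cong2[where f = "(-)"] E_bern_indep[OF J(1) _ _ coord(1) dep] E_bern_indep[OF J(1) _ _ coord(2) dep])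
         (use e J in auto)
    also have "E ?M (\<lambda>x. of_bool (x e) * (1 - p e)) = p e * (1 - p e)"
      using E_bern_coord[OF J(1), of e p "\<lambda>b. of_bool b * (1 - p e)"] e J p by auto
    also have "E ?M (\<lambda>x. of_bool (\<not> x e) * p e) = p e * (1 - p e)"
      using E_bern_coord[OF J(1), of e p "\<lambda>b. of_bool (\<not> b) * p e"] e J p by auto
    finally show ?thesis unfolding jump_def Pr_eq_E A_def by (simp add: algebra_simps)
  qed
  have "(\<Sum>e\<in>I. p e * (1 - p e) * jump J p I u e) = E ?M (\<lambda>x. \<Sum>e\<in>I. (of_bool (x e) - p e) * of_bool (cnt I x > u))"
    unfolding E_sum[OF finM] by (rule sum.cong) (auto simp: term_eq)
  also have "\<dots> = E ?M (\<lambda>x. (cnt I x - (\<Sum>e\<in>I. p e)) * of_bool (cnt I x > u))"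
    unfolding cnt_def sum_subtractf[symmetric] sum_distrib_right ..
  finally show ?thesis .
qed

definition two_class_tail :: "real \<Rightarrow> real \<Rightarrow> nat \<Rightarrow> nat \<Rightarrow> real \<Rightarrow> real" where
  "two_class_tail pa pb m1 m2 u =
     Pr (pair_pmf (binomial_pmf m1 pa) (binomial_pmf m2 pb)) (\<lambda>z. real (fst z) + real (snd z) > u)"

text \<open>In the null graph this expresses every exceedance probability by the block sizes alone, whatever the
assignment.\<close>

lemma Pr_cnt_two_class:
  assumes J: "finite J" "Ia \<subseteq> J" "Ib \<subseteq> J" "Ia \<inter> Ib = {}"
    and pa: "\<And>j. j \<in> Ia \<Longrightarrow> p j = pa" "pa \<in> {0..1}" and pb: "\<And>j. j \<in> Ib \<Longrightarrow> p j = pb" "pb \<in> {0..1}"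
  shows "Pr (bern J p) (\<lambda>x. cnt (Ia \<union> Ib) x > u) = two_class_tail pa pb (card Ia) (card Ib) u"
proof -
  let ?I = "Ia \<union> Ib"
  let ?A = "Pi_pmf Ia False (\<lambda>_. bernoulli_pmf pa)" and ?B = "Pi_pmf Ib False (\<lambda>_. bernoulli_pmf pb)"
  have fin: "finite Ia" "finite Ib" by (rule finite_subset[OF J(2,1)], rule finite_subset[OF J(3,1)])
  have "bern ?I p = map_pmf (\<lambda>f x. if x \<in> ?I then f x else False) (bern J p)"
    unfolding bern_def by (rule Pi_pmf_subset) (use J in auto)
  moreover have "cnt ?I (\<lambda>x. if x \<in> ?I then f x else False) = cnt ?I f" for f
    unfolding cnt_def by (intro sum.cong) auto
  ultimately have 1: "Pr (bern J p) (\<lambda>x. cnt ?I x > u) = Pr (bern ?I p) (\<lambda>x. cnt ?I x > u)"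
    by (simp add: vimage_def)
  have "bern ?I p = map_pmf (\<lambda>(f,g) x. if x \<in> Ia then f x else g x)
      (pair_pmf (Pi_pmf Ia False (\<lambda>j. bernoulli_pmf (p j))) (Pi_pmf Ib False (\<lambda>j. bernoulli_pmf (p j))))"
    unfolding bern_def by (rule Pi_pmf_union) (use fin J in auto)
  also have "Pi_pmf Ia False (\<lambda>j. bernoulli_pmf (p j)) = ?A" by (rule Pi_pmf_cong) (auto simp: pa)
  also have "Pi_pmf Ib False (\<lambda>j. bernoulli_pmf (p j)) = ?B" by (rule Pi_pmf_cong) (auto simp: pb)
  finally have 2: "bern ?I p = map_pmf (\<lambda>(f,g) x. if x \<in> Ia then f x else g x) (pair_pmf ?A ?B)" .
  have c: "cnt ?I (\<lambda>x. if x \<in> Ia then f x else g x) = real (card {x\<in>Ia. f x}) + real (card {x\<in>Ib. g x})" for f g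
  proof -
    have "cnt ?I (\<lambda>x. if x \<in> Ia then f x else g x) = (\<Sum>i\<in>Ia. of_bool (f i)) + (\<Sum>i\<in>Ib. of_bool (g i))"
      unfolding cnt_def sum.union_disjoint[OF fin J(4)]
      by (intro arg_cong2[where f = "(+)"] sum.cong refl) (use J(4) in auto)
    then show ?thesis using fin by (simp add: Int_def)
  qed
  have "pair_pmf (binomial_pmf (card Ia) pa) (binomial_pmf (card Ib) pb) =
      map_pmf (\<lambda>(f, g). (card {x\<in>Ia. f x}, card {x\<in>Ib. g x})) (pair_pmf ?A ?B)"
    unfolding map_pair
    by (intro arg_cong2[where f = pair_pmf] binomial_pmf_altdef') (use fin pa pb in auto)
  then show ?thesis unfolding two_class_tail_def 1 2
    by (simp add: vimage_def case_prod_unfold c)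
qed

section \<open>Monotone coupling\<close>

text \<open>A failure at parameter \<open>p\<close> is turned into a success with probability \<open>(q - p) / (1 - p)\<close>, which makes
the second component a Bernoulli variable with parameter \<open>q\<close>.\<close>

definition coupled_bernoulli :: "real \<Rightarrow> real \<Rightarrow> (bool \<times> bool) pmf" where
  "coupled_bernoulli p q =
     map_pmf (\<lambda>(y, z). (y, y \<or> z)) (pair_pmf (bernoulli_pmf p) (bernoulli_pmf ((q - p) / (1 - p))))"

definition coupling :: "'i set \<Rightarrow> ('i \<Rightarrow> real) \<Rightarrow> ('i \<Rightarrow> real) \<Rightarrow> ('i \<Rightarrow> bool \<times> bool) pmf" where
  "coupling J p q = Pi_pmf J (False, False) (\<lambda>j. coupled_bernoulli (p j) (q j))"

lemma coupled_bernoulli_fst: "map_pmf fst (coupled_bernoulli p q) = bernoulli_pmf p"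
  unfolding coupled_bernoulli_def pmf.map_comp o_def case_prod_unfold fst_conv
  by (rule map_fst_pair_pmf)

lemma pmf_bool_eqI:
  fixes p q :: "bool pmf"
  assumes "pmf p True = pmf q True"
  shows "p = q"
proof (rule pmf_eqI)
  have f: "pmf r False = 1 - pmf r True" for r :: "bool pmf"
    using sum_pmf_eq_1[OF finite subset_UNIV, of r] unfolding UNIV_bool by simp
  fix b show "pmf p b = pmf q b" using assms by (cases b) (auto simp: f)
qed

lemma Pr_coupled:
  assumes "0 \<le> p" "p \<le> q" "q \<le> 1" "p < 1"
  shows "map_pmf snd (coupled_bernoulli p q) = bernoulli_pmf q"
    and "Pr (coupled_bernoulli p q) (\<lambda>z. snd z \<and> \<not> fst z) = q - p"
proof -
  define r where "r = (q - p) / (1 - p)"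
  have r: "0 \<le> r" "r \<le> 1" "(1 - p) * r = q - p" using assms by (auto simp: r_def divide_le_eq)
  let ?P = "pair_pmf (bernoulli_pmf p) (bernoulli_pmf r)"
  have p1: "Pr ?P (\<lambda>z. snd z \<and> \<not> fst z) = (1 - p) * r"
  proof -
    have "{z. snd z \<and> \<not> fst z} = {(False, True)}" by auto
    then have "Pr ?P (\<lambda>z. snd z \<and> \<not> fst z) = pmf ?P (False, True)"
      by (simp only: measure_pmf_single)
    also have "\<dots> = (1 - p) * r" unfolding pmf_pair using assms r(1,2) by simp
    finally show ?thesis .
  qed
  have "Pr (coupled_bernoulli p q) (\<lambda>z. snd z \<and> \<not> fst z) = Pr ?P (\<lambda>z. snd z \<and> \<not> fst z)"
    unfolding coupled_bernoulli_def r_def[symmetric] Pr_map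
    by (rule arg_cong[where f = "measure_pmf.prob ?P"]) (simp add: set_eq_iff, blast)
  then show "Pr (coupled_bernoulli p q) (\<lambda>z. snd z \<and> \<not> fst z) = q - p" using p1 r by simp
  have "Pr ?P (\<lambda>z. fst z \<or> snd z) = 1 - Pr ?P (\<lambda>z. \<not> (fst z \<or> snd z))" unfolding Pr_not by simp
  also have "{z. \<not> (fst z \<or> snd z)} = {(False, False)}" by auto
  also have "1 - measure_pmf.prob ?P {(False, False)} = 1 - (1 - p) * (1 - r)"
    unfolding measure_pmf_single pmf_pair using assms r(1,2) by simp
  also have "\<dots> = q" using r(3) by (simp add: algebra_simps)
  finally have p2: "Pr ?P (\<lambda>z. fst z \<or> snd z) = q" .
  show "map_pmf snd (coupled_bernoulli p q) = bernoulli_pmf q"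
  proof (rule pmf_bool_eqI)
    have "pmf (map_pmf snd (coupled_bernoulli p q)) True = Pr ?P (\<lambda>z. fst z \<or> snd z)"
      unfolding coupled_bernoulli_def r_def[symmetric] pmf_map measure_map_pmf
      by (rule arg_cong[where f = "measure_pmf.prob ?P"]) (simp add: set_eq_iff)
    then show "pmf (map_pmf snd (coupled_bernoulli p q)) True = pmf (bernoulli_pmf q) True"
      using p2 assms by simp
  qed
qed

lemma finite_set_coupled [simp]: "finite (set_pmf (coupled_bernoulli p q))"
  by (rule finite_subset[OF subset_UNIV]) simp

lemma finite_set_coupling [simp]: "finite J \<Longrightarrow> finite (set_pmf (coupling J p q))"
  unfolding coupling_def by (rule finite_set_Pi_pmf) auto

lemma coupling_fst: "finite J \<Longrightarrow> map_pmf (\<lambda>z j. fst (z j)) (coupling J p q) = bern J p"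
  unfolding coupling_def bern_def
  using Pi_pmf_map[of J fst "(False, False)" False "\<lambda>j. coupled_bernoulli (p j) (q j)"]
  by (simp add: coupled_bernoulli_fst o_def)

lemma coupling_snd:
  assumes "finite J" "\<And>j. j \<in> J \<Longrightarrow> 0 \<le> p j \<and> p j \<le> q j \<and> q j \<le> 1 \<and> p j < 1"
  shows "map_pmf (\<lambda>z j. snd (z j)) (coupling J p q) = bern J q"
proof -
  have "bern J q = Pi_pmf J False (\<lambda>j. map_pmf snd (coupled_bernoulli (p j) (q j)))"
    unfolding bern_def by (rule Pi_pmf_cong) (use assms(2) Pr_coupled(1) in auto)
  also have "\<dots> = map_pmf (\<lambda>z. snd \<circ> z) (coupling J p q)"
    unfolding coupling_def by (rule Pi_pmf_map) (use assms in auto)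
  finally show ?thesis by (simp add: o_def)
qed

lemma coupling_mono:
  assumes "finite J" "z \<in> set_pmf (coupling J p q)" "fst (z j)"
  shows "snd (z j)"
proof (cases "j \<in> J")
  case True
  then have "z j \<in> set_pmf (coupled_bernoulli (p j) (q j))"
    using assms unfolding coupling_def set_Pi_pmf[OF assms(1)] PiE_dflt_def by auto
  then show ?thesis using assms(3) unfolding coupled_bernoulli_def by auto
next
  case False
  then have "z j = (False, False)"
    using assms unfolding coupling_def set_Pi_pmf[OF assms(1)] PiE_dflt_def by auto
  then show ?thesis using assms(3) by simp
qed

lemma coupling_equal:
  assumes "finite J" "z \<in> set_pmf (coupling J p q)" "j \<in> J" "p j = q j"
  shows "snd (z j) = fst (z j)"
proof -
  have "z j \<in> set_pmf (coupled_bernoulli (p j) (q j))"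
    using assms unfolding coupling_def set_Pi_pmf[OF assms(1)] PiE_dflt_def by auto
  then show ?thesis using assms(4) unfolding coupled_bernoulli_def
    by (auto simp: set_pmf_iff)
qed

lemma Pr_bern_mono:
  assumes "finite J" "\<And>j. j \<in> J \<Longrightarrow> 0 \<le> p j \<and> p j \<le> q j \<and> q j \<le> 1 \<and> p j < 1"
    and down: "\<And>x y. (\<And>j. x j \<Longrightarrow> y j) \<Longrightarrow> P y \<Longrightarrow> P x"
  shows "Pr (bern J q) P \<le> Pr (bern J p) P"
proof -
  have "map_pmf (\<lambda>z j. snd (z j)) (coupling J p q) = bern J q"
    by (rule coupling_snd) (use assms(1,2) in auto)
  then have "Pr (bern J q) P = Pr (coupling J p q) (\<lambda>z. P (\<lambda>j. snd (z j)))"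
    using Pr_map[of "\<lambda>z j. snd (z j)" "coupling J p q" P] by simp
  also have "\<dots> \<le> Pr (coupling J p q) (\<lambda>z. P (\<lambda>j. fst (z j)))"
    by (rule Pr_mono, rule down[rotated], assumption) (rule coupling_mono[OF assms(1)])
  also have "\<dots> = Pr (bern J p) P"
    using coupling_fst[OF assms(1), of p q] Pr_map[of "\<lambda>z j. fst (z j)" "coupling J p q" P] by simp
  finally show ?thesis .
qed

text \<open>Markov's inequality for \<open>exp (l * cnt)\<close> on the event that a given edge is added by the coupling:
  conditioning on that event costs at most a factor \<open>exp l\<close>.\<close>

lemma Pr_added_and_exceed:
  assumes J: "finite J" "I \<subseteq> J" "e \<in> I"
    and pq: "\<And>j. j \<in> J \<Longrightarrow> 0 \<le> p j \<and> p j \<le> q j \<and> q j \<le> 1 \<and> p j < 1" and l: "0 \<le> l"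
  shows "Pr (coupling J p q) (\<lambda>z. snd (z e) \<and> \<not> fst (z e) \<and> cnt I (\<lambda>j. snd (z j)) > u)
         \<le> (q e - p e) * (exp l * exp (- l * u) * E (bern J q) (\<lambda>x. exp (l * cnt I x)))"
proof -
  let ?M = "coupling J p q"
  define A where "A = (\<lambda>z. of_bool (snd (z e) \<and> \<not> fst (z e) :: bool) :: real)"
  define B where "B = (\<lambda>z :: 'a \<Rightarrow> bool \<times> bool. exp (l * cnt (I - {e}) (\<lambda>j. snd (z j))))"
  have fin: "finite I" "e \<in> J" using J by (auto intro: finite_subset[OF J(2,1)])
  have finM: "finite (set_pmf ?M)" using J by simp
  have c: "cnt I x = of_bool (x e) + cnt (I - {e}) x" for x
    using cnt_insert[of "I - {e}" e x] fin J by (simp add: insert_absorb)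
  have "Pr ?M (\<lambda>z. snd (z e) \<and> \<not> fst (z e) \<and> cnt I (\<lambda>j. snd (z j)) > u) \<le> E ?M (\<lambda>z. (exp l * exp (- l * u)) * (A z * B z))"
    unfolding Pr_eq_E
  proof (rule E_mono[OF finM])
    fix z
    show "of_bool (snd (z e) \<and> \<not> fst (z e) \<and> cnt I (\<lambda>j. snd (z j)) > u) \<le> (exp l * exp (- l * u)) * (A z * B z)"
    proof (cases "snd (z e) \<and> \<not> fst (z e) \<and> cnt I (\<lambda>j. snd (z j)) > u")
      case True
      then have "u \<le> 1 + cnt (I - {e}) (\<lambda>j. snd (z j))" using c[of "\<lambda>j. snd (z j)"] by auto
      from mult_left_mono[OF this l] have "0 \<le> l + - l * u + l * cnt (I - {e}) (\<lambda>j. snd (z j))"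
        by (simp add: algebra_simps)
      then have "1 \<le> exp (l + - l * u + l * cnt (I - {e}) (\<lambda>j. snd (z j)))" by simp
      then have "1 \<le> exp l * exp (- l * u) * exp (l * cnt (I - {e}) (\<lambda>j. snd (z j)))" unfolding exp_add .
      then show ?thesis using True unfolding A_def B_def by simp
    qed (auto simp: A_def B_def)
  qed
  also have "\<dots> = (exp l * exp (- l * u)) * (E ?M A * E ?M B)"
  proof -
    have "E ?M (\<lambda>z. A z * B z) = E ?M A * E ?M B"
      unfolding coupling_def
    proof (rule E_Pi_indep[where A = "{e}" and B = "I - {e}"])
      show "depends_on {e} A" unfolding A_def depends_on_def by auto
      show "depends_on (I - {e}) B" unfolding B_def depends_on_def cnt_def
        by (auto intro!: sum.cong)
    qed (use fin J in auto)
    then show ?thesis by simp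
  qed
  also have EA: "E ?M A = q e - p e"
  proof -
    have "E ?M A = Pr (map_pmf (\<lambda>z. z e) ?M) (\<lambda>z. snd z \<and> \<not> fst z)"
      unfolding Pr_eq_E A_def integral_map_pmf ..
    also have "map_pmf (\<lambda>z. z e) ?M = coupled_bernoulli (p e) (q e)"
      unfolding coupling_def by (subst Pi_pmf_component) (use J fin in auto)
    finally show ?thesis using Pr_coupled(2)[of "p e" "q e"] pq[OF fin(2)] by simp
  qed
  also have "(exp l * exp (- l * u)) * ((q e - p e) * E ?M B) \<le>
      (exp l * exp (- l * u)) * ((q e - p e) * E (bern J q) (\<lambda>x. exp (l * cnt I x)))"
  proof (intro mult_left_mono)
    show "E ?M B \<le> E (bern J q) (\<lambda>x. exp (l * cnt I x))"
    proof -
    have "map_pmf (\<lambda>z j. snd (z j)) ?M = bern J q"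
      by (rule coupling_snd) (use J pq in auto)
    then have "E (bern J q) (\<lambda>x. exp (l * cnt I x)) = E ?M (\<lambda>z. exp (l * cnt I (\<lambda>j. snd (z j))))"
      using integral_map_pmf[of "\<lambda>z j. snd (z j)" ?M "\<lambda>x. exp (l * cnt I x)"] by (simp only:)
    moreover have "E ?M B \<le> \<dots>"
      by (rule E_mono[OF finM]) (auto simp: B_def c intro!: mult_left_mono l)
    ultimately show ?thesis by simp
    qed
  qed (use pq[OF fin(2)] in auto)
  finally show ?thesis by (simp only: mult_ac)
qed


section \<open>Sums of indicators\<close>

lemma Pr_chebyshev_lower:
  assumes "finite (set_pmf M)" "a > 0"
  shows "Pr M (\<lambda>x. X x \<le> E M X - a) \<le> measure_pmf.variance M X / a\<^sup>2"
    and "Pr M (\<lambda>x. X x \<ge> E M X + a) \<le> measure_pmf.variance M X / a\<^sup>2"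
proof -
  have c: "Pr M (\<lambda>x. a \<le> \<bar>X x - E M X\<bar>) \<le> measure_pmf.variance M X / a\<^sup>2"
    using measure_pmf.Chebyshev_inequality[of X M a] assms
    by (simp add: integrable_measure_pmf_finite)
  show "Pr M (\<lambda>x. X x \<le> E M X - a) \<le> measure_pmf.variance M X / a\<^sup>2"
    by (rule order_trans[OF Pr_mono c]) auto
  show "Pr M (\<lambda>x. X x \<ge> E M X + a) \<le> measure_pmf.variance M X / a\<^sup>2"
    by (rule order_trans[OF Pr_mono c]) auto
qed

lemma E_sum_indicators:
  assumes "finite (set_pmf M)"
  shows "E M (\<lambda>x. \<Sum>i\<in>T. of_bool (P i x)) = (\<Sum>i\<in>T. Pr M (P i))"
  unfolding E_sum[OF assms] Pr_eq_E ..

lemma variance_sum_indicators: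
  assumes M: "finite (set_pmf M)"
  shows "measure_pmf.variance M (\<lambda>x. \<Sum>i\<in>T. of_bool (P i x)) =
     (\<Sum>i\<in>T. \<Sum>j\<in>T. E M (\<lambda>x. of_bool (P i x) * of_bool (P j x)) - Pr M (P i) * Pr M (P j))"
proof -
  have "measure_pmf.variance M (\<lambda>x. \<Sum>i\<in>T. of_bool (P i x)) =
      E M (\<lambda>x. \<Sum>i\<in>T. \<Sum>j\<in>T. (of_bool (P i x) - Pr M (P i)) * (of_bool (P j x) - Pr M (P j)))"
    unfolding E_sum_indicators[OF M] sum_subtractf[symmetric] power2_eq_square sum_product ..
  also have "\<dots> = (\<Sum>i\<in>T. \<Sum>j\<in>T. E M (\<lambda>x. (of_bool (P i x) - Pr M (P i)) * (of_bool (P j x) - Pr M (P j))))"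
    unfolding E_sum[OF M] ..
  also have "\<dots> = (\<Sum>i\<in>T. \<Sum>j\<in>T. E M (\<lambda>x. of_bool (P i x) * of_bool (P j x)) - Pr M (P i) * Pr M (P j))"
  proof (intro sum.cong refl)
    fix i j
    have "E M (\<lambda>x. (of_bool (P i x) - Pr M (P i)) * (of_bool (P j x) - Pr M (P j))) =
       E M (\<lambda>x. of_bool (P i x) * of_bool (P j x)
          - (Pr M (P j) * of_bool (P i x) + (Pr M (P i) * of_bool (P j x) - Pr M (P i) * Pr M (P j))))"
      by (intro E_cong) (simp add: algebra_simps)
    also have "\<dots> = E M (\<lambda>x. of_bool (P i x) * of_bool (P j x)) - Pr M (P i) * Pr M (P j)"
      unfolding E_diff[OF M] E_add[OF M] by (simp add: Pr_eq_E)
    finally show "E M (\<lambda>x. (of_bool (P i x) - Pr M (P i)) * (of_bool (P j x) - Pr M (P j))) = \<dots>" .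
  qed
  finally show ?thesis .
qed

text \<open>Chebyshev's inequality; for uncorrelated indicators the variance of the sum is at most its mean.\<close>

lemma Pr_few_indep:
  fixes q :: real
  assumes M: "finite (set_pmf M)" and T: "finite T"
    and ind: "\<And>i j. i \<in> T \<Longrightarrow> j \<in> T \<Longrightarrow> i \<noteq> j \<Longrightarrow>
        E M (\<lambda>x. of_bool (P i x) * of_bool (P j x)) = Pr M (P i) * Pr M (P j)"
    and lo: "\<And>i. i \<in> T \<Longrightarrow> q \<le> Pr M (P i)" and q: "q > 0" and T0: "T \<noteq> {}"
  shows "Pr M (\<lambda>x. (\<Sum>i\<in>T. of_bool (P i x)) \<le> card T * q / 2) \<le> 4 / (card T * q)"
proof -
  let ?X = "\<lambda>x. \<Sum>i\<in>T. of_bool (P i x) :: real"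
  define e where "e = E M ?X"
  have e: "e = (\<Sum>i\<in>T. Pr M (P i))" unfolding e_def E_sum_indicators[OF M] ..
  have "(\<Sum>i\<in>T. q) \<le> e" unfolding e by (intro sum_mono lo)
  then have eq: "card T * q \<le> e" by simp
  have c: "card T * q > 0" using q T T0 by (simp add: card_gt_0_iff)
  have "measure_pmf.variance M ?X \<le> (\<Sum>i\<in>T. Pr M (P i))"
    unfolding variance_sum_indicators[OF M]
  proof (rule sum_mono)
    fix i assume i: "i \<in> T"
    have "(\<Sum>j\<in>T. E M (\<lambda>x. of_bool (P i x) * of_bool (P j x)) - Pr M (P i) * Pr M (P j)) =
       (\<Sum>j\<in>T. if j = i then E M (\<lambda>x. of_bool (P i x) * of_bool (P i x)) - Pr M (P i) * Pr M (P i) else 0)"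
      using i by (intro sum.cong) (auto simp: ind)
    also have "\<dots> = Pr M (P i) - Pr M (P i) * Pr M (P i)"
      using T i by (simp add: Pr_eq_E flip: of_bool_conj)
    also have "\<dots> \<le> Pr M (P i)" by simp
    finally show "(\<Sum>j\<in>T. E M (\<lambda>x. of_bool (P i x) * of_bool (P j x)) - Pr M (P i) * Pr M (P j)) \<le> Pr M (P i)" .
  qed
  then have v: "measure_pmf.variance M ?X \<le> e" using e by simp
  have "Pr M (\<lambda>x. ?X x \<le> card T * q / 2) \<le> Pr M (\<lambda>x. ?X x \<le> E M ?X - e / 2)"
    using eq by (intro Pr_mono) (simp add: e_def[symmetric])
  also have "\<dots> \<le> measure_pmf.variance M ?X / (e / 2)\<^sup>2"
    by (rule Pr_chebyshev_lower(1)[OF M]) (use c eq in linarith)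
  also have "\<dots> \<le> e / (e / 2)\<^sup>2" by (intro divide_right_mono v) auto
  also have "\<dots> = 4 / e" using c eq by (simp add: power2_eq_square field_simps)
  also have "\<dots> \<le> 4 / (card T * q)" using c eq by (intro divide_left_mono) auto
  finally show ?thesis .
qed

section \<open>Degrees in the balanced block model\<close>

text \<open>An unordered pair is represented by its increasing ordering, as in the definition of the model.\<close>

definition edge :: "nat \<Rightarrow> nat \<Rightarrow> nat \<times> nat" where
  "edge i j = (min i j, max i j)"

definition edges :: "nat \<Rightarrow> (nat \<times> nat) set" where
  "edges n = {(i, j). 1 \<le> i \<and> i < j \<and> j \<le> n}"

definition graph :: "(nat \<times> nat \<Rightarrow> bool) \<Rightarrow> adjacency" where
  "graph x i j = x (edge i j)"

definition star :: "nat \<Rightarrow> nat \<Rightarrow> (nat \<times> nat) set" where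
  "star n i = edge i ` ({1..n} - {i})"

definition weight :: "nat \<Rightarrow> nat set set \<Rightarrow> (nat \<Rightarrow> real) \<Rightarrow> real \<Rightarrow> real \<Rightarrow> nat \<times> nat \<Rightarrow> real" where
  "weight n \<C> \<theta> a b = (\<lambda>(i, j). edge_prob n \<C> \<theta> a b i j)"

lemma finite_edges [simp]: "finite (edges n)"
  by (rule finite_subset[of _ "{1..n} \<times> {1..n}"]) (auto simp: edges_def)

lemma edge_commute: "edge i j = edge j i"
  by (simp add: edge_def min.commute max.commute)

lemma inj_edge: "inj (edge i)"
  by (auto simp: inj_def edge_def min_def max_def split: if_splits)

lemma edge_eq: "edge i j = edge i' j' \<Longrightarrow> (i = i' \<and> j = j') \<or> (i = j' \<and> j = i')"
  by (auto simp: edge_def min_def max_def split: if_splits)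

lemma edge_in_edges: "i \<in> {1..n} \<Longrightarrow> j \<in> {1..n} \<Longrightarrow> i \<noteq> j \<Longrightarrow> edge i j \<in> edges n"
  by (auto simp: edge_def edges_def min_def max_def)

lemma star_edges: "i \<in> {1..n} \<Longrightarrow> star n i \<subseteq> edges n"
  by (auto simp: star_def intro!: edge_in_edges)

lemma star_Int: "i \<in> {1..n} \<Longrightarrow> j \<in> {1..n} \<Longrightarrow> i \<noteq> j \<Longrightarrow> star n i \<inter> star n j = {edge i j}"
  by (auto simp: star_def dest: edge_eq) (metis Diff_iff edge_commute empty_iff image_eqI insert_iff atLeastAtMost_iff)+

lemma dcbm_eq: "dcbm n \<C> \<theta> a b = map_pmf graph (bern (edges n) (weight n \<C> \<theta> a b))"
proof -
  have "(\<lambda>(i, j). bernoulli_pmf (edge_prob n \<C> \<theta> a b i j)) = (\<lambda>e. bernoulli_pmf (weight n \<C> \<theta> a b e))"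
    by (auto simp: weight_def)
  moreover have "(\<lambda>E i j. E (min i j, max i j)) = graph" by (auto simp: graph_def edge_def fun_eq_iff)
  ultimately show ?thesis unfolding dcbm_def bern_def edges_def[symmetric] by simp
qed

lemma Pr_dcbm: "Pr (dcbm n \<C> \<theta> a b) P = Pr (bern (edges n) (weight n \<C> \<theta> a b)) (\<lambda>x. P (graph x))"
  unfolding dcbm_eq Pr_map ..

lemma sum_image_edge: "sum f (edge i ` T) = (\<Sum>j\<in>T. f (edge i j))"
  using sum.reindex[of "edge i" T f] inj_edge[of i] by (simp add: inj_on_subset[OF inj_edge])

lemma card_image_edge: "card (edge i ` T) = card T"
  by (rule card_image) (rule inj_on_subset[OF inj_edge subset_UNIV])

lemma deg_graph: "deg n (graph x) i = cnt (star n i) x"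
  unfolding deg_def cnt_def star_def sum_image_edge graph_def ..

definition same_block :: "nat set set \<Rightarrow> nat \<Rightarrow> nat \<Rightarrow> bool" where
  "same_block \<C> i j \<longleftrightarrow> (\<exists>B\<in>\<C>. i \<in> B \<and> j \<in> B)"

lemma same_block_commute: "same_block \<C> i j = same_block \<C> j i"
  by (auto simp: same_block_def)

lemma weight_edge:
  "weight n \<C> \<theta> a b (edge i j) = min (\<theta> i * \<theta> j * ((if same_block \<C> i j then a else b) / real n)) 1"
  unfolding weight_def edge_def edge_prob_def same_block_def[symmetric]
  by (auto simp: min_def max_def mult.commute same_block_commute)

lemma communities_finite: "finite (communities n k \<nu>)"
  by (rule finite_subset[of _ "Pow (Pow {1..n})"])
     (auto simp: communities_def partition_on_def)

lemma communities_nonempty: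
  assumes "k \<ge> 1" "k dvd n" "n > 0"
  shows "communities n k 1 \<noteq> {}"
proof -
  obtain m where n: "n = k * m" using assms by auto
  have m: "m > 0" using n assms by auto
  \<comment> \<open>Consecutive intervals of length \<open>m\<close> serve as blocks.\<close>
  define B where "B l = {l * m + 1..(l + 1) * m}" for l :: nat
  have cB: "card (B l) = m" for l by (simp add: B_def)
  have neB: "B l \<noteq> {}" for l using cB[of l] m by auto
  have inB: "x \<in> B l \<longleftrightarrow> l = (x - 1) div m" if "x \<ge> 1" for x l
  proof
    assume "x \<in> B l"
    then have "l * m \<le> x - 1" "x - 1 < (l + 1) * m" using that by (auto simp: B_def)
    then show "l = (x - 1) div m" by (metis Suc_eq_plus1 div_nat_eqI mult.commute)
  next
    assume l: "l = (x - 1) div m"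
    have "x - 1 = l * m + (x - 1) mod m" "(x - 1) mod m < m" unfolding l using m by simp_all
    then have "l * m \<le> x - 1" "x - 1 < (l + 1) * m" unfolding distrib_right by linarith+
    then show "x \<in> B l" using that by (auto simp: B_def)
  qed
  have ge1: "x \<ge> 1" if "x \<in> B l" for x l using that by (auto simp: B_def)
  have inj: "inj B"
  proof (rule injI)
    fix l l' assume e: "B l = B l'"
    obtain x where "x \<in> B l" using neB by blast
    then show "l = l'" using e inB ge1 by metis
  qed
  have part: "partition_on {1..n} (B ` {..<k})"
    unfolding partition_on_def
  proof (intro conjI)
    show "\<Union> (B ` {..<k}) = {1..n}"
    proof (intro set_eqI iffI)
      fix x assume "x \<in> \<Union> (B ` {..<k})"
      then obtain l where l: "l < k" "x \<in> B l" by auto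
      have "(l + 1) * m \<le> k * m" using l by (intro mult_right_mono) auto
      then show "x \<in> {1..n}" using l n by (auto simp: B_def)
    next
      fix x assume x: "x \<in> {1..n}"
      then have "(x - 1) div m < k" using n m by (auto simp: div_less_iff_less_mult)
      then show "x \<in> \<Union> (B ` {..<k})" using inB[of x] x by auto
    qed
    show "disjoint (B ` {..<k})"
      unfolding disjoint_def by (auto) (metis inB ge1)+
    show "{} \<notin> B ` {..<k}" using neB by auto
  qed
  have "card (B ` {..<k}) = k" using inj by (simp add: card_image inj_on_subset)
  moreover have "real n / real k = real m" using n assms by simp
  ultimately have "B ` {..<k} \<in> communities n k 1"
    unfolding communities_def using part cB by auto
  then show ?thesis by auto
qed


locale balanced_block_model =
  fixes n k :: nat and a b :: real
  assumes k: "k \<ge> 1" and dvd: "k dvd n" and n2: "2 * k \<le> n"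
    and ab: "0 < b" "b < a" "a \<le> real n / 2"
begin

definition "m = n div k"
definition "pa = a / real n"
definition "pb = b / real n"
definition "\<mu> = null_mean n k a b"
definition "\<sigma> = sqrt (null_variance n k a b)"
definition "w0 \<C> = weight n \<C> (\<lambda>_. 1) a b"
definition "w1 \<C> S A = weight n \<C> (\<lambda>i. if i \<in> S then 1 + A else 1) a b"

lemma n_pos: "n > 0" using k n2 by linarith

lemma n_eq: "n = k * m" using dvd by (simp add: m_def)

lemma m_ge: "m \<ge> 2" using n2 n_eq k by (metis mult.commute mult_le_cancel1 not_one_le_zero le_zero_eq not_le)

lemma m_le: "m \<le> n" by (simp add: m_def)

lemma m_eq: "real n / real k = real m"
proof -
  have "real n = real k * real m" by (metis n_eq of_nat_mult)
  then show ?thesis using k by (simp add: field_simps)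
qed

lemma p_bounds: "0 < pa" "0 < pb" "pa \<le> 1 / 2" "pb \<le> 1 / 2" "pb \<le> pa"
  using ab n_pos by (auto simp: pa_def pb_def field_simps)

lemma real_sizes: "real (m - 1) = real m - 1" "real (n - m) = real n - real m"
  using m_ge m_le by (auto simp: of_nat_diff)

lemma \<mu>_eq: "\<mu> = real (m - 1) * pa + real (n - m) * pb"
  unfolding \<mu>_def null_mean_def m_eq pa_def pb_def real_sizes ..

lemma null_variance_eq: "null_variance n k a b = real (m - 1) * (pa * (1 - pa)) + real (n - m) * (pb * (1 - pb))"
  unfolding null_variance_def m_eq pa_def pb_def real_sizes by simp

lemma va_pos: "real (m - 1) * (pa * (1 - pa)) > 0"
  using m_ge p_bounds by auto

lemma \<sigma>_pos: "\<sigma> > 0" and \<sigma>_sq: "\<sigma>\<^sup>2 = real (m - 1) * (pa * (1 - pa)) + real (n - m) * (pb * (1 - pb))"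
proof -
  have "null_variance n k a b > 0" unfolding null_variance_eq
    by (rule add_pos_nonneg[OF va_pos]) (use p_bounds in auto)
  then show "\<sigma> > 0" "\<sigma>\<^sup>2 = real (m - 1) * (pa * (1 - pa)) + real (n - m) * (pb * (1 - pb))"
    unfolding \<sigma>_def null_variance_eq by auto
qed

lemma \<mu>_pos: "\<mu> > 0"
  unfolding \<mu>_eq by (rule add_pos_nonneg) (use p_bounds m_ge in auto)

lemma \<sigma>_le: "\<sigma>\<^sup>2 \<le> \<mu>"
  unfolding \<mu>_eq \<sigma>_sq using p_bounds by (intro add_mono mult_left_mono) (auto simp: mult_left_le)

lemma w0_edge: "w0 \<C> (edge i j) = (if same_block \<C> i j then pa else pb)"
proof -
  have "pa \<le> 1" "pb \<le> 1" using p_bounds by linarith+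
  then show ?thesis unfolding w0_def weight_edge by (simp add: pa_def pb_def)
qed

lemma w0_bounds: "w0 \<C> e \<in> {0..1 / 2}"
proof -
  have "pa \<le> 1" "pb \<le> 1" using p_bounds by linarith+
  then have "w0 \<C> e = pa \<or> w0 \<C> e = pb"
    unfolding w0_def weight_def edge_prob_def by (auto simp: pa_def pb_def split: prod.splits)
  then show ?thesis using p_bounds by auto
qed

lemma w0_prob: "w0 \<C> e \<in> {0..1}"
  using w0_bounds[of \<C> e] by auto

lemma block_cards:
  assumes C: "\<C> \<in> communities n k 1" and i: "i \<in> {1..n}"
  shows "card {j \<in> {1..n} - {i}. same_block \<C> i j} = m - 1"
    and "card {j \<in> {1..n} - {i}. \<not> same_block \<C> i j} = n - m"
proof -
  have part: "partition_on {1..n} \<C>" using C by (simp add: communities_def)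
  then obtain B where B: "B \<in> \<C>" "i \<in> B" using i unfolding partition_on_def by blast
  have sb: "same_block \<C> i j \<longleftrightarrow> j \<in> B" for j
    unfolding same_block_def using B part unfolding partition_on_def disjoint_def by blast
  have Bsub: "B \<subseteq> {1..n}" using B part unfolding partition_on_def by blast
  have "real (card B) = real m" using C B unfolding communities_def by (auto simp: m_eq)
  then have cB: "card B = m" by simp
  have fB: "finite B" using Bsub finite_subset by blast
  have "{j \<in> {1..n} - {i}. same_block \<C> i j} = B - {i}" unfolding sb using Bsub by auto
  then show "card {j \<in> {1..n} - {i}. same_block \<C> i j} = m - 1" using B cB fB by simp
  have "{j \<in> {1..n} - {i}. \<not> same_block \<C> i j} = {1..n} - B" unfolding sb using B by auto
  then show "card {j \<in> {1..n} - {i}. \<not> same_block \<C> i j} = n - m" using cB fB Bsub by (simp add: card_Diff_subset)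
qed

lemma sum_star_by_block:
  fixes g :: "bool \<Rightarrow> real"
  assumes C: "\<C> \<in> communities n k 1" and i: "i \<in> {1..n}"
  shows "(\<Sum>j\<in>{1..n} - {i}. g (same_block \<C> i j)) = real (m - 1) * g True + real (n - m) * g False"
proof -
  have "(\<Sum>j\<in>{1..n} - {i}. g (same_block \<C> i j)) =
      (\<Sum>j\<in>{1..n} - {i}. if same_block \<C> i j then g True else g False)"
    by (intro sum.cong) auto
  then show ?thesis using block_cards[OF C i]
    by (simp add: sum.If_cases Int_def Collect_conj_eq[symmetric] conj_commute)
qed

lemma sum_star_w0:
  assumes C: "\<C> \<in> communities n k 1" and i: "i \<in> {1..n}"
  shows "(\<Sum>e\<in>star n i. w0 \<C> e) = \<mu>" and "(\<Sum>e\<in>star n i. w0 \<C> e * (1 - w0 \<C> e)) = \<sigma>\<^sup>2"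
proof -
  show "(\<Sum>e\<in>star n i. w0 \<C> e) = \<mu>"
    unfolding star_def sum_image_edge w0_edge \<mu>_eq
    using sum_star_by_block[OF C i, of "\<lambda>s. if s then pa else pb"] by simp
  have "(\<Sum>e\<in>star n i. w0 \<C> e * (1 - w0 \<C> e)) =
     (\<Sum>j\<in>{1..n} - {i}. (\<lambda>s. if s then pa * (1 - pa) else pb * (1 - pb)) (same_block \<C> i j))"
    unfolding star_def sum_image_edge w0_edge by (intro sum.cong) auto
  then show "(\<Sum>e\<in>star n i. w0 \<C> e * (1 - w0 \<C> e)) = \<sigma>\<^sup>2"
    unfolding \<sigma>_sq using sum_star_by_block[OF C i, of "\<lambda>s. if s then pa * (1 - pa) else pb * (1 - pb)"] by simp
qed

text \<open>For a null degree, \<open>F u\<close> is the probability of exceeding \<open>u\<close>, \<open>\<delta>a u\<close> and \<open>\<delta>b u\<close> are the jumps of that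
probability caused by an edge within a block and between blocks, and \<open>G u\<close> is the covariance of the degree
with its exceedance; \<open>V u\<close> is the variance of the number of exceedances. The formulas mention the block
sizes only, so that they apply to every balanced assignment.\<close>

definition "F u = two_class_tail pa pb (m - 1) (n - m) u"
definition "\<delta>a u = two_class_tail pa pb (m - 2) (n - m) (u - 1) - two_class_tail pa pb (m - 2) (n - m) u"
definition "\<delta>b u = two_class_tail pa pb (m - 1) (n - m - 1) (u - 1) - two_class_tail pa pb (m - 1) (n - m - 1) u"
definition "G u = real (m - 1) * (pa * (1 - pa)) * \<delta>a u + real (n - m) * (pb * (1 - pb)) * \<delta>b u"
definition "V u = real n * (F u * (1 - F u) + real (m - 1) * (pa * (1 - pa)) * (\<delta>a u)\<^sup>2
                   + real (n - m) * (pb * (1 - pb)) * (\<delta>b u)\<^sup>2)"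
definition exceedances :: "real \<Rightarrow> (nat \<times> nat \<Rightarrow> bool) \<Rightarrow> real" where
  "exceedances u x = (\<Sum>i=1..n. of_bool (cnt (star n i) x > u))"

lemma Pr_two_blocks:
  assumes i: "i \<in> {1..n}" and T: "T \<subseteq> {1..n} - {i}"
  shows "Pr (bern (edges n) (w0 \<C>)) (\<lambda>x. cnt (edge i ` T) x > u) =
     two_class_tail pa pb (card {j \<in> T. same_block \<C> i j}) (card {j \<in> T. \<not> same_block \<C> i j}) u"
proof -
  let ?Ia = "edge i ` {j \<in> T. same_block \<C> i j}" and ?Ib = "edge i ` {j \<in> T. \<not> same_block \<C> i j}"
  have un: "edge i ` T = ?Ia \<union> ?Ib" by auto
  have "edge i ` T \<subseteq> edges n" using star_edges[OF i] T unfolding star_def by blast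
  then have sub: "?Ia \<subseteq> edges n" "?Ib \<subseteq> edges n" by blast+
  have "Pr (bern (edges n) (w0 \<C>)) (\<lambda>x. cnt (?Ia \<union> ?Ib) x > u) =
     two_class_tail pa pb (card ?Ia) (card ?Ib) u"
    by (rule Pr_cnt_two_class)
       (use sub p_bounds in \<open>auto simp: w0_edge dest: injD[OF inj_edge]\<close>)
  then show ?thesis unfolding un card_image_edge .
qed

lemma Pr_exceed:
  assumes C: "\<C> \<in> communities n k 1" and i: "i \<in> {1..n}"
  shows "Pr (bern (edges n) (w0 \<C>)) (\<lambda>x. cnt (star n i) x > u) = F u"
  unfolding star_def F_def Pr_two_blocks[OF i subset_refl] block_cards[OF C i] ..

lemma jump_eq:
  assumes C: "\<C> \<in> communities n k 1" and i: "i \<in> {1..n}" and j: "j \<in> {1..n}" "j \<noteq> i"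
  shows "jump (edges n) (w0 \<C>) (star n i) u (edge i j) = (if same_block \<C> i j then \<delta>a u else \<delta>b u)"
proof -
  let ?T = "{1..n} - {i} - {j}"
  have st: "star n i - {edge i j} = edge i ` ?T"
    unfolding star_def using inj_edge[of i] by (auto simp: inj_def)
  have sub: "?T \<subseteq> {1..n} - {i}" by auto
  have fin: "finite {l \<in> {1..n} - {i}. P l}" for P by auto
  have *: "{l \<in> ?T. P l} = {l \<in> {1..n} - {i}. P l} - {j}" for P by auto
  have c: "card {l \<in> ?T. P l} = card {l \<in> {1..n} - {i}. P l} - (if P j then 1 else 0)" for P
    unfolding * using j by (auto simp: card_Diff_singleton_if)
  show ?thesis
    unfolding jump_def st Pr_two_blocks[OF i sub] c[of "same_block \<C> i"] c[of "\<lambda>l. \<not> same_block \<C> i l"]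
      block_cards[OF C i] \<delta>a_def \<delta>b_def
    by (simp add: numeral_2_eq_2)
qed

text \<open>Since the value does not depend on \<open>\<C>\<close>, the normalisation of the higher criticism statistic, computed under
a reference assignment, is correct under the true one.\<close>

lemma variance_exceedances:
  assumes C: "\<C> \<in> communities n k 1"
  shows "measure_pmf.variance (bern (edges n) (w0 \<C>)) (exceedances u) = V u"
proof -
  let ?M = "bern (edges n) (w0 \<C>)"
  let ?P = "\<lambda>i x. cnt (star n i) x > u"
  have fin: "finite (set_pmf ?M)" by simp
  have "measure_pmf.variance ?M (exceedances u) =
      (\<Sum>i=1..n. \<Sum>j=1..n. E ?M (\<lambda>x. of_bool (?P i x) * of_bool (?P j x)) - Pr ?M (?P i) * Pr ?M (?P j))"
    unfolding exceedances_def variance_sum_indicators[OF fin] ..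
  also have "\<dots> = (\<Sum>i=1..n. F u * (1 - F u) + (real (m - 1) * (pa * (1 - pa) * (\<delta>a u)\<^sup>2)
      + real (n - m) * (pb * (1 - pb) * (\<delta>b u)\<^sup>2)))"
  proof (rule sum.cong[OF refl])
    fix i assume i: "i \<in> {1..n}"
    let ?c = "\<lambda>j. E ?M (\<lambda>x. of_bool (?P i x) * of_bool (?P j x)) - Pr ?M (?P i) * Pr ?M (?P j)"
    have "(\<Sum>j=1..n. ?c j) = ?c i + (\<Sum>j\<in>{1..n} - {i}. ?c j)"
      using i by (simp add: sum.remove)
    also have "?c i = F u * (1 - F u)"
    proof -
      have "E ?M (\<lambda>x. of_bool (?P i x) * of_bool (?P i x)) = Pr ?M (?P i)"
        unfolding Pr_eq_E by (intro E_cong) auto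
      then show ?thesis unfolding Pr_exceed[OF C i] by (simp add: algebra_simps)
    qed
    also have "(\<Sum>j\<in>{1..n} - {i}. ?c j) = (\<Sum>j\<in>{1..n} - {i}.
        (\<lambda>s. if s then pa * (1 - pa) * (\<delta>a u)\<^sup>2 else pb * (1 - pb) * (\<delta>b u)\<^sup>2) (same_block \<C> i j))"
    proof (rule sum.cong[OF refl])
      fix j assume "j \<in> {1..n} - {i}"
      then have j: "j \<in> {1..n}" "j \<noteq> i" by auto
      have "?c j = w0 \<C> (edge i j) * (1 - w0 \<C> (edge i j)) *
         jump (edges n) (w0 \<C>) (star n i) u (edge i j) * jump (edges n) (w0 \<C>) (star n j) u (edge i j)"
        by (rule cov_exceed) (use i j star_edges star_Int w0_prob in auto)
      also have "jump (edges n) (w0 \<C>) (star n j) u (edge i j) = jump (edges n) (w0 \<C>) (star n i) u (edge i j)"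
        unfolding jump_eq[OF C i j] unfolding edge_commute[of i j] jump_eq[OF C j(1) i j(2)[symmetric]]
        by (simp add: same_block_commute)
      finally show "?c j = (\<lambda>s. if s then pa * (1 - pa) * (\<delta>a u)\<^sup>2 else pb * (1 - pb) * (\<delta>b u)\<^sup>2) (same_block \<C> i j)"
        unfolding jump_eq[OF C i j] w0_edge by (auto simp: power2_eq_square)
    qed
    also have "\<dots> = real (m - 1) * (pa * (1 - pa) * (\<delta>a u)\<^sup>2) + real (n - m) * (pb * (1 - pb) * (\<delta>b u)\<^sup>2)"
      using sum_star_by_block[OF C i, of "\<lambda>s. if s then pa * (1 - pa) * (\<delta>a u)\<^sup>2 else pb * (1 - pb) * (\<delta>b u)\<^sup>2"]
      by simp
    finally show "(\<Sum>j=1..n. ?c j) = F u * (1 - F u) + (real (m - 1) * (pa * (1 - pa) * (\<delta>a u)\<^sup>2)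
      + real (n - m) * (pb * (1 - pb) * (\<delta>b u)\<^sup>2))" .
  qed
  also have "\<dots> = V u" unfolding V_def by (simp add: algebra_simps)
  finally show ?thesis .
qed

lemma E_exceedances:
  assumes C: "\<C> \<in> communities n k 1"
  shows "E (bern (edges n) (w0 \<C>)) (exceedances u) = real n * F u"
  unfolding exceedances_def by (subst E_sum_indicators) (auto simp: Pr_exceed[OF C])

lemma sum_star: "sum g (star n i) = (\<Sum>j\<in>{1..n} - {i}. g (edge i j))"
  unfolding star_def by (rule sum_image_edge)

lemma G_eq:
  assumes C: "\<C> \<in> communities n k 1" and i: "i \<in> {1..n}"
  shows "G u = E (bern (edges n) (w0 \<C>)) (\<lambda>x. (cnt (star n i) x - \<mu>) * of_bool (cnt (star n i) x > u))"
proof -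
  have "(\<Sum>e\<in>star n i. w0 \<C> e * (1 - w0 \<C> e) * jump (edges n) (w0 \<C>) (star n i) u e) =
     (\<Sum>j\<in>{1..n} - {i}. (\<lambda>s. if s then pa * (1 - pa) * \<delta>a u else pb * (1 - pb) * \<delta>b u) (same_block \<C> i j))"
    unfolding sum_star by (intro sum.cong refl) (auto simp: w0_edge jump_eq[OF C i])
  also have "\<dots> = G u" unfolding G_def
    using sum_star_by_block[OF C i, of "\<lambda>s. if s then pa * (1 - pa) * \<delta>a u else pb * (1 - pb) * \<delta>b u"] by simp
  finally show ?thesis
    using sum_jump[OF finite_edges star_edges[OF i], of "w0 \<C>" u] w0_prob[of \<C>] sum_star_w0(1)[OF C i]
    by simp
qed

lemma \<delta>_nonneg: "\<delta>a u \<ge> 0" "\<delta>b u \<ge> 0"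
  unfolding \<delta>a_def \<delta>b_def two_class_tail_def by (auto intro!: Pr_mono)

lemma weighted_square_le:
  fixes x y g :: real
  assumes "x \<ge> 0" "y \<ge> 0" "x * y \<le> g"
  shows "x * y\<^sup>2 \<le> g\<^sup>2 / x"
proof (cases "x = 0")
  case False
  have "(x * y)\<^sup>2 \<le> g\<^sup>2" using assms by (intro power_mono) auto
  then show ?thesis using False assms by (simp add: field_simps power2_eq_square)
qed simp

text \<open>Each of the two nonnegative terms of \<open>G u\<close> is at most \<open>G u\<close>, which bounds the jumps.\<close>

lemma V_le:
  "V u \<le> real n * (F u + (G u)\<^sup>2 * (1 / (real (m - 1) * (pa * (1 - pa))) + 1 / (real (n - m) * (pb * (1 - pb)))))"
proof -
  let ?x = "real (m - 1) * (pa * (1 - pa))" and ?y = "real (n - m) * (pb * (1 - pb))"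
  have nn: "?x \<ge> 0" "?y \<ge> 0" using p_bounds by auto
  have "?x * \<delta>a u \<le> G u" "?y * \<delta>b u \<le> G u"
    using nn \<delta>_nonneg unfolding G_def by auto
  then have 1: "?x * (\<delta>a u)\<^sup>2 \<le> (G u)\<^sup>2 / ?x" "?y * (\<delta>b u)\<^sup>2 \<le> (G u)\<^sup>2 / ?y"
    using nn \<delta>_nonneg by (auto intro!: weighted_square_le)
  have 0: "F u * (1 - F u) \<le> F u" unfolding F_def two_class_tail_def by (simp add: mult_left_le)
  have "F u * (1 - F u) + ?x * (\<delta>a u)\<^sup>2 + ?y * (\<delta>b u)\<^sup>2 \<le> F u + (G u)\<^sup>2 / ?x + (G u)\<^sup>2 / ?y"
    by (rule add_mono[OF add_mono[OF 0 1(1)] 1(2)])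
  then have "V u \<le> real n * (F u + (G u)\<^sup>2 / ?x + (G u)\<^sup>2 / ?y)"
    unfolding V_def by (intro mult_left_mono) auto
  then show ?thesis by (simp add: distrib_left)
qed

lemma V_pos:
  assumes "0 < F u" "F u < 1"
  shows "V u > 0"
  unfolding V_def using assms n_pos p_bounds
  by (intro mult_pos_pos add_pos_nonneg) auto

lemma std_deg_graph: "std_deg n k a b (graph x) i > t \<longleftrightarrow> cnt (star n i) x > \<mu> + t * \<sigma>"
  using \<sigma>_pos unfolding std_deg_def deg_graph \<mu>_def[symmetric] \<sigma>_def[symmetric]
  by (simp add: field_simps)

lemma null_law_eq: "null_law n \<C> a b = map_pmf graph (bern (edges n) (w0 \<C>))"
  unfolding dcbm_eq w0_def ..

lemma ref_in: "ref_communities n k \<in> communities n k 1"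
  unfolding ref_communities_def using communities_nonempty[OF k dvd n_pos] by (simp add: some_in_eq)

lemma HC_at_graph: "HC_at n k a b t (graph x) = exceedances (\<mu> + t * \<sigma>) x - real n * F (\<mu> + t * \<sigma>)"
proof -
  have "measure_pmf.prob (null_law n (ref_communities n k) a b) {Y'. std_deg n k a b Y' i > t} = F (\<mu> + t * \<sigma>)"
    if "i \<in> {1..n}" for i
    unfolding null_law_eq Pr_map std_deg_graph Pr_exceed[OF ref_in that] ..
  then have "HC_at n k a b t (graph x) = (\<Sum>i=1..n. of_bool (cnt (star n i) x > \<mu> + t * \<sigma>) - F (\<mu> + t * \<sigma>))"
    unfolding HC_at_def std_deg_graph by (intro sum.cong) auto
  then show ?thesis unfolding exceedances_def sum_subtractf by simp
qed

lemma variance_HC_at: "measure_pmf.variance (null_law n (ref_communities n k) a b) (HC_at n k a b t) = V (\<mu> + t * \<sigma>)"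
proof -
  let ?M = "bern (edges n) (w0 (ref_communities n k))" and ?u = "\<mu> + t * \<sigma>"
  have "measure_pmf.expectation (null_law n (ref_communities n k) a b) (HC_at n k a b t) = 0"
    unfolding null_law_eq integral_map_pmf HC_at_graph
    by (subst E_diff) (auto simp: E_exceedances[OF ref_in])
  then have "measure_pmf.variance (null_law n (ref_communities n k) a b) (HC_at n k a b t) =
     E ?M (\<lambda>x. (exceedances ?u x - real n * F ?u)\<^sup>2)"
    unfolding null_law_eq integral_map_pmf HC_at_graph by simp
  also have "\<dots> = measure_pmf.variance ?M (exceedances ?u)"
    unfolding E_exceedances[OF ref_in] ..
  finally show ?thesis unfolding variance_exceedances[OF ref_in] .
qed

lemma GHC_at_graph:
  "GHC_at n k a b t (graph x) = (exceedances (\<mu> + t * \<sigma>) x - real n * F (\<mu> + t * \<sigma>)) / sqrt (V (\<mu> + t * \<sigma>))"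
  unfolding GHC_at_def variance_HC_at HC_at_graph ..

end


context balanced_block_model
begin

lemma \<mu>_le: "\<mu> \<le> a"
proof -
  have "\<mu> \<le> real (m - 1) * pa + real (n - m) * pa"
    unfolding \<mu>_eq using p_bounds by (intro add_mono mult_left_mono) auto
  also have "\<dots> = (real n - 1) * pa" unfolding real_sizes by (simp add: algebra_simps)
  also have "\<dots> \<le> real n * pa" using p_bounds by (intro mult_right_mono) auto
  finally show ?thesis using n_pos by (simp add: pa_def)
qed

lemma within_variance_ge: "a / (4 * real k) \<le> real (m - 1) * (pa * (1 - pa))"
proof -
  have "a / (4 * real k) = (real m / 2) * (pa * (1 / 2))"
    unfolding m_eq[symmetric] pa_def using n_pos k by (simp add: field_simps)
  also have "\<dots> \<le> real (m - 1) * (pa * (1 - pa))"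
    using m_ge p_bounds unfolding real_sizes by (intro mult_mono) auto
  finally show ?thesis .
qed

lemma \<sigma>_sq_ge: "a / (4 * real k) \<le> \<sigma>\<^sup>2"
proof -
  have "0 \<le> real (n - m) * (pb * (1 - pb))" using p_bounds by auto
  then show ?thesis using within_variance_ge unfolding \<sigma>_sq by linarith
qed

lemma between_variance_ge:
  assumes "n \<noteq> m"
  shows "b / 4 \<le> real (n - m) * (pb * (1 - pb))"
proof -
  have "k \<noteq> 1" using assms n_eq by auto
  then have "2 * m \<le> k * m" using k by (intro mult_right_mono) auto
  then have "2 * m \<le> n" using n_eq by linarith
  then have nm: "real n / 2 \<le> real (n - m)" unfolding real_sizes by linarith
  have "b / 4 = (real n / 2) * (pb * (1 / 2))"
    unfolding pb_def using n_pos by (simp add: field_simps)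
  also have "\<dots> \<le> real (n - m) * (pb * (1 - pb))"
    using nm p_bounds by (intro mult_mono) auto
  finally show ?thesis .
qed

lemma null_count_variance_le: "V u \<le> real n * (F u + (G u)\<^sup>2 * (4 * real k / a + 4 / b))"
proof -
  let ?x = "real (m - 1) * (pa * (1 - pa))" and ?y = "real (n - m) * (pb * (1 - pb))"
  have "1 / ?x \<le> 1 / (a / (4 * real k))"
    using within_variance_ge ab k by (intro divide_left_mono mult_pos_pos va_pos) auto
  then have 1: "1 / ?x \<le> 4 * real k / a" by simp
  have 2: "1 / ?y \<le> 4 / b"
  proof (cases "n = m")
    case True
    then show ?thesis using ab by simp
  next
    case False
    then have "1 / ?y \<le> 1 / (b / 4)"
      using between_variance_ge ab p_bounds m_le by (intro divide_left_mono mult_pos_pos) auto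
    then show ?thesis by simp
  qed
  have "(G u)\<^sup>2 * (1 / ?x + 1 / ?y) \<le> (G u)\<^sup>2 * (4 * real k / a + 4 / b)"
    by (intro mult_left_mono add_mono 1 2) auto
  then have "real n * (F u + (G u)\<^sup>2 * (1 / ?x + 1 / ?y)) \<le> real n * (F u + (G u)\<^sup>2 * (4 * real k / a + 4 / b))"
    by (intro mult_left_mono) auto
  then show ?thesis using V_le[of u] by linarith
qed

lemma w1_edge:
  assumes A: "0 \<le> A" "A \<le> 1 / 4"
  shows "w1 \<C> S A (edge i j) = (if i \<in> S then 1 + A else 1) * (if j \<in> S then 1 + A else 1) * w0 \<C> (edge i j)"
proof -
  let ?f = "(if i \<in> S then 1 + A else 1) * (if j \<in> S then 1 + A else 1)"
  have "(1 + A) * (1 + A) \<le> (1 + 1 / 4) * (1 + 1 / 4)" using A by (intro mult_mono) auto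
  then have "?f \<le> 2" using A by auto
  then have "?f * w0 \<C> (edge i j) \<le> 2 * (1 / 2)"
    using A w0_bounds[of \<C> "edge i j"] by (intro mult_mono) auto
  then have "?f * w0 \<C> (edge i j) \<le> 1" by simp
  then show ?thesis unfolding w1_def weight_edge w0_edge by (auto simp: pa_def pb_def)
qed

lemma edges_edge: "e \<in> edges n \<Longrightarrow> e = edge (fst e) (snd e)"
  by (auto simp: edges_def edge_def)

lemma w1_coupled:
  assumes A: "0 \<le> A" "A \<le> 1 / 4" and e: "e \<in> edges n"
  shows "0 \<le> w0 \<C> e \<and> w0 \<C> e \<le> w1 \<C> S A e \<and> w1 \<C> S A e \<le> 1 \<and> w0 \<C> e < 1"
proof -
  obtain i j where ij: "e = edge i j" using edges_edge[OF e] by blast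
  let ?f = "(if i \<in> S then 1 + A else 1) * (if j \<in> S then 1 + A else 1)"
  have "1 * 1 \<le> ?f" using A by (intro mult_mono) auto
  then have "1 * w0 \<C> e \<le> ?f * w0 \<C> e" using w0_bounds[of \<C> e] by (intro mult_right_mono) auto
  moreover have "w1 \<C> S A e \<le> 1" unfolding w1_def weight_def edge_prob_def by (auto split: prod.splits)
  ultimately show ?thesis using w0_bounds[of \<C> e] w1_edge[OF A, of \<C> S i j] ij by auto
qed

text \<open>All degrees that occur, null or boosted, complete or restricted to the complement of \<open>S\<close>, arise from the
null probabilities by a factor \<open>1 + B\<close> and a perturbation of total size \<open>R\<close>. Removed edges count as
edges of probability 0.\<close>

lemma near_gaussian_degree:
  assumes C: "\<C> \<in> communities n k 1" and i: "i \<in> {1..n}" and I: "I \<subseteq> star n i"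
    and q: "\<And>e. e \<in> I \<Longrightarrow> q e \<in> {0..1}" and B: "0 \<le> B" "B \<le> 1"
    and R: "(\<Sum>e\<in>star n i. \<bar>(if e \<in> I then q e else 0) - (1 + B) * w0 \<C> e\<bar>) \<le> R"
    and L: "L > 0" and K: "0 \<le> K" "K * sqrt L \<le> \<sigma>"
    and h1: "\<bar>B * \<mu> / (\<sigma> * sqrt L) - v\<bar> + R / (\<sigma> * sqrt L) \<le> h"
    and h2: "(B * \<mu> + R) / \<sigma>\<^sup>2 \<le> h" and h3: "sqrt L * ((1 + B) * \<mu> + R) / \<sigma> ^ 3 \<le> h"
    and h: "h * (K + K\<^sup>2 + K ^ 3) \<le> \<eta>"
  shows "near_gaussian (bern (edges n) q) (\<lambda>x. sqrt L * ((cnt I x - \<mu>) / \<sigma>)) L K \<eta> v"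
proof -
  define q' where "q' e = (if e \<in> I then q e else 0)" for e
  have fin: "finite (star n i)" by (simp add: star_def)
  have q': "0 \<le> q' e" "q' e \<le> 1" for e using q by (auto simp: q'_def)
  define M where "M = (\<Sum>e\<in>I. q e)"
  define VV where "VV = (\<Sum>e\<in>I. q e * (1 - q e))"
  have M: "M = (\<Sum>e\<in>star n i. q' e)" unfolding M_def q'_def
    using fin I by (simp add: sum.inter_restrict[symmetric] Int_absorb1)
  have VV: "VV = (\<Sum>e\<in>star n i. q' e * (1 - q' e))"
  proof -
    have "VV = (\<Sum>e\<in>star n i. if e \<in> I then q e * (1 - q e) else 0)" unfolding VV_def
      using fin I by (simp add: sum.inter_restrict[symmetric] Int_absorb1)
    also have "\<dots> = (\<Sum>e\<in>star n i. q' e * (1 - q' e))" by (intro sum.cong) (auto simp: q'_def)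
    finally show ?thesis .
  qed
  note w0 = sum_star_w0[OF C i]
  have R': "(\<Sum>e\<in>star n i. \<bar>q' e - (1 + B) * w0 \<C> e\<bar>) \<le> R" using R by (simp add: q'_def)
  have dM: "\<bar>M - (1 + B) * \<mu>\<bar> \<le> R"
  proof -
    have "M - (1 + B) * \<mu> = (\<Sum>e\<in>star n i. q' e - (1 + B) * w0 \<C> e)"
      unfolding M w0(1)[symmetric] sum_subtractf sum_distrib_left ..
    then show ?thesis using R' sum_abs[of "\<lambda>e. q' e - (1 + B) * w0 \<C> e" "star n i"] by linarith
  qed
  have dV: "\<bar>VV - \<sigma>\<^sup>2\<bar> \<le> B * \<mu> + R"
  proof -
    have lip: "\<bar>x * (1 - x) - y * (1 - y)\<bar> \<le> \<bar>x - y\<bar>" if "0 \<le> x" "x \<le> 1" "0 \<le> y" "y \<le> 1" for x y :: real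
    proof -
      have "x * (1 - x) - y * (1 - y) = (x - y) * (1 - x - y)" by (simp add: algebra_simps)
      then have "\<bar>x * (1 - x) - y * (1 - y)\<bar> = \<bar>x - y\<bar> * \<bar>1 - x - y\<bar>" by (simp add: abs_mult)
      also have "\<dots> \<le> \<bar>x - y\<bar> * 1" using that by (intro mult_left_mono) auto
      finally show ?thesis by simp
    qed
    have "\<bar>VV - \<sigma>\<^sup>2\<bar> \<le> (\<Sum>e\<in>star n i. \<bar>q' e * (1 - q' e) - w0 \<C> e * (1 - w0 \<C> e)\<bar>)"
      unfolding VV w0(2)[symmetric] sum_subtractf[symmetric] by (rule sum_abs)
    also have "\<dots> \<le> (\<Sum>e\<in>star n i. B * w0 \<C> e + \<bar>q' e - (1 + B) * w0 \<C> e\<bar>)"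
    proof (rule sum_mono)
      fix e
      have "\<bar>q' e * (1 - q' e) - w0 \<C> e * (1 - w0 \<C> e)\<bar> \<le> \<bar>q' e - w0 \<C> e\<bar>"
        using q' w0_prob[of \<C> e] by (intro lip) auto
      also have "\<dots> = \<bar>B * w0 \<C> e + (q' e - (1 + B) * w0 \<C> e)\<bar>" by (simp add: algebra_simps)
      also have "\<dots> \<le> \<bar>B * w0 \<C> e\<bar> + \<bar>q' e - (1 + B) * w0 \<C> e\<bar>" by (rule abs_triangle_ineq)
      also have "\<bar>B * w0 \<C> e\<bar> = B * w0 \<C> e" using B w0_prob[of \<C> e] by simp
      finally show "\<bar>q' e * (1 - q' e) - w0 \<C> e * (1 - w0 \<C> e)\<bar> \<le> B * w0 \<C> e + \<bar>q' e - (1 + B) * w0 \<C> e\<bar>" .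
    qed
    also have "\<dots> = B * \<mu> + (\<Sum>e\<in>star n i. \<bar>q' e - (1 + B) * w0 \<C> e\<bar>)"
      unfolding sum.distrib sum_distrib_left[symmetric] w0(1) ..
    finally show ?thesis using R' by linarith
  qed
  have sL: "sqrt L > 0" "\<sigma> > 0" using L \<sigma>_pos by auto
  have sub: "I \<subseteq> edges n" using I star_edges[OF i] by auto
  show ?thesis
  proof (rule near_gaussian_cnt[where h = h])
    have "\<bar>(M - \<mu>) / (\<sigma> * sqrt L) - v\<bar> \<le> \<bar>B * \<mu> / (\<sigma> * sqrt L) - v\<bar> + \<bar>(M - (1 + B) * \<mu>) / (\<sigma> * sqrt L)\<bar>"
    proof -
      have "(M - \<mu>) / (\<sigma> * sqrt L) - v = (B * \<mu> / (\<sigma> * sqrt L) - v) + (M - (1 + B) * \<mu>) / (\<sigma> * sqrt L)"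
        by (simp add: diff_divide_distrib distrib_right add_divide_distrib)
      then show ?thesis using abs_triangle_ineq[of "B * \<mu> / (\<sigma> * sqrt L) - v" "(M - (1 + B) * \<mu>) / (\<sigma> * sqrt L)"] by presburger
    qed
    moreover have "\<bar>(M - (1 + B) * \<mu>) / (\<sigma> * sqrt L)\<bar> \<le> R / (\<sigma> * sqrt L)"
      using dM sL by (simp add: abs_divide abs_mult divide_right_mono)
    ultimately show "\<bar>((\<Sum>e\<in>I. q e) - \<mu>) / (\<sigma> * sqrt L) - v\<bar> \<le> h"
      using h1 unfolding M_def[symmetric] by linarith
    have "VV / \<sigma>\<^sup>2 - 1 = (VV - \<sigma>\<^sup>2) / \<sigma>\<^sup>2" using sL by (simp add: field_simps)
    then have "\<bar>VV / \<sigma>\<^sup>2 - 1\<bar> = \<bar>VV - \<sigma>\<^sup>2\<bar> / \<sigma>\<^sup>2" by (simp add: abs_divide)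
    also have "\<dots> \<le> (B * \<mu> + R) / \<sigma>\<^sup>2" using dV by (intro divide_right_mono) auto
    finally show "\<bar>(\<Sum>e\<in>I. q e * (1 - q e)) / \<sigma>\<^sup>2 - 1\<bar> \<le> h" using h2 unfolding VV_def[symmetric] by linarith
    have "sqrt L * M / \<sigma> ^ 3 \<le> sqrt L * ((1 + B) * \<mu> + R) / \<sigma> ^ 3"
      using dM sL by (intro divide_right_mono mult_left_mono) auto
    then show "sqrt L * (\<Sum>e\<in>I. q e) / \<sigma> ^ 3 \<le> h" using h3 unfolding M_def[symmetric] by linarith
  qed (use sub q L \<sigma>_pos K h in auto)
qed

text \<open>The numerical conditions under which \<open>near_gaussian_degree\<close> applies with \<open>B = A\<close> and with \<open>B = 0\<close>; the
term \<open>2 * s * pa\<close> bounds the expected number of edges from one vertex into \<open>S\<close> under any of the laws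
considered.\<close>

definition scale_ok :: "nat \<Rightarrow> real \<Rightarrow> real \<Rightarrow> real \<Rightarrow> real \<Rightarrow> real \<Rightarrow> bool" where
  "scale_ok s A L K h v \<longleftrightarrow> 0 \<le> A \<and> A \<le> 1 / 4 \<and> 1 \<le> L \<and> 0 \<le> K \<and> K * sqrt L \<le> \<sigma> \<and>
     \<bar>A * \<mu> / (\<sigma> * sqrt L) - v\<bar> + 2 * real s * pa / (\<sigma> * sqrt L) \<le> h \<and>
     (A * \<mu> + 2 * real s * pa) / \<sigma>\<^sup>2 \<le> h \<and> sqrt L * ((1 + A) * \<mu> + 2 * real s * pa) / \<sigma> ^ 3 \<le> h"

definition std_cnt :: "real \<Rightarrow> (nat \<times> nat) set \<Rightarrow> (nat \<times> nat \<Rightarrow> bool) \<Rightarrow> real" where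
  "std_cnt L I x = sqrt L * ((cnt I x - \<mu>) / \<sigma>)"

lemma std_cnt_greater:
  assumes "L > 0"
  shows "std_cnt L I x > y * L \<longleftrightarrow> cnt I x > \<mu> + y * sqrt L * \<sigma>"
proof -
  have "y * L = sqrt L * (y * sqrt L)" using assms by simp
  then have "std_cnt L I x > y * L \<longleftrightarrow> (cnt I x - \<mu>) / \<sigma> > y * sqrt L"
    unfolding std_cnt_def using assms by (simp only: mult_less_cancel_left_pos real_sqrt_gt_zero)
  then show ?thesis using \<sigma>_pos by (simp add: field_simps)
qed

lemma sum_star_S:
  assumes S: "S \<subseteq> {1..n}" "card S = s" and c: "\<And>j. j \<in> S \<Longrightarrow> 0 \<le> c j \<and> c j \<le> 2 * pa"
    and g: "\<And>j. j \<in> {1..n} - {i} \<Longrightarrow> g (edge i j) = (if j \<in> S then c j else 0)"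
  shows "sum g (star n i) \<le> 2 * real s * pa"
proof -
  have fS: "finite S" using S finite_subset by blast
  have "sum g (star n i) = (\<Sum>j\<in>{1..n} - {i}. if j \<in> S then c j else 0)"
    unfolding sum_star by (rule sum.cong[OF refl]) (rule g)
  also have "\<dots> = (\<Sum>j\<in>({1..n} - {i}) \<inter> S. c j)" by (simp add: sum.inter_restrict)
  also have "\<dots> \<le> (\<Sum>j\<in>S. c j)" using fS c by (intro sum_mono2) auto
  also have "\<dots> \<le> (\<Sum>j\<in>S. 2 * pa)" using c by (intro sum_mono) auto
  finally show ?thesis using S by simp
qed

lemma w0_le_pa: "0 \<le> w0 \<C> (edge i j)" "w0 \<C> (edge i j) \<le> pa"
  using p_bounds unfolding w0_edge by auto

context
  fixes \<C> S s A L K h v \<eta>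
  assumes C: "\<C> \<in> communities n k 1" and S: "S \<subseteq> {1..n}" "card S = s"
    and ok: "scale_ok s A L K h v" and h\<eta>: "h * (K + K\<^sup>2 + K ^ 3) \<le> \<eta>"
begin

lemma A_range: "0 \<le> A" "A \<le> 1 / 4" and L_ge: "1 \<le> L"
  using ok unfolding scale_ok_def by auto

lemma bounds_B:
  assumes B: "B = A \<and> w = v \<or> B = 0 \<and> w = 0"
  shows "\<bar>B * \<mu> / (\<sigma> * sqrt L) - w\<bar> + 2 * real s * pa / (\<sigma> * sqrt L) \<le> h"
    "(B * \<mu> + 2 * real s * pa) / \<sigma>\<^sup>2 \<le> h" "sqrt L * ((1 + B) * \<mu> + 2 * real s * pa) / \<sigma> ^ 3 \<le> h"
proof -
  have BA: "0 \<le> B" "B \<le> A" using B A_range by auto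
  show "\<bar>B * \<mu> / (\<sigma> * sqrt L) - w\<bar> + 2 * real s * pa / (\<sigma> * sqrt L) \<le> h"
    using ok B unfolding scale_ok_def by auto
  have "(B * \<mu> + 2 * real s * pa) / \<sigma>\<^sup>2 \<le> (A * \<mu> + 2 * real s * pa) / \<sigma>\<^sup>2"
    using BA \<mu>_pos p_bounds by (intro divide_right_mono add_mono mult_right_mono) auto
  then show "(B * \<mu> + 2 * real s * pa) / \<sigma>\<^sup>2 \<le> h" using ok unfolding scale_ok_def by linarith
  have "sqrt L * ((1 + B) * \<mu> + 2 * real s * pa) / \<sigma> ^ 3 \<le> sqrt L * ((1 + A) * \<mu> + 2 * real s * pa) / \<sigma> ^ 3"
    using BA \<mu>_pos \<sigma>_pos L_ge p_bounds by (intro divide_right_mono mult_left_mono add_mono mult_right_mono) auto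
  then show "sqrt L * ((1 + B) * \<mu> + 2 * real s * pa) / \<sigma> ^ 3 \<le> h" using ok unfolding scale_ok_def by linarith
qed

lemma near_gaussian_B:
  assumes B: "B = A \<and> w = v \<or> B = 0 \<and> w = 0" and i: "i \<in> {1..n}" and I: "I \<subseteq> star n i"
    and q: "\<And>e. e \<in> I \<Longrightarrow> q e \<in> {0..1}"
    and R: "(\<Sum>e\<in>star n i. \<bar>(if e \<in> I then q e else 0) - (1 + B) * w0 \<C> e\<bar>) \<le> 2 * real s * pa"
  shows "near_gaussian (bern (edges n) q) (std_cnt L I) L K \<eta> w"
  unfolding std_cnt_def
  by (rule near_gaussian_degree[OF C i I q _ _ R _ _ _ bounds_B[OF B] h\<eta>])
     (use B A_range L_ge ok in \<open>auto simp: scale_ok_def\<close>)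

lemma near_gaussian_null:
  assumes i: "i \<in> {1..n}"
  shows "near_gaussian (bern (edges n) (w0 \<C>)) (std_cnt L (star n i)) L K \<eta> 0"
  by (rule near_gaussian_B[where B = 0]) (use i w0_prob p_bounds in auto)

lemma w1_prob: "e \<in> edges n \<Longrightarrow> w1 \<C> S A e \<in> {0..1}"
  using w1_coupled[OF A_range, of e \<C> S] by auto

lemma near_gaussian_cut:
  assumes i: "i \<in> S"
  shows "near_gaussian (bern (edges n) (w1 \<C> S A)) (std_cnt L (edge i ` ({1..n} - S))) L K \<eta> v"
proof (rule near_gaussian_B[where B = A])
  have iS: "i \<in> {1..n}" using i S by auto
  show "i \<in> {1..n}" by fact
  show sub: "edge i ` ({1..n} - S) \<subseteq> star n i" unfolding star_def using i by auto
  show "w1 \<C> S A e \<in> {0..1}" if "e \<in> edge i ` ({1..n} - S)" for e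
    using that sub star_edges[OF iS] w1_prob by blast
  show "(\<Sum>e\<in>star n i. \<bar>(if e \<in> edge i ` ({1..n} - S) then w1 \<C> S A e else 0) - (1 + A) * w0 \<C> e\<bar>) \<le> 2 * real s * pa"
  proof (rule sum_star_S[OF S])
    fix j assume j: "j \<in> {1..n} - {i}"
    have "edge i j \<in> edge i ` ({1..n} - S) \<longleftrightarrow> j \<notin> S" using j inj_edge[of i] by (auto simp: inj_def)
    then show "\<bar>(if edge i j \<in> edge i ` ({1..n} - S) then w1 \<C> S A (edge i j) else 0) - (1 + A) * w0 \<C> (edge i j)\<bar>
        = (if j \<in> S then (1 + A) * w0 \<C> (edge i j) else 0)"
      using i A_range w0_le_pa[of \<C> i j] unfolding w1_edge[OF A_range] by auto
  next
    fix j
    have "(1 + A) * w0 \<C> (edge i j) \<le> 2 * pa" using A_range w0_le_pa[of \<C> i j] p_bounds by (intro mult_mono) auto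
    then show "0 \<le> (1 + A) * w0 \<C> (edge i j) \<and> (1 + A) * w0 \<C> (edge i j) \<le> 2 * pa"
      using A_range w0_le_pa[of \<C> i j] by auto
  qed
qed simp

lemma near_gaussian_alt:
  assumes i: "i \<in> {1..n}"
  shows "near_gaussian (bern (edges n) (w1 \<C> S A)) (std_cnt L (star n i)) L K \<eta> (if i \<in> S then v else 0)"
proof (rule near_gaussian_B[where B = "if i \<in> S then A else 0"])
  let ?B = "if i \<in> S then A else 0"
  show "i \<in> {1..n}" by fact
  show "w1 \<C> S A e \<in> {0..1}" if "e \<in> star n i" for e
    using that star_edges[OF i] w1_prob by blast
  show "(\<Sum>e\<in>star n i. \<bar>(if e \<in> star n i then w1 \<C> S A e else 0) - (1 + ?B) * w0 \<C> e\<bar>) \<le> 2 * real s * pa"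
  proof (rule sum_star_S[OF S])
    fix j assume j: "j \<in> {1..n} - {i}"
    then have e: "edge i j \<in> star n i" by (auto simp: star_def)
    have "w1 \<C> S A (edge i j) - (1 + ?B) * w0 \<C> (edge i j) = (if j \<in> S then A * (1 + ?B) * w0 \<C> (edge i j) else 0)"
      unfolding w1_edge[OF A_range] by (auto simp: algebra_simps)
    then show "\<bar>(if edge i j \<in> star n i then w1 \<C> S A (edge i j) else 0) - (1 + ?B) * w0 \<C> (edge i j)\<bar>
        = (if j \<in> S then A * (1 + ?B) * w0 \<C> (edge i j) else 0)"
      using e A_range w0_le_pa[of \<C> i j] by simp
  next
    fix j
    have "A * (1 + ?B) \<le> 1 * 2" using A_range by (intro mult_mono) auto
    then have "A * (1 + ?B) * w0 \<C> (edge i j) \<le> (1 * 2) * pa"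
      by (rule mult_mono[OF _ w0_le_pa(2)]) (use w0_le_pa[of \<C> i j] in auto)
    then show "0 \<le> A * (1 + ?B) * w0 \<C> (edge i j) \<and> A * (1 + ?B) * w0 \<C> (edge i j) \<le> 2 * pa"
      using A_range w0_le_pa[of \<C> i j] by auto
  qed
qed auto

end

end


section \<open>Asymptotics of the parameters\<close>

lemma multiples_le: "multiples k \<le> sequentially"
  unfolding multiples_def by simp

lemma eventually_multiples: "eventually P sequentially \<Longrightarrow> eventually P (multiples k)"
  using multiples_le[of k] unfolding le_filter_def by blast

lemma eventually_dvd: "\<forall>\<^sub>F n in multiples k. k dvd n"
  unfolding multiples_def by (simp add: eventually_inf_principal)

lemma multiples_nontrivial:
  assumes "k \<ge> 1"
  shows "multiples k \<noteq> bot"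
proof
  assume "multiples k = bot"
  then have "eventually (\<lambda>_. False) (multiples k)" by simp
  then have "eventually (\<lambda>n. \<not> k dvd n) sequentially"
    unfolding multiples_def eventually_inf_principal by simp
  then obtain N where N: "\<And>n. n \<ge> N \<Longrightarrow> \<not> k dvd n" unfolding eventually_sequentially by blast
  have "k * N \<ge> N" using assms by simp
  then show False using N[of "k * N"] by simp
qed

locale asymptotic_regime =
  fixes k :: nat and a b :: "nat \<Rightarrow> real" and s :: "nat \<Rightarrow> nat" and \<tau>a \<tau>b \<alpha> C :: real
  assumes k: "k \<ge> 1"
    and ab: "\<forall>\<^sub>F n in multiples k. 0 < b n \<and> b n < a n \<and> a n \<le> real n / 2"
    and ratio_pos: "0 < Liminf (multiples k) (\<lambda>n. ereal (b n / a n))"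
    and \<tau>a: "((\<lambda>n. a n / real n) \<longlongrightarrow> \<tau>a) (multiples k)"
    and \<tau>b: "((\<lambda>n. b n / real n) \<longlongrightarrow> \<tau>b) (multiples k)"
    and log_b: "((\<lambda>n. ln (real n) / b n) \<longlongrightarrow> 0) (multiples k)"
    and \<alpha>: "1 / 2 < \<alpha>" "\<alpha> < 1"
    and s: "\<forall>\<^sub>F n in multiples k. \<bar>real (s n) - real n powr (1 - \<alpha>)\<bar> < 1"
    and C: "C > 0"
begin

abbreviation "FF \<equiv> multiples k"
abbreviation "L n \<equiv> ln (real n)"
abbreviation "A \<equiv> signal k a b C"
abbreviation "model n \<equiv> balanced_block_model n k (a n) (b n)"
definition "mu n = balanced_block_model.\<mu> n k (a n) (b n)"
definition "sg n = balanced_block_model.\<sigma> n k (a n) (b n)"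
definition "v = sqrt (C / rho k \<tau>a \<tau>b)"

lemma FF_nontrivial [simp]: "FF \<noteq> bot"
  using multiples_nontrivial[OF k] .

lemma ev_ge: "\<forall>\<^sub>F n in FF. N \<le> n"
  by (intro eventually_multiples eventually_ge_at_top)

lemma ev_model: "\<forall>\<^sub>F n in FF. model n"
  using ab eventually_dvd[of k] ev_ge[of "2 * k"]
  by eventually_elim (unfold_locales, use k in auto)

lemma L_at_top: "filterlim L at_top FF"
proof -
  have "filterlim L at_top sequentially"
    by (rule filterlim_compose[OF ln_at_top filterlim_real_sequentially])
  then show ?thesis using multiples_le filterlim_mono by blast
qed

lemma ev_L_ge: "\<forall>\<^sub>F n in FF. c \<le> L n"
  using L_at_top unfolding filterlim_at_top by blast

lemma exp_L: "model n \<Longrightarrow> exp (L n) = real n"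
  using balanced_block_model.n_pos by simp

lemma exp_decay:
  assumes "c < 0"
  shows "((\<lambda>n. exp (c * L n)) \<longlongrightarrow> 0) FF"
  by (rule filterlim_compose[OF exp_at_bot])
     (use filterlim_tendsto_neg_mult_at_bot[OF tendsto_const assms L_at_top] in simp)

lemma L_over_var: "((\<lambda>n. L n / (sg n)\<^sup>2) \<longlongrightarrow> 0) FF"
proof (rule tendsto_sandwich[OF _ _ tendsto_const])
  show "\<forall>\<^sub>F n in FF. 0 \<le> L n / (sg n)\<^sup>2"
    using ev_L_ge[of 0] by eventually_elim auto
  show "\<forall>\<^sub>F n in FF. L n / (sg n)\<^sup>2 \<le> 4 * real k * (L n / b n)"
    using ev_L_ge[of 0] ev_model
  proof eventually_elim
    case (elim n)
    interpret balanced_block_model n k "a n" "b n" by fact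
    have "b n / (4 * real k) \<le> a n / (4 * real k)" using ab k by (intro divide_right_mono) auto
    then have "b n / (4 * real k) \<le> (sg n)\<^sup>2" using \<sigma>_sq_ge unfolding sg_def by linarith
    then have "L n / (sg n)\<^sup>2 \<le> L n / (b n / (4 * real k))"
      using elim(1) ab k \<sigma>_pos by (intro divide_left_mono mult_pos_pos) (auto simp: sg_def)
    then show ?case by (simp add: mult_ac)
  qed
  show "((\<lambda>n. 4 * real k * (L n / b n)) \<longlongrightarrow> 0) FF"
    using tendsto_mult_right_zero[OF log_b, of "4 * real k"] by simp
qed

lemma ev_sg_pos: "\<forall>\<^sub>F n in FF. 0 < sg n"
  using ev_model by eventually_elim (auto simp: sg_def balanced_block_model.\<sigma>_pos)

lemma sqrt_L_over_sg: "((\<lambda>n. sqrt (L n) / sg n) \<longlongrightarrow> 0) FF"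
proof -
  have "((\<lambda>n. sqrt (L n / (sg n)\<^sup>2)) \<longlongrightarrow> sqrt 0) FF" by (intro tendsto_real_sqrt L_over_var)
  moreover have "\<forall>\<^sub>F n in FF. sqrt (L n / (sg n)\<^sup>2) = sqrt (L n) / sg n"
    using ev_sg_pos by eventually_elim (simp add: real_sqrt_divide)
  ultimately show ?thesis using Lim_transform_eventually by fastforce
qed

lemma inverse_var: "((\<lambda>n. 1 / (sg n)\<^sup>2) \<longlongrightarrow> 0) FF"
proof (rule tendsto_sandwich[OF _ _ tendsto_const L_over_var])
  show "\<forall>\<^sub>F n in FF. 0 \<le> 1 / (sg n)\<^sup>2" by simp
  show "\<forall>\<^sub>F n in FF. 1 / (sg n)\<^sup>2 \<le> L n / (sg n)\<^sup>2"
    using ev_L_ge[of 1] by eventually_elim (auto intro: divide_right_mono)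
qed

lemma inverse_n: "((\<lambda>n. 1 / real n) \<longlongrightarrow> 0) FF"
  using lim_1_over_n multiples_le tendsto_mono by blast

lemma \<tau>_bounds: "0 \<le> \<tau>b" "\<tau>b \<le> \<tau>a" "\<tau>a \<le> 1 / 2"
proof -
  show "0 \<le> \<tau>b" by (rule tendsto_lowerbound[OF \<tau>b _ FF_nontrivial]) (use ab in eventually_elim, auto)
  show "\<tau>b \<le> \<tau>a"
    by (rule tendsto_le[OF FF_nontrivial \<tau>a \<tau>b]) (use ab in eventually_elim, auto intro!: divide_right_mono)
  show "\<tau>a \<le> 1 / 2"
    by (rule tendsto_upperbound[OF \<tau>a _ FF_nontrivial])
       (use ab ev_ge[of 1] in eventually_elim, auto simp: field_simps)
qed

lemma mu_sg_formulas:
  assumes "model n"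
  shows "mu n / real n = (1 / real k - 1 / real n) * (a n / real n) + (1 - 1 / real k) * (b n / real n)"
    and "(sg n)\<^sup>2 / real n = (1 / real k - 1 / real n) * (a n / real n * (1 - a n / real n))
           + (1 - 1 / real k) * (b n / real n * (1 - b n / real n))"
proof -
  interpret balanced_block_model n k "a n" "b n" by fact
  have n: "real n \<noteq> 0" using n_pos by simp
  have 1: "real (m - 1) = real n * (1 / real k - 1 / real n)" "real (n - m) = real n * (1 - 1 / real k)"
    unfolding real_sizes m_eq[symmetric] using n by (simp_all add: field_simps)
  show "mu n / real n = (1 / real k - 1 / real n) * (a n / real n) + (1 - 1 / real k) * (b n / real n)"
    unfolding mu_def \<mu>_eq 1 pa_def pb_def add_divide_distrib using n by simp
  show "(sg n)\<^sup>2 / real n = (1 / real k - 1 / real n) * (a n / real n * (1 - a n / real n))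
           + (1 - 1 / real k) * (b n / real n * (1 - b n / real n))"
    unfolding sg_def \<sigma>_sq 1 pa_def pb_def add_divide_distrib using n by simp
qed

text \<open>Here the constant \<open>rho\<close> enters. If \<open>a / n\<close> tends to 0, every factor \<open>1 - p\<close> in the variance tends to 1, so
that mean and variance are asymptotically equal; otherwise both are of order \<open>n\<close>.\<close>

lemma rho_pos: "rho k \<tau>a \<tau>b > 0"
  and mu_over_var: "((\<lambda>n. mu n / (sg n)\<^sup>2) \<longlongrightarrow> 1 / sqrt (rho k \<tau>a \<tau>b)) FF"
proof -
  have "rho k \<tau>a \<tau>b > 0 \<and> ((\<lambda>n. mu n / (sg n)\<^sup>2) \<longlongrightarrow> 1 / sqrt (rho k \<tau>a \<tau>b)) FF"
  proof (cases "\<tau>a = 0 \<and> \<tau>b = 0")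
    case True
    have "((\<lambda>n. mu n / (sg n)\<^sup>2) \<longlongrightarrow> 1) FF"
    proof (rule tendsto_sandwich[OF _ _ tendsto_const])
      show "\<forall>\<^sub>F n in FF. 1 \<le> mu n / (sg n)\<^sup>2"
        using ev_model
      proof eventually_elim
        case (elim n)
        interpret balanced_block_model n k "a n" "b n" by fact
        show ?case using \<sigma>_le \<sigma>_pos unfolding mu_def sg_def by simp
      qed
      show "\<forall>\<^sub>F n in FF. mu n / (sg n)\<^sup>2 \<le> 1 / (1 - a n / real n)"
        using ev_model
      proof eventually_elim
        case (elim n)
        interpret balanced_block_model n k "a n" "b n" by fact
        have "(1 - pa) * \<mu> = real (m - 1) * (pa * (1 - pa)) + real (n - m) * (pb * (1 - pa))"
          unfolding \<mu>_eq by (simp add: algebra_simps)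
        also have "\<dots> \<le> \<sigma>\<^sup>2" unfolding \<sigma>_sq using p_bounds by (intro add_mono mult_left_mono) auto
        finally have "(1 - pa) * \<mu> \<le> \<sigma>\<^sup>2" .
        then have "\<mu> / \<sigma>\<^sup>2 \<le> 1 / (1 - pa)" using p_bounds \<sigma>_pos by (simp add: field_simps)
        then show ?case unfolding mu_def sg_def pa_def .
      qed
      have "((\<lambda>n. 1 / (1 - a n / real n)) \<longlongrightarrow> 1 / (1 - \<tau>a)) FF"
        using True by (intro tendsto_divide tendsto_diff tendsto_const \<tau>a) auto
      then show "((\<lambda>n. 1 / (1 - a n / real n)) \<longlongrightarrow> 1) FF" using True by simp
    qed
    then show ?thesis using True by (simp add: rho_def)
  next
    case False
    then have \<tau>: "\<tau>a > 0" using \<tau>_bounds by auto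
    define M1 where "M1 = 1 / real k * \<tau>a + (1 - 1 / real k) * \<tau>b"
    define V1 where "V1 = 1 / real k * (\<tau>a * (1 - \<tau>a)) + (1 - 1 / real k) * (\<tau>b * (1 - \<tau>b))"
    have kk: "0 < 1 / real k" "0 \<le> 1 - 1 / real k" using k by auto
    have pos: "M1 > 0" "V1 > 0"
      unfolding M1_def V1_def using kk \<tau> \<tau>_bounds by (auto intro!: add_pos_nonneg mult_nonneg_nonneg mult_pos_pos)
    have rho: "rho k \<tau>a \<tau>b = (V1 / M1)\<^sup>2"
    proof -
      have "(real k - 1) / real k = 1 - 1 / real k" using k by (simp add: field_simps)
      then show ?thesis using False unfolding rho_def M1_def V1_def by (auto simp: power_divide mult.assoc)
    qed
    have "((\<lambda>n. mu n / real n) \<longlongrightarrow> (1 / real k - 0) * \<tau>a + (1 - 1 / real k) * \<tau>b) FF"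
      by (rule Lim_transform_eventually[OF _ eventually_mono[OF ev_model mu_sg_formulas(1)[symmetric]]])
         (intro tendsto_intros \<tau>a \<tau>b inverse_n)
    then have lM: "((\<lambda>n. mu n / real n) \<longlongrightarrow> M1) FF" by (simp add: M1_def)
    have "((\<lambda>n. (sg n)\<^sup>2 / real n) \<longlongrightarrow> (1 / real k - 0) * (\<tau>a * (1 - \<tau>a)) + (1 - 1 / real k) * (\<tau>b * (1 - \<tau>b))) FF"
      by (rule Lim_transform_eventually[OF _ eventually_mono[OF ev_model mu_sg_formulas(2)[symmetric]]])
         (intro tendsto_intros \<tau>a \<tau>b inverse_n)
    then have lV: "((\<lambda>n. (sg n)\<^sup>2 / real n) \<longlongrightarrow> V1) FF" by (simp add: V1_def)
    have "((\<lambda>n. (mu n / real n) / ((sg n)\<^sup>2 / real n)) \<longlongrightarrow> M1 / V1) FF"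
      using pos by (intro tendsto_divide lM lV) auto
    moreover have "\<forall>\<^sub>F n in FF. (mu n / real n) / ((sg n)\<^sup>2 / real n) = mu n / (sg n)\<^sup>2"
      using ev_ge[of 1] by eventually_elim auto
    ultimately have "((\<lambda>n. mu n / (sg n)\<^sup>2) \<longlongrightarrow> M1 / V1) FF" by (rule Lim_transform_eventually)
    moreover have "1 / sqrt (rho k \<tau>a \<tau>b) = M1 / V1" unfolding rho using pos by simp
    ultimately show ?thesis using rho pos by simp
  qed
  then show "rho k \<tau>a \<tau>b > 0" "((\<lambda>n. mu n / (sg n)\<^sup>2) \<longlongrightarrow> 1 / sqrt (rho k \<tau>a \<tau>b)) FF" by auto
qed

lemma v_pos: "v > 0" and v_sq: "v\<^sup>2 = C / rho k \<tau>a \<tau>b"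
  using C rho_pos by (auto simp: v_def)

abbreviation "var0 n \<equiv> sigma0_sq n k (a n) (b n)"

lemma var0_eq:
  assumes "model n"
  shows "var0 n = (sg n)\<^sup>2 + a n / real n * (1 - a n / real n)"
proof -
  interpret balanced_block_model n k "a n" "b n" by fact
  have 1: "(real k - 1) * real n / real k = real n - real n / real k" using k by (simp add: field_simps)
  show ?thesis
    unfolding sigma0_sq_def 1 sg_def \<sigma>_sq real_sizes m_eq pa_def[symmetric] pb_def[symmetric]
    by (simp add: algebra_simps)
qed

lemma var0_ge: "model n \<Longrightarrow> var0 n \<ge> (sg n)\<^sup>2"
  and var0_le: "model n \<Longrightarrow> var0 n \<le> (sg n)\<^sup>2 + 1"
proof -
  assume m: "model n"
  then interpret balanced_block_model n k "a n" "b n" .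
  have "0 \<le> pa * (1 - pa)" "pa * (1 - pa) \<le> 1" using p_bounds by (auto intro: mult_le_one)
  then show "var0 n \<ge> (sg n)\<^sup>2" "var0 n \<le> (sg n)\<^sup>2 + 1" unfolding var0_eq[OF m] pa_def by auto
qed

lemma var_over_var0: "((\<lambda>n. (sg n)\<^sup>2 / var0 n) \<longlongrightarrow> 1) FF"
proof (rule tendsto_sandwich[OF _ _ _ tendsto_const])
  show "\<forall>\<^sub>F n in FF. 1 / (1 + 1 / (sg n)\<^sup>2) \<le> (sg n)\<^sup>2 / var0 n"
    using ev_model ev_sg_pos
  proof eventually_elim
    case (elim n)
    have "1 / (1 + 1 / (sg n)\<^sup>2) = (sg n)\<^sup>2 / ((sg n)\<^sup>2 + 1)" using elim(2) by (simp add: field_simps)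
    also have "\<dots> \<le> (sg n)\<^sup>2 / var0 n"
      using var0_le[OF elim(1)] var0_ge[OF elim(1)] zero_less_power[OF elim(2), of 2]
      by (intro divide_left_mono mult_pos_pos) linarith+
    finally show ?case .
  qed
  show "\<forall>\<^sub>F n in FF. (sg n)\<^sup>2 / var0 n \<le> 1"
    using ev_model ev_sg_pos
  proof eventually_elim
    case (elim n)
    have "0 < var0 n" using var0_ge[OF elim(1)] zero_less_power[OF elim(2), of 2] by linarith
    then show ?case using var0_ge[OF elim(1)] by simp
  qed
  have "((\<lambda>n. 1 / (1 + 1 / (sg n)\<^sup>2)) \<longlongrightarrow> 1 / (1 + 0)) FF"
    by (intro tendsto_intros inverse_var) auto
  then show "((\<lambda>n. 1 / (1 + 1 / (sg n)\<^sup>2)) \<longlongrightarrow> 1) FF" by simp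
qed

lemma A_nonneg: "\<forall>\<^sub>F n in FF. 0 \<le> A n"
  using ev_model ev_L_ge[of 0]
proof eventually_elim
  case (elim n)
  have "var0 n \<ge> 0" using var0_ge[OF elim(1)] zero_le_power2[of "sg n"] by linarith
  then show ?case unfolding signal_def using C elim by auto
qed

lemma A_tendsto: "(A \<longlongrightarrow> 0) FF"
proof (rule tendsto_sandwich[OF A_nonneg _ tendsto_const])
  show "\<forall>\<^sub>F n in FF. A n \<le> sqrt (C * (L n / (sg n)\<^sup>2))"
    using ev_model ev_L_ge[of 0] ev_sg_pos
  proof eventually_elim
    case (elim n)
    have "(sg n)\<^sup>2 > 0" "var0 n > 0"
      using var0_ge[OF elim(1)] zero_less_power[OF elim(3), of 2] by linarith+
    then have "C * L n / var0 n \<le> C * L n / (sg n)\<^sup>2"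
      using C elim(2) var0_ge[OF elim(1)] by (intro divide_left_mono mult_pos_pos) auto
    then show ?case unfolding signal_def by simp
  qed
  have "((\<lambda>n. sqrt (C * (L n / (sg n)\<^sup>2))) \<longlongrightarrow> sqrt (C * 0)) FF"
    by (intro tendsto_intros L_over_var)
  then show "((\<lambda>n. sqrt (C * (L n / (sg n)\<^sup>2))) \<longlongrightarrow> 0) FF" by simp
qed

text \<open>The mean of a boosted degree moves by about \<open>A * mu\<close>; this is the shift in units of \<open>sqrt L\<close> standard
deviations.\<close>

lemma shift_tendsto: "((\<lambda>n. A n * mu n / (sg n * sqrt (L n))) \<longlongrightarrow> v) FF"
proof -
  have "((\<lambda>n. sqrt (C * (mu n / (sg n)\<^sup>2)\<^sup>2 * ((sg n)\<^sup>2 / var0 n))) \<longlongrightarrow>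
      sqrt (C * (1 / sqrt (rho k \<tau>a \<tau>b))\<^sup>2 * 1)) FF"
    by (intro tendsto_intros mu_over_var var_over_var0)
  also have "sqrt (C * (1 / sqrt (rho k \<tau>a \<tau>b))\<^sup>2 * 1) = v"
    using rho_pos by (simp add: v_def power_divide)
  finally show ?thesis
  proof (rule Lim_transform_eventually)
    show "\<forall>\<^sub>F n in FF. sqrt (C * (mu n / (sg n)\<^sup>2)\<^sup>2 * ((sg n)\<^sup>2 / var0 n)) = A n * mu n / (sg n * sqrt (L n))"
      using ev_model ev_L_ge[of 1] ev_sg_pos
    proof eventually_elim
      case (elim n)
      have mu: "mu n > 0" unfolding mu_def using balanced_block_model.\<mu>_pos[OF elim(1)] .
      have v0: "var0 n > 0" using var0_ge[OF elim(1)] zero_less_power[OF elim(3), of 2] by linarith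
      show ?case unfolding signal_def
      proof (rule real_sqrt_unique)
        show "(sqrt (C * ln (real n) / var0 n) * mu n / (sg n * sqrt (L n)))\<^sup>2 = C * (mu n / (sg n)\<^sup>2)\<^sup>2 * ((sg n)\<^sup>2 / var0 n)"
          using C mu v0 elim by (simp add: power_divide power_mult_distrib field_simps power2_eq_square)
        show "0 \<le> sqrt (C * ln (real n) / var0 n) * mu n / (sg n * sqrt (L n))"
          using C mu v0 elim by auto
      qed
    qed
  qed
qed

lemma ev_s_bounds: "\<forall>\<^sub>F n in FF. exp ((1 - \<alpha>) * L n) / 2 \<le> real (s n) \<and> real (s n) \<le> 2 * exp ((1 - \<alpha>) * L n)"
  using s ev_model ev_L_ge[of "ln 2 / (1 - \<alpha>)"]
proof eventually_elim
  case (elim n)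
  have e: "real n powr (1 - \<alpha>) = exp ((1 - \<alpha>) * L n)"
    using balanced_block_model.n_pos[OF elim(2)] by (simp add: powr_def)
  have "ln 2 \<le> (1 - \<alpha>) * L n" using elim(3) \<alpha> by (simp add: field_simps)
  then have "2 \<le> exp ((1 - \<alpha>) * L n)" using exp_le_cancel_iff[of "ln 2" "(1 - \<alpha>) * L n"] by simp
  then show ?case using elim(1) unfolding e by linarith
qed

definition "R n = 2 * real (s n) * (a n / real n)"

text \<open>The edges inside \<open>S\<close> are negligible because \<open>s * a / n\<close> is at most of the order
\<open>sqrt a * n powr (1 / 2 - \<alpha>)\<close>, while the standard deviation is of order \<open>sqrt a\<close>.\<close>

lemma R_over_sg: "((\<lambda>n. R n / sg n) \<longlongrightarrow> 0) FF"
proof (rule tendsto_sandwich[OF _ _ tendsto_const])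
  show "\<forall>\<^sub>F n in FF. 0 \<le> R n / sg n"
    using ev_sg_pos ab by eventually_elim (auto simp: R_def)
  show "\<forall>\<^sub>F n in FF. R n / sg n \<le> sqrt (32 * real k * exp ((1 - 2 * \<alpha>) * L n))"
    using ev_model ev_sg_pos ev_s_bounds
  proof eventually_elim
    case (elim n)
    interpret balanced_block_model n k "a n" "b n" by fact
    have n: "real n > 0" using n_pos by simp
    have "(R n / sg n)\<^sup>2 = 4 * (real (s n))\<^sup>2 * (a n / real n)\<^sup>2 / (sg n)\<^sup>2"
      by (simp add: R_def power_divide power_mult_distrib)
    also have "\<dots> \<le> 4 * (real (s n))\<^sup>2 * (a n / real n)\<^sup>2 / (a n / (4 * real k))"
      using \<sigma>_sq_ge \<sigma>_pos ab k by (intro divide_left_mono mult_pos_pos) (auto simp: sg_def)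
    also have "\<dots> = 16 * real k * (real (s n))\<^sup>2 * (a n / real n) / real n"
      using ab n by (simp add: field_simps power2_eq_square)
    also have "\<dots> \<le> 16 * real k * (2 * exp ((1 - \<alpha>) * L n))\<^sup>2 * (1 / 2) / real n"
      using p_bounds elim(3) n by (intro divide_right_mono mult_mono power_mono) (auto simp: pa_def)
    also have "\<dots> = 32 * real k * (exp ((1 - \<alpha>) * L n) * exp ((1 - \<alpha>) * L n) / exp (L n))"
      unfolding exp_L[OF elim(1)] by (simp add: power2_eq_square)
    also have "exp ((1 - \<alpha>) * L n) * exp ((1 - \<alpha>) * L n) / exp (L n) = exp ((1 - 2 * \<alpha>) * L n)"
      unfolding exp_add[symmetric] exp_diff[symmetric] by (simp add: algebra_simps)
    finally show ?case by (rule real_le_rsqrt)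
  qed
  have "((\<lambda>n. sqrt (32 * real k * exp ((1 - 2 * \<alpha>) * L n))) \<longlongrightarrow> sqrt (32 * real k * 0)) FF"
    using \<alpha> by (intro tendsto_intros exp_decay) auto
  then show "((\<lambda>n. sqrt (32 * real k * exp ((1 - 2 * \<alpha>) * L n))) \<longlongrightarrow> 0) FF" by simp
qed

lemma ev_scale_ok:
  assumes h: "h > 0" and K: "K \<ge> 0"
  shows "\<forall>\<^sub>F n in FF. balanced_block_model.scale_ok n k (a n) (b n) (s n) (A n) (L n) K h v"
proof -
  have inv: "((\<lambda>n. 1 / sg n) \<longlongrightarrow> 0) FF"
  proof -
    have "((\<lambda>n. sqrt (1 / (sg n)\<^sup>2)) \<longlongrightarrow> sqrt 0) FF" by (intro tendsto_real_sqrt inverse_var)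
    moreover have "\<forall>\<^sub>F n in FF. sqrt (1 / (sg n)\<^sup>2) = 1 / sg n"
      using ev_sg_pos by eventually_elim (simp add: real_sqrt_divide)
    ultimately show ?thesis using Lim_transform_eventually by fastforce
  qed
  have R2: "((\<lambda>n. R n / (sg n)\<^sup>2) \<longlongrightarrow> 0) FF"
    using tendsto_mult[OF R_over_sg inv] by (simp add: power2_eq_square)
  have "((\<lambda>n. \<bar>A n * mu n / (sg n * sqrt (L n)) - v\<bar> + R n / sg n) \<longlongrightarrow> \<bar>v - v\<bar> + 0) FF"
    by (intro tendsto_intros shift_tendsto R_over_sg)
  then have e1: "\<forall>\<^sub>F n in FF. \<bar>A n * mu n / (sg n * sqrt (L n)) - v\<bar> + R n / sg n < h"
    using h by (intro order_tendstoD(2)) auto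
  have "((\<lambda>n. A n * (mu n / (sg n)\<^sup>2) + R n / (sg n)\<^sup>2) \<longlongrightarrow> 0 * (1 / sqrt (rho k \<tau>a \<tau>b)) + 0) FF"
    by (intro tendsto_intros A_tendsto mu_over_var R2)
  then have e2: "\<forall>\<^sub>F n in FF. A n * (mu n / (sg n)\<^sup>2) + R n / (sg n)\<^sup>2 < h"
    using h by (intro order_tendstoD(2)) auto
  have "((\<lambda>n. sqrt (L n) / sg n * ((1 + A n) * (mu n / (sg n)\<^sup>2) + R n / (sg n)\<^sup>2)) \<longlongrightarrow>
       0 * ((1 + 0) * (1 / sqrt (rho k \<tau>a \<tau>b)) + 0)) FF"
    by (intro tendsto_intros A_tendsto mu_over_var R2 sqrt_L_over_sg)
  then have e3: "\<forall>\<^sub>F n in FF. sqrt (L n) / sg n * ((1 + A n) * (mu n / (sg n)\<^sup>2) + R n / (sg n)\<^sup>2) < h"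
    using h by (intro order_tendstoD(2)) auto
  have "((\<lambda>n. K * (sqrt (L n) / sg n)) \<longlongrightarrow> K * 0) FF" by (intro tendsto_intros sqrt_L_over_sg)
  then have e4: "\<forall>\<^sub>F n in FF. K * (sqrt (L n) / sg n) < 1" by (intro order_tendstoD(2)) auto
  have e5: "\<forall>\<^sub>F n in FF. A n < 1 / 4" using A_tendsto by (intro order_tendstoD(2)) auto
  show ?thesis
    using ev_model e1 e2 e3 e4 e5 A_nonneg ev_L_ge[of 1] ev_sg_pos ab
  proof eventually_elim
    case (elim n)
    have Rn: "2 * real (s n) * balanced_block_model.pa n (a n) = R n"
      unfolding R_def balanced_block_model.pa_def[OF elim(1)] ..
    have R0: "R n \<ge> 0" using elim by (auto simp: R_def)
    have s1: "sqrt (L n) \<ge> 1" using elim by simp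
    have "R n / (sg n * sqrt (L n)) = (R n / sg n) / sqrt (L n)" by simp
    also have "\<dots> \<le> (R n / sg n) / 1"
      using s1 R0 elim(9) by (intro frac_le) auto
    finally have r: "R n / (sg n * sqrt (L n)) \<le> R n / sg n" by simp
    have "sqrt (L n) * ((1 + A n) * mu n + R n) / sg n ^ 3 =
        sqrt (L n) / sg n * ((1 + A n) * (mu n / (sg n)\<^sup>2) + R n / (sg n)\<^sup>2)"
      using elim by (simp add: field_simps power2_eq_square power3_eq_cube)
    then have c3: "sqrt (L n) * ((1 + A n) * mu n + R n) / sg n ^ 3 \<le> h" using elim(4) by linarith
    have c1: "K * sqrt (L n) \<le> sg n" using elim(5,9) by (simp add: field_simps)
    have c2: "(A n * mu n + R n) / (sg n)\<^sup>2 \<le> h" using elim(3) by (simp add: add_divide_distrib)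
    have c0: "\<bar>A n * mu n / (sg n * sqrt (L n)) - v\<bar> + R n / (sg n * sqrt (L n)) \<le> h" using elim(2) r by linarith
    have "A n \<le> 1 / 4" using elim(6) by simp
    then show ?case
      unfolding balanced_block_model.scale_ok_def[OF elim(1)] mu_def[symmetric] sg_def[symmetric] Rn
      using c0 c1 c2 c3 elim(7,8) K by blast
  qed
qed

end


section \<open>Degree tails, uniformly over assignments and alternatives\<close>

abbreviation cut :: "nat \<Rightarrow> nat set \<Rightarrow> nat \<Rightarrow> (nat \<times> nat) set" where
  "cut n S i \<equiv> edge i ` ({1..n} - S)"

context balanced_block_model
begin

lemma F_mono: "u \<le> u' \<Longrightarrow> F u' \<le> F u"
  unfolding F_def two_class_tail_def by (rule Pr_mono) auto

lemma G_nonneg: "0 \<le> G u"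
  unfolding G_def using \<delta>_nonneg p_bounds by (auto intro!: add_nonneg_nonneg mult_nonneg_nonneg)

lemma G_mono:
  assumes "\<mu> \<le> u" "u \<le> u'"
  shows "G u' \<le> G u"
proof -
  have 1: "1 \<in> {1..n}" using n_pos by auto
  show ?thesis unfolding G_eq[OF ref_in 1]
    by (rule E_mono) (use assms in auto)
qed

lemma V_nonneg: "0 \<le> V u"
  using variance_exceedances[OF ref_in, of u] by (metis (no_types, lifting) Bochner_Integration.integral_nonneg zero_le_power2)

lemma w1_less_1:
  assumes A: "0 \<le> A" "A \<le> 1 / 4" and e: "e \<in> edges n"
  shows "w1 \<C> S A e < 1"
proof -
  obtain i j where ij: "e = edge i j" using edges_edge[OF e] by blast
  let ?f = "(if i \<in> S then 1 + A else 1) * (if j \<in> S then 1 + A else 1)"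
  have "?f \<le> (1 + 1 / 4) * (1 + 1 / 4)" using A by (intro mult_mono) auto
  then have "?f * w0 \<C> e \<le> ((1 + 1 / 4) * (1 + 1 / 4)) * (1 / 2)"
    by (rule mult_mono) (use w0_bounds[of \<C> e] in auto)
  then show ?thesis using w1_edge[OF A, of \<C> S i j] ij by simp
qed

end

context asymptotic_regime
begin

abbreviation "nullw n \<equiv> balanced_block_model.w0 n (a n) (b n)"
abbreviation "altw n \<equiv> balanced_block_model.w1 n (a n) (b n)"
abbreviation "tailF n \<equiv> balanced_block_model.F n k (a n) (b n)"
abbreviation "tailG n \<equiv> balanced_block_model.G n k (a n) (b n)"
abbreviation "varV n \<equiv> balanced_block_model.V n k (a n) (b n)"
abbreviation "stdc n \<equiv> balanced_block_model.std_cnt n k (a n) (b n)"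
definition "thr x n = mu n + x * sqrt (L n) * sg n"

lemma ev_s_le: "\<forall>\<^sub>F n in FF. 0 < s n \<and> s n \<le> n"
  using ev_s_bounds ev_model ev_L_ge[of "ln 2 / \<alpha>"]
proof eventually_elim
  case (elim n)
  have "ln 2 \<le> \<alpha> * L n" using elim(3) \<alpha> by (simp add: field_simps)
  then have "2 \<le> exp (\<alpha> * L n)" using exp_le_cancel_iff[of "ln 2" "\<alpha> * L n"] by simp
  then have "2 * exp ((1 - \<alpha>) * L n) \<le> exp (\<alpha> * L n) * exp ((1 - \<alpha>) * L n)" by simp
  also have "\<dots> = exp (L n)" unfolding exp_add[symmetric] by (simp add: algebra_simps)
  also have "\<dots> = real n" by (rule exp_L[OF elim(2)])
  finally have 1: "real (s n) \<le> real n" using elim(1) by linarith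
  have "0 < exp ((1 - \<alpha>) * L n) / 2" by simp
  then have "0 < real (s n)" using elim(1) by linarith
  then show ?case using 1 by simp
qed

definition sparse_sets :: "nat \<Rightarrow> nat set set" where
  "sparse_sets n = {S. S \<subseteq> {1..n} \<and> card S = s n}"

lemma ev_sparse_sets: "\<forall>\<^sub>F n in FF. sparse_sets n \<noteq> {}"
  using ev_s_le
proof eventually_elim
  case (elim n)
  then have "{1..s n} \<in> sparse_sets n" by (auto simp: sparse_sets_def)
  then show ?case by blast
qed

lemma ev_near_gaussian:
  assumes \<eta>: "\<eta> > 0" and K: "K \<ge> 0"
  shows "\<forall>\<^sub>F n in FF. \<forall>\<C>\<in>communities n k 1. \<forall>S\<in>sparse_sets n.
     (\<forall>i\<in>{1..n}. near_gaussian (bern (edges n) (nullw n \<C>)) (stdc n (L n) (star n i)) (L n) K \<eta> 0) \<and>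
     (\<forall>i\<in>S. near_gaussian (bern (edges n) (altw n \<C> S (A n))) (stdc n (L n) (cut n S i)) (L n) K \<eta> v) \<and>
     (\<forall>i\<in>{1..n}. near_gaussian (bern (edges n) (altw n \<C> S (A n))) (stdc n (L n) (star n i)) (L n) K \<eta> (if i \<in> S then v else 0))"
proof -
  define h where "h = \<eta> / (K + K\<^sup>2 + K ^ 3 + 1)"
  have den: "K + K\<^sup>2 + K ^ 3 + 1 > 0" using K by (intro add_nonneg_pos add_nonneg_nonneg) auto
  have h: "h > 0" using \<eta> den by (simp add: h_def)
  have "h * (K + K\<^sup>2 + K ^ 3) \<le> h * (K + K\<^sup>2 + K ^ 3 + 1)" using h by simp
  also have "\<dots> = \<eta>" using den by (simp add: h_def)
  finally have h\<eta>: "h * (K + K\<^sup>2 + K ^ 3) \<le> \<eta>" .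
  show ?thesis
    using ev_model ev_scale_ok[OF h K]
  proof eventually_elim
    case (elim n)
    interpret balanced_block_model n k "a n" "b n" by fact
    show ?case
      using near_gaussian_null[OF _ _ _ elim(2) h\<eta>] near_gaussian_cut[OF _ _ _ elim(2) h\<eta>]
        near_gaussian_alt[OF _ _ _ elim(2) h\<eta>]
      unfolding sparse_sets_def by blast
  qed
qed

lemma ev_A_range: "\<forall>\<^sub>F n in FF. 0 \<le> A n \<and> A n \<le> 1 / 4"
proof -
  have "\<forall>\<^sub>F n in FF. A n < 1 / 4" using A_tendsto by (intro order_tendstoD(2)) auto
  with A_nonneg show ?thesis by eventually_elim auto
qed

lemma stdc_greater:
  assumes "model n" "L n > 0"
  shows "stdc n (L n) I x > y * L n \<longleftrightarrow> cnt I x > thr y n"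
proof -
  interpret balanced_block_model n k "a n" "b n" by fact
  show ?thesis using std_cnt_greater[OF assms(2)] unfolding thr_def mu_def sg_def .
qed

lemma null_tail_upper:
  assumes x: "x > 0" "\<beta> < x\<^sup>2 / 2"
  shows "\<forall>\<^sub>F n in FF. tailF n (thr x n) \<le> exp (- \<beta> * L n) \<and> tailG n (thr x n) \<le> sg n * exp (- \<beta> * L n)"
proof -
  have x': "\<beta> < (x - 0)\<^sup>2 / 2" using x by simp
  obtain \<eta>1 K1 where 1: "\<eta>1 > 0" "K1 > 0" and
    up: "\<forall>L\<ge>0. \<forall>M (W :: (nat \<times> nat \<Rightarrow> bool) \<Rightarrow> real). finite (set_pmf M) \<longrightarrow> near_gaussian M W L K1 \<eta>1 0 \<longrightarrow>
        Pr M (\<lambda>\<omega>. W \<omega> > x * L) \<le> exp (- \<beta> * L)"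
    using gaussian_upper_tail[OF x(1) x', where 'a = "nat \<times> nat \<Rightarrow> bool"] by (elim exE conjE) (rule that)
  obtain \<eta>2 K2 L2 where 2: "\<eta>2 > 0" "K2 > 0" "L2 > 0" and
    tr: "\<forall>L\<ge>L2. \<forall>M (W :: (nat \<times> nat \<Rightarrow> bool) \<Rightarrow> real). finite (set_pmf M) \<longrightarrow> near_gaussian M W L K2 \<eta>2 0 \<longrightarrow>
        E M (\<lambda>\<omega>. W \<omega> / sqrt L * of_bool (W \<omega> > x * L)) \<le> exp (- \<beta> * L)"
    using gaussian_truncated_mean[OF x, where 'a = "nat \<times> nat \<Rightarrow> bool"] by (elim exE conjE) (rule that)
  show ?thesis
    using ev_model ev_sparse_sets ev_near_gaussian[of \<eta>1 K1, OF 1(1) less_imp_le[OF 1(2)]]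
      ev_near_gaussian[of \<eta>2 K2, OF 2(1) less_imp_le[OF 2(2)]] ev_L_ge[of 1] ev_L_ge[of L2]
  proof eventually_elim
    case (elim n)
    interpret balanced_block_model n k "a n" "b n" by fact
    let ?C = "ref_communities n k"
    let ?M = "bern (edges n) (nullw n ?C)"
    let ?W = "std_cnt (L n) (star n 1)"
    obtain S where S: "S \<in> sparse_sets n" using elim(2) by blast
    have one: "1 \<in> {1..n}" using n_pos by auto
    have Lp: "L n > 0" using elim(5) by linarith
    have ng: "near_gaussian ?M ?W (L n) K1 \<eta>1 0" "near_gaussian ?M ?W (L n) K2 \<eta>2 0"
      using bspec[OF bspec[OF elim(3) ref_in] S, THEN conjunct1, rule_format, OF one]
        bspec[OF bspec[OF elim(4) ref_in] S, THEN conjunct1, rule_format, OF one] by simp_all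
    have "tailF n (thr x n) = Pr ?M (\<lambda>\<omega>. ?W \<omega> > x * L n)"
      unfolding stdc_greater[OF elim(1) Lp] Pr_exceed[OF ref_in one] ..
    also have "\<dots> \<le> exp (- \<beta> * L n)" by (rule up[rule_format]) (use ng Lp in auto)
    finally have F: "tailF n (thr x n) \<le> exp (- \<beta> * L n)" .
    have "tailG n (thr x n) = E ?M (\<lambda>\<omega>. sg n * (?W \<omega> / sqrt (L n) * of_bool (?W \<omega> > x * L n)))"
      unfolding stdc_greater[OF elim(1) Lp] G_eq[OF ref_in one]
      using \<sigma>_pos Lp by (intro E_cong) (auto simp: std_cnt_def sg_def)
    also have "\<dots> = sg n * E ?M (\<lambda>\<omega>. ?W \<omega> / sqrt (L n) * of_bool (?W \<omega> > x * L n))" by simp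
    also have "\<dots> \<le> sg n * exp (- \<beta> * L n)"
      using \<sigma>_pos by (intro mult_left_mono tr[rule_format]) (use ng elim in \<open>auto simp: sg_def\<close>)
    finally show ?case using F by simp
  qed
qed

lemma null_tail_lower:
  assumes x: "x > 0" "x\<^sup>2 / 2 < \<beta>"
  shows "\<forall>\<^sub>F n in FF. exp (- \<beta> * L n) \<le> tailF n (thr x n)"
proof -
  have x': "(x - 0)\<^sup>2 / 2 < \<beta>" using x by simp
  obtain \<eta> K L0 where 1: "\<eta> > 0" "K > 0" "L0 > 0" and
    lo: "\<forall>L\<ge>L0. \<forall>M (W :: (nat \<times> nat \<Rightarrow> bool) \<Rightarrow> real). finite (set_pmf M) \<longrightarrow> near_gaussian M W L K \<eta> 0 \<longrightarrow>
        exp (- \<beta> * L) \<le> Pr M (\<lambda>\<omega>. W \<omega> > x * L)"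
    using gaussian_lower_tail[OF x(1) x', where 'a = "nat \<times> nat \<Rightarrow> bool"] by (elim exE conjE) (rule that)
  show ?thesis
    using ev_model ev_sparse_sets ev_near_gaussian[of \<eta> K, OF 1(1) less_imp_le[OF 1(2)]] ev_L_ge[of L0]
  proof eventually_elim
    case (elim n)
    interpret balanced_block_model n k "a n" "b n" by fact
    let ?C = "ref_communities n k"
    obtain S where S: "S \<in> sparse_sets n" using elim(2) by blast
    have one: "1 \<in> {1..n}" using n_pos by auto
    have Lp: "L n > 0" using elim(4) 1 by linarith
    have "exp (- \<beta> * L n) \<le> Pr (bern (edges n) (nullw n ?C)) (\<lambda>\<omega>. std_cnt (L n) (star n 1) \<omega> > x * L n)"
      using bspec[OF bspec[OF elim(3) ref_in] S, THEN conjunct1, rule_format, OF one] elim(4)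
      by (intro lo[rule_format]) simp_all
    then show ?case unfolding stdc_greater[OF elim(1) Lp] Pr_exceed[OF ref_in one] .
  qed
qed

lemma cut_tail_lower:
  assumes x: "v < x" "(x - v)\<^sup>2 / 2 < \<beta>"
  shows "\<forall>\<^sub>F n in FF. \<forall>\<C>\<in>communities n k 1. \<forall>S\<in>sparse_sets n. \<forall>i\<in>S.
     exp (- \<beta> * L n) \<le> Pr (bern (edges n) (altw n \<C> S (A n))) (\<lambda>x'. cnt (cut n S i) x' > thr x n)"
proof -
  obtain \<eta> K L0 where 1: "\<eta> > 0" "K > 0" "L0 > 0" and
    lo: "\<forall>L\<ge>L0. \<forall>M (W :: (nat \<times> nat \<Rightarrow> bool) \<Rightarrow> real). finite (set_pmf M) \<longrightarrow> near_gaussian M W L K \<eta> v \<longrightarrow>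
        exp (- \<beta> * L) \<le> Pr M (\<lambda>\<omega>. W \<omega> > x * L)"
    using gaussian_lower_tail[OF x, where 'a = "nat \<times> nat \<Rightarrow> bool"] by (elim exE conjE) (rule that)
  show ?thesis
    using ev_model ev_near_gaussian[of \<eta> K, OF 1(1) less_imp_le[OF 1(2)]] ev_L_ge[of L0]
  proof eventually_elim
    case (elim n)
    have Lp: "L n > 0" using elim(3) 1 by linarith
    show ?case
    proof (intro ballI)
      fix \<C> S i assume "\<C> \<in> communities n k 1" "S \<in> sparse_sets n" "i \<in> S"
      then have "exp (- \<beta> * L n) \<le> Pr (bern (edges n) (altw n \<C> S (A n))) (\<lambda>\<omega>. stdc n (L n) (cut n S i) \<omega> > x * L n)"
        using elim(2,3) by (intro lo[rule_format]) simp_all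
      then show "exp (- \<beta> * L n) \<le> Pr (bern (edges n) (altw n \<C> S (A n))) (\<lambda>x'. cnt (cut n S i) x' > thr x n)"
        unfolding stdc_greater[OF elim(1) Lp] .
    qed
  qed
qed

lemma alt_tail_upper:
  assumes x: "v < x" "\<beta> < (x - v)\<^sup>2 / 2"
  shows "\<forall>\<^sub>F n in FF. \<forall>\<C>\<in>communities n k 1. \<forall>S\<in>sparse_sets n. \<forall>i\<in>S.
     Pr (bern (edges n) (altw n \<C> S (A n))) (\<lambda>x'. cnt (star n i) x' > thr x n) \<le> exp (- \<beta> * L n)"
proof -
  obtain \<eta> K where 1: "\<eta> > 0" "K > 0" and
    up: "\<forall>L\<ge>0. \<forall>M (W :: (nat \<times> nat \<Rightarrow> bool) \<Rightarrow> real). finite (set_pmf M) \<longrightarrow> near_gaussian M W L K \<eta> v \<longrightarrow>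
        Pr M (\<lambda>\<omega>. W \<omega> > x * L) \<le> exp (- \<beta> * L)"
    using gaussian_upper_tail[OF x, where 'a = "nat \<times> nat \<Rightarrow> bool"] by (elim exE conjE) (rule that)
  show ?thesis
    using ev_model ev_near_gaussian[of \<eta> K, OF 1(1) less_imp_le[OF 1(2)]] ev_L_ge[of 1]
  proof eventually_elim
    case (elim n)
    have Lp: "L n > 0" using elim(3) 1 by linarith
    show ?case
    proof (intro ballI)
      fix \<C> S i assume as: "\<C> \<in> communities n k 1" "S \<in> sparse_sets n" "i \<in> S"
      then have "i \<in> {1..n}" by (auto simp: sparse_sets_def)
      then have "near_gaussian (bern (edges n) (altw n \<C> S (A n))) (stdc n (L n) (star n i)) (L n) K \<eta> (if i \<in> S then v else 0)"
        using elim(2) as by blast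
      then have "Pr (bern (edges n) (altw n \<C> S (A n))) (\<lambda>\<omega>. stdc n (L n) (star n i) \<omega> > x * L n) \<le> exp (- \<beta> * L n)"
        by (intro up[rule_format]) (use Lp as in auto)
      then show "Pr (bern (edges n) (altw n \<C> S (A n))) (\<lambda>x'. cnt (star n i) x' > thr x n) \<le> exp (- \<beta> * L n)"
        unfolding stdc_greater[OF elim(1) Lp] .
    qed
  qed
qed

text \<open>The mean degree of a vertex outside of \<open>S\<close> hardly changes under the alternative, so the moment generating function
in \<open>Pr_added_and_exceed\<close> is that of a null degree, up to \<open>exp (o(L))\<close>.\<close>

lemma added_edge_tail:
  assumes x: "0 < x" "\<beta> < x\<^sup>2 / 2"
  shows "\<forall>\<^sub>F n in FF. \<forall>\<C>\<in>communities n k 1. \<forall>S\<in>sparse_sets n. \<forall>i\<in>{1..n} - S. \<forall>j\<in>S.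
     Pr (coupling (edges n) (nullw n \<C>) (altw n \<C> S (A n)))
        (\<lambda>z. snd (z (edge i j)) \<and> \<not> fst (z (edge i j)) \<and> cnt (star n i) (\<lambda>e. snd (z e)) > thr x n)
     \<le> 3 * (A n * (a n / real n)) * exp (- \<beta> * L n)"
proof -
  define \<eta> where "\<eta> = x\<^sup>2 / 2 - \<beta>"
  have \<eta>: "\<eta> > 0" using x by (simp add: \<eta>_def)
  have "((\<lambda>n. x * (sqrt (L n) / sg n)) \<longlongrightarrow> x * 0) FF" by (intro tendsto_intros sqrt_L_over_sg)
  then have ev1: "\<forall>\<^sub>F n in FF. x * (sqrt (L n) / sg n) < 1" by (intro order_tendstoD(2)) auto
  show ?thesis
    using ev_model ev_near_gaussian[of \<eta> x, OF \<eta> less_imp_le[OF x(1)]] ev_L_ge[of 1] ev1 ev_A_range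
  proof eventually_elim
    case (elim n)
    interpret balanced_block_model n k "a n" "b n" by fact
    define l where "l = x * (sqrt (L n) / sg n)"
    have sg: "sg n > 0" using \<sigma>_pos by (simp add: sg_def)
    have l: "0 \<le> l" "l \<le> 1" using elim(4) x sg elim(3) by (auto simp: l_def)
    have A: "0 \<le> A n" "A n \<le> 1 / 4" using elim(5) by auto
    show ?case
    proof (intro ballI)
      fix \<C> S i j assume as: "\<C> \<in> communities n k 1" "S \<in> sparse_sets n" "i \<in> {1..n} - S" "j \<in> S"
      have ij: "i \<in> {1..n}" "j \<in> {1..n}" "i \<noteq> j" using as by (auto simp: sparse_sets_def)
      let ?q = "altw n \<C> S (A n)" and ?e = "edge i j"
      have ng: "near_gaussian (bern (edges n) ?q) (std_cnt (L n) (star n i)) (L n) x \<eta> 0"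
        using bspec[OF bspec[OF elim(2) as(1)] as(2), THEN conjunct2, THEN conjunct2, rule_format, OF ij(1)] as(3)
        by simp
      have e: "?e \<in> star n i" using ij by (auto simp: star_def)
      have mgf: "exp (- l * thr x n) * E (bern (edges n) ?q) (\<lambda>y. exp (l * cnt (star n i) y)) \<le> exp (- \<beta> * L n)"
      proof -
        have "exp (l * cnt (star n i) y) = exp (l * mu n) * exp (x * std_cnt (L n) (star n i) y)" for y
          unfolding exp_add[symmetric] l_def std_cnt_def mu_def sg_def by (simp add: algebra_simps diff_divide_distrib)
        then have "E (bern (edges n) ?q) (\<lambda>y. exp (l * cnt (star n i) y)) =
            exp (l * mu n) * E (bern (edges n) ?q) (\<lambda>y. exp (x * std_cnt (L n) (star n i) y))" by simp
        also have "\<dots> \<le> exp (l * mu n) * exp (L n * (x * 0 + x\<^sup>2 / 2 + \<eta>))"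
          using ng x unfolding near_gaussian_def by (intro mult_left_mono) auto
        finally have "exp (- l * thr x n) * E (bern (edges n) ?q) (\<lambda>y. exp (l * cnt (star n i) y)) \<le>
            exp (- l * thr x n) * (exp (l * mu n) * exp (L n * (x * 0 + x\<^sup>2 / 2 + \<eta>)))"
          by (intro mult_left_mono) auto
        also have "\<dots> = exp (- \<beta> * L n)"
        proof -
          have "l * (x * sqrt (L n) * sg n) = x\<^sup>2 * L n"
            using sg elim(3) by (simp add: l_def power2_eq_square)
          then have "- l * thr x n = - l * mu n - x\<^sup>2 * L n" by (simp add: thr_def algebra_simps)
          then show ?thesis unfolding exp_add[symmetric] by (simp add: \<eta>_def algebra_simps)
        qed
        finally show ?thesis .
      qed
      have "?q ?e - nullw n \<C> ?e = A n * nullw n \<C> ?e"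
        unfolding w1_edge[OF A] using as by (auto simp: algebra_simps)
      also have "\<dots> \<le> A n * pa" by (intro mult_left_mono A w0_le_pa)
      finally have diff: "?q ?e - nullw n \<C> ?e \<le> A n * pa" .
      have diff0: "0 \<le> ?q ?e - nullw n \<C> ?e"
        using w1_coupled[OF A, of ?e \<C> S] star_edges[OF ij(1)] e by auto
      have "Pr (coupling (edges n) (nullw n \<C>) ?q)
          (\<lambda>z. snd (z ?e) \<and> \<not> fst (z ?e) \<and> cnt (star n i) (\<lambda>e. snd (z e)) > thr x n)
          \<le> (?q ?e - nullw n \<C> ?e) * (exp l * exp (- l * thr x n) * E (bern (edges n) ?q) (\<lambda>y. exp (l * cnt (star n i) y)))"
        by (rule Pr_added_and_exceed[OF finite_edges star_edges[OF ij(1)] e _ l(1)]) (rule w1_coupled[OF A])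
      also have "\<dots> \<le> (A n * pa) * (3 * exp (- \<beta> * L n))"
      proof (rule mult_mono[OF diff])
        have "exp l \<le> exp 1" using l by simp
        also have "\<dots> \<le> 3" by (rule exp_le)
        finally have "exp l * (exp (- l * thr x n) * E (bern (edges n) ?q) (\<lambda>y. exp (l * cnt (star n i) y))) \<le> 3 * exp (- \<beta> * L n)"
          by (intro mult_mono mgf) auto
        then show "exp l * exp (- l * thr x n) * E (bern (edges n) ?q) (\<lambda>y. exp (l * cnt (star n i) y)) \<le> 3 * exp (- \<beta> * L n)"
          by (simp only: mult.assoc)
      qed (use diff0 A p_bounds in auto)
      finally show "Pr (coupling (edges n) (nullw n \<C>) ?q)
          (\<lambda>z. snd (z ?e) \<and> \<not> fst (z ?e) \<and> cnt (star n i) (\<lambda>e. snd (z e)) > thr x n)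
          \<le> 3 * (A n * (a n / real n)) * exp (- \<beta> * L n)" by (simp add: pa_def mult_ac)
    qed
  qed
qed

end


section \<open>Reduction of the risk to a single worst alternative\<close>


context asymptotic_regime
begin

lemma var0_pos: "model n \<Longrightarrow> var0 n > 0"
proof -
  assume m: "model n"
  then interpret balanced_block_model n k "a n" "b n" .
  show "var0 n > 0" using var0_ge[OF m] \<sigma>_pos zero_less_power[of \<sigma> 2] unfolding sg_def by linarith
qed

lemma signal_mono:
  assumes "model n" "L n \<ge> 0" "C \<le> C'"
  shows "A n \<le> signal k a b C' n"
  unfolding signal_def using assms var0_pos[OF assms(1)]
  by (intro real_sqrt_le_mono divide_right_mono mult_right_mono) auto

lemma signal_pos: "model n \<Longrightarrow> L n > 0 \<Longrightarrow> A n > 0"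
  unfolding signal_def using C var0_pos by auto

lemma heterogeneous_sparse: "\<theta> \<in> alternatives n (s n) A' \<Longrightarrow> heterogeneous n \<theta> \<in> sparse_sets n"
  by (auto simp: alternatives_def sparse_sets_def heterogeneous_def)

lemma boosted_alternative:
  assumes "S \<in> sparse_sets n" "A' > 0"
  shows "(\<lambda>i. if i \<in> S then 1 + A' else 1) \<in> alternatives n (s n) A'"
proof -
  have "heterogeneous n (\<lambda>i. if i \<in> S then 1 + A' else 1) = S"
    using assms by (auto simp: heterogeneous_def sparse_sets_def)
  then show ?thesis using assms by (auto simp: alternatives_def sparse_sets_def)
qed

text \<open>Since degrees increase with \<open>\<theta>\<close>, a monotone test errs most when every \<open>\<theta> i\<close> on \<open>S\<close> takes
  the least permitted value.\<close>

lemma alternative_dominated: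
  assumes m: "model n" and A: "0 \<le> A n" "A n \<le> 1 / 4" "A n \<le> A'"
    and \<theta>: "\<theta> \<in> alternatives n (s n) A'"
    and mono: "\<And>x y. (\<And>e. x e \<Longrightarrow> y e) \<Longrightarrow> T (graph x) \<Longrightarrow> T (graph y)"
  shows "Pr (dcbm n \<C> \<theta> (a n) (b n)) (\<lambda>Y. \<not> T Y) \<le>
     Pr (bern (edges n) (altw n \<C> (heterogeneous n \<theta>) (A n))) (\<lambda>x. \<not> T (graph x))"
proof -
  interpret balanced_block_model n k "a n" "b n" by fact
  let ?S = "heterogeneous n \<theta>"
  have le: "altw n \<C> ?S (A n) e \<le> weight n \<C> \<theta> (a n) (b n) e" if e: "e \<in> edges n" for e
  proof -
    obtain i j where ij: "e = edge i j" "i \<in> {1..n}" "j \<in> {1..n}"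
    proof
      show "e = edge (fst e) (snd e)" by (rule edges_edge[OF e])
    qed (use e in \<open>auto simp: edges_def\<close>)
    let ?t = "\<lambda>i. if i \<in> ?S then 1 + A n else 1"
    have t: "0 \<le> ?t l" "?t l \<le> \<theta> l" if "l \<in> {1..n}" for l
      using that \<theta> A by (auto simp: alternatives_def heterogeneous_def)
    have "?t i * ?t j \<le> \<theta> i * \<theta> j"
      by (rule mult_mono) (use t[OF ij(2)] t[OF ij(3)] in linarith)+
    then have "?t i * ?t j * ((if same_block \<C> i j then a n else b n) / real n) \<le>
        \<theta> i * \<theta> j * ((if same_block \<C> i j then a n else b n) / real n)"
      using ab by (intro mult_right_mono) auto
    then show ?thesis unfolding ij(1) w1_def weight_edge by (intro min.mono) auto
  qed
  have le1: "weight n \<C> \<theta> (a n) (b n) e \<le> 1" for e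
    unfolding weight_def edge_prob_def by (auto split: prod.splits)
  have "Pr (bern (edges n) (weight n \<C> \<theta> (a n) (b n))) (\<lambda>x. \<not> T (graph x)) \<le>
     Pr (bern (edges n) (altw n \<C> ?S (A n))) (\<lambda>x. \<not> T (graph x))"
  proof (rule Pr_bern_mono)
    fix e assume e: "e \<in> edges n"
    show "0 \<le> altw n \<C> ?S (A n) e \<and> altw n \<C> ?S (A n) e \<le> weight n \<C> \<theta> (a n) (b n) e
        \<and> weight n \<C> \<theta> (a n) (b n) e \<le> 1 \<and> altw n \<C> ?S (A n) e < 1"
      using le[OF e] le1[of e] w1_coupled[OF A(1,2) e, of \<C> ?S] w1_less_1[OF A(1,2) e, of \<C> ?S] by auto
  next
    fix x y :: "nat \<times> nat \<Rightarrow> bool" assume "\<And>e. x e \<Longrightarrow> y e" "\<not> T (graph y)"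
    then show "\<not> T (graph x)" using mono[of x y] by blast
  qed simp
  then show ?thesis unfolding Pr_dcbm .
qed

lemma powerfulI:
  assumes C': "C \<le> C'"
    and mono: "\<forall>\<^sub>F n in FF. \<forall>x y. (\<forall>e. x e \<longrightarrow> y e) \<longrightarrow> T n (graph x) \<longrightarrow> T n (graph y)"
    and null: "\<And>\<epsilon>. \<epsilon> > 0 \<Longrightarrow> \<forall>\<^sub>F n in FF. \<forall>\<C>\<in>communities n k 1.
        Pr (bern (edges n) (nullw n \<C>)) (\<lambda>x. T n (graph x)) \<le> \<epsilon>"
    and alt: "\<And>\<epsilon>. \<epsilon> > 0 \<Longrightarrow> \<forall>\<^sub>F n in FF. \<forall>\<C>\<in>communities n k 1. \<forall>S\<in>sparse_sets n.
        Pr (bern (edges n) (altw n \<C> S (A n))) (\<lambda>x. \<not> T n (graph x)) \<le> \<epsilon>"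
  shows "powerful k a b s (signal k a b C') T"
proof -
  let ?r = "\<lambda>n. risk n k 1 (a n) (b n) (s n) (signal k a b C' n) (T n)"
  have bound: "\<forall>\<^sub>F n in FF. 0 \<le> ?r n \<and> ?r n \<le> 2 * \<epsilon>" if \<epsilon>: "\<epsilon> > 0" for \<epsilon>
    using ev_model mono null[OF \<epsilon>] alt[OF \<epsilon>] ev_A_range ev_sparse_sets ev_L_ge[of 1]
  proof eventually_elim
    case (elim n)
    interpret balanced_block_model n k "a n" "b n" by fact
    let ?A = "signal k a b C' n"
    have Lp: "L n > 0" using elim(7) by linarith
    have AA: "A n \<le> ?A" using signal_mono[OF elim(1) _ C'] Lp by simp
    have A0: "?A > 0" using AA signal_pos[OF elim(1) Lp] by linarith
    have ne: "communities n k 1 \<noteq> {}" by (rule communities_nonempty[OF k dvd n_pos])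
    note fin = communities_finite[of n k 1]
    obtain S where S: "S \<in> sparse_sets n" using elim(6) by blast
    have ane: "alternatives n (s n) ?A \<noteq> {}" using boosted_alternative[OF S A0] by (metis empty_iff)
    have mono': "T n (graph y)" if "\<And>e. x e \<Longrightarrow> y e" "T n (graph x)" for x y
      by (rule elim(2)[rule_format, OF that])
    let ?f1 = "\<lambda>\<C>. Pr (null_law n \<C> (a n) (b n)) (\<lambda>Y. T n Y)"
    let ?f2 = "\<lambda>\<theta> \<C>. Pr (dcbm n \<C> \<theta> (a n) (b n)) (\<lambda>Y. \<not> T n Y)"
    let ?m2 = "\<lambda>\<theta>. MAX \<C>\<in>communities n k 1. ?f2 \<theta> \<C>"
    have 1: "0 \<le> (MAX \<C>\<in>communities n k 1. ?f1 \<C>)"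
      using fin ne by (subst Max_ge_iff) auto
    have 2: "(MAX \<C>\<in>communities n k 1. ?f1 \<C>) \<le> \<epsilon>"
      using fin ne elim(3) by (subst Max_le_iff) (auto simp: null_law_eq)
    have m2: "0 \<le> ?m2 \<theta>" "?m2 \<theta> \<le> 1" for \<theta>
      using fin ne by (subst Max_ge_iff, auto)
    have 3: "?m2 \<theta> \<le> \<epsilon>" if \<theta>: "\<theta> \<in> alternatives n (s n) ?A" for \<theta>
    proof -
      have "?f2 \<theta> \<C> \<le> \<epsilon>" if C: "\<C> \<in> communities n k 1" for \<C>
      proof -
        have "?f2 \<theta> \<C> \<le> Pr (bern (edges n) (altw n \<C> (heterogeneous n \<theta>) (A n))) (\<lambda>x. \<not> T n (graph x))"
          by (rule alternative_dominated[where T = "T n", OF elim(1) _ _ AA \<theta>]) (use elim(5) in simp, use elim(5) in simp, rule mono')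
        also have "\<dots> \<le> \<epsilon>"
          using bspec[OF bspec[OF elim(4) C] heterogeneous_sparse[OF \<theta>]] .
        finally show ?thesis .
      qed
      then show ?thesis using fin ne by (subst Max_le_iff) auto
    qed
    have 4: "(SUP \<theta>\<in>alternatives n (s n) ?A. ?m2 \<theta>) \<le> \<epsilon>"
      by (rule cSUP_least[OF ane 3])
    obtain \<theta> where \<theta>: "\<theta> \<in> alternatives n (s n) ?A" using ane by blast
    have "bdd_above (?m2 ` alternatives n (s n) ?A)"
      by (rule bdd_aboveI[of _ 1]) (use m2 in auto)
    then have 5: "0 \<le> (SUP \<theta>\<in>alternatives n (s n) ?A. ?m2 \<theta>)"
      by (rule cSUP_upper2[OF _ \<theta>]) (rule m2)
    show ?case unfolding risk_def using 1 2 4 5 by linarith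
  qed
  have "(?r \<longlongrightarrow> 0) FF"
    unfolding tendsto_iff dist_real_def
  proof (intro allI impI)
    fix e :: real assume "e > 0"
    then have "e / 4 > 0" by simp
    from bound[OF this] show "\<forall>\<^sub>F n in FF. \<bar>?r n - 0\<bar> < e"
      by eventually_elim (use \<open>e > 0\<close> in linarith)
  qed
  then have "((\<lambda>n. ereal (?r n)) \<longlongrightarrow> ereal 0) FF" by (intro tendsto_ereal)
  from lim_imp_Limsup[OF FF_nontrivial this] show ?thesis unfolding powerful_def by simp
qed

lemma powerlessI:
  assumes "\<And>\<epsilon>. \<epsilon> > 0 \<Longrightarrow> \<forall>\<^sub>F n in FF. \<exists>\<C>\<in>communities n k 1. \<exists>S\<in>sparse_sets n.
     Pr (bern (edges n) (nullw n \<C>)) (\<lambda>x. T n (graph x)) +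
     Pr (bern (edges n) (altw n \<C> S (A n))) (\<lambda>x. \<not> T n (graph x)) \<ge> 1 - \<epsilon>"
  shows "powerless k a b s A T"
proof -
  let ?r = "\<lambda>n. risk n k 1 (a n) (b n) (s n) (A n) (T n)"
  have bound: "\<forall>\<^sub>F n in FF. ?r n \<ge> 1 - \<epsilon>" if \<epsilon>: "\<epsilon> > 0" for \<epsilon>
    using ev_model assms[OF \<epsilon>] ev_L_ge[of 1]
  proof eventually_elim
    case (elim n)
    interpret balanced_block_model n k "a n" "b n" by fact
    obtain \<C> S where C: "\<C> \<in> communities n k 1" and S: "S \<in> sparse_sets n" and
      le: "Pr (bern (edges n) (nullw n \<C>)) (\<lambda>x. T n (graph x)) +
        Pr (bern (edges n) (altw n \<C> S (A n))) (\<lambda>x. \<not> T n (graph x)) \<ge> 1 - \<epsilon>" using elim(2) by blast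
    have Lp: "L n > 0" using elim(3) by linarith
    let ?f1 = "\<lambda>\<C>. Pr (null_law n \<C> (a n) (b n)) (\<lambda>Y. T n Y)"
    let ?f2 = "\<lambda>\<theta> \<C>. Pr (dcbm n \<C> \<theta> (a n) (b n)) (\<lambda>Y. \<not> T n Y)"
    let ?m2 = "\<lambda>\<theta>. MAX \<C>\<in>communities n k 1. ?f2 \<theta> \<C>"
    let ?\<theta> = "\<lambda>i. if i \<in> S then 1 + A n else 1"
    note fin = communities_finite[of n k 1]
    have \<theta>: "?\<theta> \<in> alternatives n (s n) (A n)" by (rule boosted_alternative[OF S signal_pos[OF elim(1) Lp]])
    have 1: "?f1 \<C> \<le> (MAX \<C>\<in>communities n k 1. ?f1 \<C>)" using fin C by (intro Max_ge) auto
    have 2: "?f2 ?\<theta> \<C> \<le> ?m2 ?\<theta>" using fin C by (intro Max_ge) auto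
    have "?m2 \<theta> \<le> 1" for \<theta> using fin C by (subst Max_le_iff) auto
    then have "bdd_above (?m2 ` alternatives n (s n) (A n))" by (intro bdd_aboveI[of _ 1]) auto
    then have 3: "?m2 ?\<theta> \<le> (SUP \<theta>\<in>alternatives n (s n) (A n). ?m2 \<theta>)"
      by (rule cSUP_upper[OF \<theta>])
    have "?f1 \<C> = Pr (bern (edges n) (nullw n \<C>)) (\<lambda>x. T n (graph x))" unfolding null_law_eq Pr_map ..
    moreover have "?f2 ?\<theta> \<C> = Pr (bern (edges n) (altw n \<C> S (A n))) (\<lambda>x. \<not> T n (graph x))"
      unfolding Pr_dcbm w1_def ..
    ultimately show ?case unfolding risk_def using 1 2 3 le by linarith
  qed
  show ?thesis unfolding powerless_def le_Liminf_iff
  proof (intro allI impI)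
    fix y :: ereal assume y: "y < 1"
    then obtain z where z: "y < ereal z" "ereal z < 1" using ereal_dense2 by blast
    then have "1 - z > 0" by simp
    from bound[OF this] show "\<forall>\<^sub>F n in FF. y < ereal (?r n)"
    proof eventually_elim
      case (elim n)
      have "ereal z \<le> ereal (?r n)" using elim by simp
      then show ?case using z(1) by (rule less_le_trans[rotated])
    qed
  qed
qed

lemma sqrt_exp_decay:
  assumes "c < 0"
  shows "((\<lambda>n. sqrt (L n) * exp (c * L n)) \<longlongrightarrow> 0) FF"
proof (rule tendsto_sandwich[OF _ _ tendsto_const])
  show "\<forall>\<^sub>F n in FF. 0 \<le> sqrt (L n) * exp (c * L n)" using ev_L_ge[of 0] by eventually_elim auto
  show "\<forall>\<^sub>F n in FF. sqrt (L n) * exp (c * L n) \<le> (2 / - c) * exp (c / 2 * L n)"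
    using ev_L_ge[of 1]
  proof eventually_elim
    case (elim n)
    have "sqrt (L n) \<le> L n" using elim real_sqrt_le_mono[of "L n" "L n * L n"] mult_left_mono[of 1 "L n" "L n"] by simp
    also have "L n * (- c / 2) \<le> exp (- c / 2 * L n)"
      using exp_ge_add_one_self[of "- c / 2 * L n"] by (simp add: mult.commute)
    then have "L n \<le> (2 / - c) * exp (- c / 2 * L n)" using assms by (simp add: field_simps)
    finally have "sqrt (L n) * exp (c * L n) \<le> (2 / - c) * exp (- c / 2 * L n) * exp (c * L n)"
      by (intro mult_right_mono) auto
    also have "\<dots> = (2 / - c) * exp (c / 2 * L n)"
      unfolding mult.assoc exp_add[symmetric] by (simp add: algebra_simps)
    finally show ?case .
  qed
  have "((\<lambda>n. (2 / - c) * exp (c / 2 * L n)) \<longlongrightarrow> (2 / - c) * 0) FF"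
    using assms by (intro tendsto_intros exp_decay) auto
  then show "((\<lambda>n. (2 / - c) * exp (c / 2 * L n)) \<longlongrightarrow> 0) FF" by simp
qed

text \<open>The first term bounds the variance of an independent sum, the second one accounts for the correlations.
For \<open>\<beta>\<close> close to \<open>x\<^sup>2 / 2\<close> it is of the order \<open>n powr (1 - x\<^sup>2 + o(1))\<close>, hence negligible at
\<open>u = thr x n\<close>.\<close>

lemma variance_upper:
  "\<exists>c0\<ge>0. \<forall>x \<beta>. 0 < x \<longrightarrow> \<beta> < x\<^sup>2 / 2 \<longrightarrow>
     (\<forall>\<^sub>F n in FF. \<forall>u\<ge>thr x n. varV n u \<le> real n * (tailF n u + c0 * exp (- (2 * \<beta>) * L n)))"
proof -
  obtain c where c: "0 < ereal c" "ereal c < Liminf FF (\<lambda>n. ereal (b n / a n))"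
    using ereal_dense2[OF ratio_pos] by blast
  then have c0: "c > 0" by simp
  have evc: "\<forall>\<^sub>F n in FF. c < b n / a n"
    using less_LiminfD[OF c(2)] by simp
  define c0' where "c0' = 4 * real k + 4 / c"
  have "\<forall>\<^sub>F n in FF. \<forall>u\<ge>thr x n. varV n u \<le> real n * (tailF n u + c0' * exp (- (2 * \<beta>) * L n))"
    if x: "0 < x" "\<beta> < x\<^sup>2 / 2" for x \<beta>
    using ev_model evc null_tail_upper[OF x] ev_L_ge[of 0]
  proof eventually_elim
    case (elim n)
    interpret balanced_block_model n k "a n" "b n" by fact
    show ?case
    proof (intro allI impI)
      fix u assume u: "thr x n \<le> u"
      have "\<mu> \<le> thr x n" using x elim(4) \<sigma>_pos unfolding thr_def mu_def sg_def by auto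
      then have "G u \<le> sg n * exp (- \<beta> * L n)" using G_mono[OF _ u] elim(3) by linarith
      then have "(G u)\<^sup>2 \<le> (sg n * exp (- \<beta> * L n))\<^sup>2" using G_nonneg by (intro power_mono) auto
      also have "\<dots> = \<sigma>\<^sup>2 * exp (- (2 * \<beta>) * L n)"
        unfolding sg_def power_mult_distrib exp_of_nat_mult[symmetric] by (simp add: mult_ac power2_eq_square exp_add[symmetric])
      also have "\<dots> \<le> a n * exp (- (2 * \<beta>) * L n)"
        using \<sigma>_le \<mu>_le by (intro mult_right_mono) auto
      finally have "(G u)\<^sup>2 * (4 * real k / a n + 4 / b n) \<le> a n * exp (- (2 * \<beta>) * L n) * (4 * real k / a n + 4 / b n)"
        using ab by (intro mult_right_mono) auto
      also have "\<dots> = (4 * real k + 4 * (a n / b n)) * exp (- (2 * \<beta>) * L n)"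
        using ab by (simp add: field_simps)
      also have "\<dots> \<le> c0' * exp (- (2 * \<beta>) * L n)"
      proof -
        have "a n / b n \<le> 1 / c" using elim(2) c0 ab by (simp add: field_simps)
        then show ?thesis unfolding c0'_def by (intro mult_right_mono) auto
      qed
      finally have "real n * (F u + (G u)\<^sup>2 * (4 * real k / a n + 4 / b n)) \<le> real n * (F u + c0' * exp (- (2 * \<beta>) * L n))"
        by (intro mult_left_mono add_left_mono) auto
      then show "V u \<le> real n * (F u + c0' * exp (- (2 * \<beta>) * L n))" using null_count_variance_le[of u] by linarith
    qed
  qed
  moreover have "c0' \<ge> 0" using c0 by (simp add: c0'_def)
  ultimately show ?thesis by (intro exI[of _ c0'] conjI allI impI)
qed

end


section \<open>Maximal degree and higher criticism\<close>

lemma cnt_mono: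
  assumes "\<And>e. x e \<Longrightarrow> y e"
  shows "cnt I x \<le> cnt I y"
  unfolding cnt_def by (rule sum_mono) (use assms in auto)

lemma cnt_subset:
  assumes "I \<subseteq> I'" "finite I'"
  shows "cnt I x \<le> cnt I' x"
  unfolding cnt_def by (rule sum_mono2[OF assms(2,1)]) auto

context balanced_block_model
begin

lemma exceedances_mono:
  assumes "\<And>e. x e \<Longrightarrow> y e"
  shows "exceedances u x \<le> exceedances u y"
  unfolding exceedances_def
proof (rule sum_mono)
  fix i
  have "cnt (star n i) x \<le> cnt (star n i) y" by (rule cnt_mono) (rule assms)
  then show "of_bool (cnt (star n i) x > u) \<le> (of_bool (cnt (star n i) y > u) :: real)" by auto
qed

lemma d_max_graph: "d_max n k a b (graph x) > c \<longleftrightarrow> (\<exists>i\<in>{1..n}. cnt (star n i) x > \<mu> + c * \<sigma>)"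
proof -
  have ne: "{1..n} \<noteq> {}" using n_pos by auto
  show ?thesis unfolding d_max_def using ne by (subst Max_gr_iff) (auto simp: std_deg_graph)
qed

definition grid :: "real set" where
  "grid = {sqrt (2 * r * ln (real n)) | r. r \<in> {0<..<5}} \<inter> \<nat>"

lemma grid_subset:
  assumes "ln (real n) \<ge> 1"
  shows "grid \<subseteq> real ` {..nat \<lfloor>sqrt (10 * ln (real n))\<rfloor>}"
proof
  fix t assume "t \<in> grid"
  then obtain r m' where r: "0 < r" "r < 5" "t = sqrt (2 * r * ln (real n))" "t = real m'"
    unfolding grid_def Nats_def by auto
  have "t \<le> sqrt (10 * ln (real n))" unfolding r(3) using r assms by (intro real_sqrt_le_mono mult_right_mono) auto
  then have "m' \<le> nat \<lfloor>sqrt (10 * ln (real n))\<rfloor>" unfolding r(4) by (simp add: le_nat_floor)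
  then show "t \<in> real ` {..nat \<lfloor>sqrt (10 * ln (real n))\<rfloor>}" using r(4) by auto
qed

lemma grid_finite: "ln (real n) \<ge> 1 \<Longrightarrow> finite grid"
  using grid_subset finite_subset by blast

lemma grid_card:
  assumes "ln (real n) \<ge> 1"
  shows "real (card grid) \<le> 5 * sqrt (ln (real n))"
proof -
  have "card grid \<le> card (real ` {..nat \<lfloor>sqrt (10 * ln (real n))\<rfloor>})"
    by (rule card_mono) (use grid_subset[OF assms] in auto)
  also have "\<dots> = nat \<lfloor>sqrt (10 * ln (real n))\<rfloor> + 1" by (simp add: card_image)
  finally have "real (card grid) \<le> real (nat \<lfloor>sqrt (10 * ln (real n))\<rfloor>) + 1" by linarith
  also have "real (nat \<lfloor>sqrt (10 * ln (real n))\<rfloor>) \<le> sqrt (10 * ln (real n))"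
    using assms by (intro of_nat_floor) auto
  also have "sqrt (10 * ln (real n)) \<le> sqrt (16 * ln (real n))" using assms by simp
  also have "\<dots> = 4 * sqrt (ln (real n))" by (simp add: real_sqrt_mult)
  also have "4 * sqrt (ln (real n)) + 1 \<le> 5 * sqrt (ln (real n))" using assms by simp
  finally show ?thesis by simp
qed

lemma grid_memI:
  assumes "ln (real n) \<ge> 1" "t \<ge> 1" "(real t)\<^sup>2 \<le> 2 * ln (real n)"
  shows "real t \<in> grid"
proof -
  define r where "r = (real t)\<^sup>2 / (2 * ln (real n))"
  have "r > 0" "r < 5" "real t = sqrt (2 * r * ln (real n))"
    using assms by (auto simp: r_def divide_less_eq)
  then have "real t \<in> {sqrt (2 * r * ln (real n)) | r. r \<in> {0<..<5}}" by auto
  then show ?thesis unfolding grid_def by simp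
qed

lemma HC_greater:
  assumes "ln (real n) \<ge> 1"
  shows "HC n k a b Y > c \<longleftrightarrow> (\<exists>t\<in>grid. GHC_at n k a b t Y > c)"
  unfolding HC_def grid_def[symmetric]
proof (rule less_cSUP_iff)
  have "real 1 \<in> grid" by (rule grid_memI) (use assms in auto)
  then show "grid \<noteq> {}" by blast
  show "bdd_above ((\<lambda>t. GHC_at n k a b t Y) ` grid)"
    using grid_finite[OF assms] by (intro bdd_above_finite) auto
qed

lemma GHC_at_mono:
  assumes "\<And>e. x e \<Longrightarrow> y e"
  shows "GHC_at n k a b t (graph x) \<le> GHC_at n k a b t (graph y)"
proof -
  have "exceedances u x \<le> exceedances u y" for u by (rule exceedances_mono) (rule assms)
  then show ?thesis unfolding GHC_at_graph using V_nonneg by (intro divide_right_mono) auto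
qed

lemma GHC_at_null:
  assumes C: "\<C> \<in> communities n k 1" and L: "L > 0"
  shows "Pr (bern (edges n) (w0 \<C>)) (\<lambda>x. GHC_at n k a b t (graph x) > sqrt L) \<le> 1 / L"
proof (cases "V (\<mu> + t * \<sigma>) = 0")
  case True
  then show ?thesis unfolding GHC_at_graph using L by simp
next
  case False
  let ?u = "\<mu> + t * \<sigma>" and ?M = "bern (edges n) (w0 \<C>)"
  have V: "V ?u > 0" using False V_nonneg[of ?u] by linarith
  have "Pr ?M (\<lambda>x. GHC_at n k a b t (graph x) > sqrt L) \<le>
      Pr ?M (\<lambda>x. exceedances ?u x \<ge> E ?M (exceedances ?u) + sqrt L * sqrt (V ?u))"
    unfolding GHC_at_graph E_exceedances[OF C] using V by (intro Pr_mono) (simp add: pos_less_divide_eq)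
  also have "\<dots> \<le> measure_pmf.variance ?M (exceedances ?u) / (sqrt L * sqrt (V ?u))\<^sup>2"
    by (rule Pr_chebyshev_lower(2)) (use L V in auto)
  also have "\<dots> = 1 / L" unfolding variance_exceedances[OF C] using L V by (simp add: power_mult_distrib)
  finally show ?thesis .
qed

text \<open>The signal contributes through edges from \<open>S\<close> to its complement only; all other exceedances are
  compared with the coupled null graph.\<close>

lemma exceedances_split:
  assumes S: "S \<subseteq> {1..n}" and le: "\<And>e. x e \<Longrightarrow> y e"
  shows "exceedances u y \<ge> exceedances u x - (\<Sum>i\<in>S. of_bool (cnt (star n i) x > u))
           + (\<Sum>i\<in>S. of_bool (cnt (cut n S i) y > u))"
proof -
  let ?f = "\<lambda>x i. of_bool (cnt (star n i) x > u) :: real"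
  have sp: "exceedances u z = (\<Sum>i\<in>{1..n} - S. ?f z i) + (\<Sum>i\<in>S. ?f z i)" for z
    unfolding exceedances_def by (rule sum.subset_diff[OF S]) simp
  have "(\<Sum>i\<in>{1..n} - S. ?f x i) \<le> (\<Sum>i\<in>{1..n} - S. ?f y i)"
  proof (rule sum_mono)
    fix i
    have "cnt (star n i) x \<le> cnt (star n i) y" by (rule cnt_mono) (rule le)
    then show "?f x i \<le> ?f y i" by auto
  qed
  moreover have "(\<Sum>i\<in>S. of_bool (cnt (cut n S i) y > u)) \<le> (\<Sum>i\<in>S. ?f y i)"
  proof (rule sum_mono)
    fix i assume "i \<in> S"
    then have "cut n S i \<subseteq> star n i" unfolding star_def by auto
    from cnt_subset[OF this, of y] show "of_bool (cnt (cut n S i) y > u) \<le> ?f y i"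
      by (auto simp: star_def)
  qed
  ultimately show ?thesis unfolding sp[of x] sp[of y] by linarith
qed

lemma cut_exceedances_few:
  fixes q :: real
  assumes S: "S \<subseteq> {1..n}" "S \<noteq> {}" and q: "q > 0"
    and lo: "\<And>i. i \<in> S \<Longrightarrow> q \<le> Pr (bern (edges n) p) (\<lambda>x. cnt (cut n S i) x > u)"
  shows "Pr (bern (edges n) p) (\<lambda>x. (\<Sum>i\<in>S. of_bool (cnt (cut n S i) x > u)) \<le> card S * q / 2) \<le> 4 / (card S * q)"
proof (rule Pr_few_indep[OF _ _ _ lo q S(2)])
  show "finite S" using S finite_subset by blast
  fix i j assume ij: "i \<in> S" "j \<in> S" "i \<noteq> j"
  show "E (bern (edges n) p) (\<lambda>x. of_bool (cnt (cut n S i) x > u) * of_bool (cnt (cut n S j) x > u)) =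
    Pr (bern (edges n) p) (\<lambda>x. cnt (cut n S i) x > u) * Pr (bern (edges n) p) (\<lambda>x. cnt (cut n S j) x > u)"
    unfolding Pr_eq_E
  proof (rule E_bern_indep[OF finite_edges _ _ depends_on_cnt[OF subset_refl] depends_on_cnt[OF subset_refl]])
    show "cut n S i \<subseteq> edges n" using ij S subsetD[OF S(1) ij(1)] by (auto intro!: edge_in_edges)
    show "cut n S i \<inter> cut n S j = {}" using ij by (auto dest!: edge_eq)
  qed
qed simp

text \<open>In the coupled pair of graphs the test can only fail if the null count falls below its mean by
\<open>sqrt (ln n)\<close> standard deviations, or the boosted vertices have few exceedances, or the same vertices
already have many in the null graph. The bounds come from Chebyshev's inequality for the first two events
and from Markov's for the third.\<close>

lemma HC_alt:
  fixes q :: real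
  assumes C: "\<C> \<in> communities n k 1" and S: "S \<subseteq> {1..n}" "S \<noteq> {}" and A: "0 \<le> A" "A \<le> 1 / 4"
    and L: "ln (real n) \<ge> 1" and t: "real t \<in> grid" and u: "u = \<mu> + real t * \<sigma>" and q: "q > 0"
    and lo: "\<And>i. i \<in> S \<Longrightarrow> q \<le> Pr (bern (edges n) (w1 \<C> S A)) (\<lambda>x. cnt (cut n S i) x > u)"
    and V: "V u > 0" and sep: "8 * (sqrt (ln (real n)) * sqrt (V u)) \<le> card S * q"
  shows "Pr (bern (edges n) (w1 \<C> S A)) (\<lambda>x. \<not> HC n k a b (graph x) > sqrt (ln (real n)))
     \<le> 1 / ln (real n) + 4 / (card S * q) + 4 * F u / q"
proof -
  let ?Q = "coupling (edges n) (w0 \<C>) (w1 \<C> S A)"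
  let ?M0 = "bern (edges n) (w0 \<C>)" and ?M1 = "bern (edges n) (w1 \<C> S A)"
  define d where "d = sqrt (ln (real n)) * sqrt (V u)"
  have d: "d > 0" using L V by (simp add: d_def)
  have fS: "finite S" using S finite_subset by blast
  have cS: "card S * q > 0" using fS S q by (simp add: card_gt_0_iff)
  have Q0: "map_pmf (\<lambda>z j. fst (z j)) ?Q = ?M0" by (rule coupling_fst) simp
  have Q1: "map_pmf (\<lambda>z j. snd (z j)) ?Q = ?M1"
    by (rule coupling_snd[OF finite_edges]) (rule w1_coupled[OF A])
  define B1 where "B1 x \<longleftrightarrow> exceedances u x \<le> real n * F u - d" for x
  define B2 where "B2 x \<longleftrightarrow> (\<Sum>i\<in>S. of_bool (cnt (cut n S i) x > u)) \<le> card S * q / 2" for x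
  define B3 where "B3 x \<longleftrightarrow> (\<Sum>i\<in>S. of_bool (cnt (star n i) x > u)) \<ge> card S * q / 4" for x
  have "Pr ?M1 (\<lambda>x. \<not> HC n k a b (graph x) > sqrt (ln (real n))) =
     Pr ?Q (\<lambda>z. \<not> HC n k a b (graph (\<lambda>j. snd (z j))) > sqrt (ln (real n)))"
    unfolding Q1[symmetric] Pr_map ..
  also have "\<dots> \<le> Pr ?Q (\<lambda>z. B1 (\<lambda>j. fst (z j)) \<or> (B2 (\<lambda>j. snd (z j)) \<or> B3 (\<lambda>j. fst (z j))))"
  proof (rule Pr_mono, rule ccontr)
    fix z assume z: "z \<in> set_pmf ?Q" and n: "\<not> HC n k a b (graph (\<lambda>j. snd (z j))) > sqrt (ln (real n))"
      and nb: "\<not> (B1 (\<lambda>j. fst (z j)) \<or> (B2 (\<lambda>j. snd (z j)) \<or> B3 (\<lambda>j. fst (z j))))"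
    have "GHC_at n k a b t (graph (\<lambda>j. snd (z j))) \<le> sqrt (ln (real n))"
      using n t unfolding HC_greater[OF L] by (simp add: not_less)
    then have up: "exceedances u (\<lambda>j. snd (z j)) - real n * F u \<le> d"
      unfolding GHC_at_graph u[symmetric] d_def using V by (simp add: pos_divide_le_eq)
    have "snd (z e)" if "fst (z e)" for e using coupling_mono[OF finite_edges z that] .
    then have "exceedances u (\<lambda>j. snd (z j)) \<ge> exceedances u (\<lambda>j. fst (z j))
        - (\<Sum>i\<in>S. of_bool (cnt (star n i) (\<lambda>j. fst (z j)) > u))
           + (\<Sum>i\<in>S. of_bool (cnt (cut n S i) (\<lambda>j. snd (z j)) > u))"
      by (rule exceedances_split[OF S(1)])
    then show False using up nb sep unfolding B1_def B2_def B3_def d_def[symmetric] by linarith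
  qed
  also have "\<dots> \<le> Pr ?Q (\<lambda>z. B1 (\<lambda>j. fst (z j))) + (Pr ?Q (\<lambda>z. B2 (\<lambda>j. snd (z j))) + Pr ?Q (\<lambda>z. B3 (\<lambda>j. fst (z j))))"
    by (rule order_trans[OF Pr_disj add_left_mono[OF Pr_disj]])
  also have "Pr ?Q (\<lambda>z. B1 (\<lambda>j. fst (z j))) = Pr ?M0 B1" unfolding Q0[symmetric] Pr_map ..
  also have "Pr ?Q (\<lambda>z. B2 (\<lambda>j. snd (z j))) = Pr ?M1 B2" unfolding Q1[symmetric] Pr_map ..
  also have "Pr ?Q (\<lambda>z. B3 (\<lambda>j. fst (z j))) = Pr ?M0 B3" unfolding Q0[symmetric] Pr_map ..
  finally have main: "Pr ?M1 (\<lambda>x. \<not> HC n k a b (graph x) > sqrt (ln (real n))) \<le> Pr ?M0 B1 + (Pr ?M1 B2 + Pr ?M0 B3)" .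
  have "Pr ?M0 B1 \<le> measure_pmf.variance ?M0 (exceedances u) / d\<^sup>2"
    unfolding B1_def E_exceedances[OF C, symmetric] by (rule Pr_chebyshev_lower(1)[OF _ d]) simp
  also have "\<dots> = 1 / ln (real n)"
    unfolding variance_exceedances[OF C] d_def using L V by (simp add: power_mult_distrib)
  finally have p1: "Pr ?M0 B1 \<le> 1 / ln (real n)" .
  have p2: "Pr ?M1 B2 \<le> 4 / (card S * q)"
    unfolding B2_def by (rule cut_exceedances_few[OF S q lo])
  have p3: "Pr ?M0 B3 \<le> 4 * F u / q"
  proof -
    let ?N = "\<lambda>x. \<Sum>i\<in>S. of_bool (cnt (star n i) x > u) :: real"
    have "Pr ?M0 B3 \<le> E ?M0 (\<lambda>x. ?N x / (card S * q / 4))"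
      unfolding Pr_eq_E
    proof (rule E_mono)
      fix x show "of_bool (B3 x) \<le> ?N x / (card S * q / 4)"
      proof (cases "B3 x")
        case True
        then show ?thesis using cS unfolding B3_def by (simp add: le_divide_eq)
      next
        case False
        then show ?thesis using cS by (simp add: sum_nonneg)
      qed
    qed simp
    also have "\<dots> = E ?M0 ?N / (card S * q / 4)" by simp
    also have "E ?M0 ?N = (\<Sum>i\<in>S. F u)"
      unfolding E_sum_indicators[OF finite_set_bern[OF finite_edges]]
      by (rule sum.cong[OF refl], rule Pr_exceed[OF C]) (use S in blast)
    also have "(\<Sum>i\<in>S. F u) / (card S * q / 4) = 4 * F u / q"
      using q fS S(2) by (simp add: field_simps card_gt_0_iff)
    finally show ?thesis .
  qed
  show ?thesis using main p1 p2 p3 by linarith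
qed

end


section \<open>Asymptotic error probabilities\<close>

context asymptotic_regime
begin

lemma HC_monotone: "\<forall>\<^sub>F n in FF. \<forall>x y. (\<forall>e. x e \<longrightarrow> y e) \<longrightarrow> HC_test k a b n (graph x) \<longrightarrow> HC_test k a b n (graph y)"
  using ev_model ev_L_ge[of 1]
proof eventually_elim
  case (elim n)
  interpret balanced_block_model n k "a n" "b n" by fact
  show ?case
  proof (intro allI impI)
    fix x y :: "nat \<times> nat \<Rightarrow> bool" assume le: "\<forall>e. x e \<longrightarrow> y e" and T: "HC_test k a b n (graph x)"
    obtain t where t: "t \<in> grid" "GHC_at n k (a n) (b n) t (graph x) > sqrt (L n)"
      using T unfolding HC_test_def HC_greater[OF elim(2)] by blast
    have "GHC_at n k (a n) (b n) t (graph x) \<le> GHC_at n k (a n) (b n) t (graph y)"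
      by (rule GHC_at_mono) (use le in blast)
    then show "HC_test k a b n (graph y)"
      unfolding HC_test_def HC_greater[OF elim(2)] using t by (intro bexI[of _ t]) auto
  qed
qed

text \<open>Only about \<open>sqrt (ln n)\<close> integers compete, and each exceeds the critical value with probability at most
\<open>1 / ln n\<close> by Chebyshev's inequality.\<close>

lemma HC_null_level:
  assumes \<epsilon>: "\<epsilon> > 0"
  shows "\<forall>\<^sub>F n in FF. \<forall>\<C>\<in>communities n k 1. Pr (bern (edges n) (nullw n \<C>)) (\<lambda>x. HC_test k a b n (graph x)) \<le> \<epsilon>"
  using ev_model ev_L_ge[of 1] ev_L_ge[of "(5 / \<epsilon>)\<^sup>2"]
proof eventually_elim
  case (elim n)
  interpret balanced_block_model n k "a n" "b n" by fact
  have Lp: "L n > 0" using elim(2) by linarith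
  show ?case
  proof
    fix \<C> assume C: "\<C> \<in> communities n k 1"
    let ?M = "bern (edges n) (nullw n \<C>)"
    have "Pr ?M (\<lambda>x. HC_test k a b n (graph x)) \<le> (\<Sum>t\<in>grid. Pr ?M (\<lambda>x. GHC_at n k (a n) (b n) t (graph x) > sqrt (L n)))"
      unfolding HC_test_def HC_greater[OF elim(2)] by (rule Pr_Bex[OF grid_finite[OF elim(2)]])
    also have "\<dots> \<le> (\<Sum>t\<in>grid. 1 / L n)" by (intro sum_mono GHC_at_null[OF C Lp])
    also have "\<dots> = real (card grid) / L n" by simp
    also have "\<dots> \<le> 5 * sqrt (L n) / L n" using grid_card[OF elim(2)] Lp by (intro divide_right_mono) auto
    also have "\<dots> = 5 / sqrt (L n)" using Lp by (simp add: field_simps)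
    also have "\<dots> \<le> \<epsilon>"
    proof -
      have "5 / \<epsilon> \<le> sqrt (L n)" using elim(3) \<epsilon> by (intro real_le_rsqrt) auto
      then show ?thesis using \<epsilon> Lp by (simp add: field_simps)
    qed
    finally show "Pr ?M (\<lambda>x. HC_test k a b n (graph x)) \<le> \<epsilon>" .
  qed
qed

lemma ev_small:
  assumes "(f \<longlongrightarrow> 0) FF" "\<epsilon> > (0::real)"
  shows "\<forall>\<^sub>F n in FF. f n \<le> \<epsilon>"
proof -
  have "\<forall>\<^sub>F n in FF. f n < \<epsilon>" by (rule order_tendstoD(2)[OF assms])
  then show ?thesis by eventually_elim simp
qed

text \<open>Null exceedances are counted at \<open>x0\<close> and signals at \<open>x1\<close> since the statistic uses integer thresholds;
one of them lies between \<open>x0 * sqrt L\<close> and \<open>x1 * sqrt L\<close>. The last condition on the exponents says that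
the signals outnumber \<open>sqrt L\<close> standard deviations of the null count.\<close>

lemma HC_power:
  assumes x: "0 < x0" "x0 < x1" "v < x1" "x1\<^sup>2 / 2 \<le> 1"
    and \<beta>: "\<beta>0 < x0\<^sup>2 / 2" "(x1 - v)\<^sup>2 / 2 < \<beta>1" "0 < \<beta>0" "\<beta>1 < \<beta>0" "(1 - \<beta>0) / 2 < 1 - \<alpha> - \<beta>1"
    and \<epsilon>: "\<epsilon> > 0"
  shows "\<forall>\<^sub>F n in FF. \<forall>\<C>\<in>communities n k 1. \<forall>S\<in>sparse_sets n.
     Pr (bern (edges n) (altw n \<C> S (A n))) (\<lambda>x. \<not> HC_test k a b n (graph x)) \<le> \<epsilon>"
proof -
  obtain c0 where c0: "c0 \<ge> 0" and vu: "\<forall>x \<beta>. 0 < x \<longrightarrow> \<beta> < x\<^sup>2 / 2 \<longrightarrow>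
     (\<forall>\<^sub>F n in FF. \<forall>u\<ge>thr x n. varV n u \<le> real n * (tailF n u + c0 * exp (- (2 * \<beta>) * L n)))"
    using variance_upper by (elim exE conjE) (rule that)
  have \<beta>01: "\<beta>0 < 1"
  proof -
    have "x0\<^sup>2 < x1\<^sup>2" using x by (intro power_strict_mono) auto
    then show ?thesis using \<beta>(1) x(4) by linarith
  qed
  define \<zeta> where "\<zeta> = 1 - \<alpha> - \<beta>1"
  have \<zeta>: "\<zeta> > 0" "(1 - \<beta>0) / 2 - \<zeta> < 0" using \<beta> \<beta>01 by (auto simp: \<zeta>_def)
  have l1: "((\<lambda>n. 1 / L n) \<longlongrightarrow> 0) FF"
    by (rule tendsto_divide_0[OF tendsto_const filterlim_at_top_imp_at_infinity[OF L_at_top]])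
  have "((\<lambda>n. 1 / L n + 8 * exp (- \<zeta> * L n) + 4 * exp ((\<beta>1 - \<beta>0) * L n)) \<longlongrightarrow> 0 + 8 * 0 + 4 * 0) FF"
    using \<zeta> \<beta> by (intro tendsto_intros l1 exp_decay) auto
  then have lim1: "((\<lambda>n. 1 / L n + 8 * exp (- \<zeta> * L n) + 4 * exp ((\<beta>1 - \<beta>0) * L n)) \<longlongrightarrow> 0) FF" by simp
  have "((\<lambda>n. 16 * sqrt (1 + c0) * (sqrt (L n) * exp (((1 - \<beta>0) / 2 - \<zeta>) * L n))) \<longlongrightarrow> 16 * sqrt (1 + c0) * 0) FF"
    using \<zeta> by (intro tendsto_intros sqrt_exp_decay) auto
  then have lim2: "((\<lambda>n. 16 * sqrt (1 + c0) * (sqrt (L n) * exp (((1 - \<beta>0) / 2 - \<zeta>) * L n))) \<longlongrightarrow> 0) FF" by simp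
  have lim3: "((\<lambda>n. exp (- \<beta>0 * L n)) \<longlongrightarrow> 0) FF" using \<beta> by (intro exp_decay) auto
  have x1: "x1 > 0" using x by linarith
  have half: "(0::real) < 1 / 2" by simp
  have nl: "x1\<^sup>2 / 2 < x1\<^sup>2 / 2 + 1" by simp
  show ?thesis
    using ev_model ev_L_ge[of 1] ev_L_ge[of "(1 / x1)\<^sup>2"] ev_L_ge[of "(1 / (x1 - x0))\<^sup>2"] ev_A_range ev_s_le
      ev_s_bounds null_tail_upper[OF x(1) \<beta>(1)] null_tail_lower[OF x1 nl] cut_tail_lower[OF x(3) \<beta>(2)]
      vu[rule_format, OF x(1) \<beta>(1)] ev_small[OF lim1 \<epsilon>] ev_small[OF lim2 zero_less_one]
      ev_small[OF lim3 half]
  proof eventually_elim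
    case (elim n)
    interpret balanced_block_model n k "a n" "b n" by fact
    have Lp: "L n > 0" using elim(2) by linarith
    have sg: "sg n > 0" using \<sigma>_pos by (simp add: sg_def)
    define t where "t = nat \<lfloor>x1 * sqrt (L n)\<rfloor>"
    have sL1: "1 / x1 \<le> sqrt (L n)" using elim(3) by (rule real_le_rsqrt)
    have sL2: "1 / (x1 - x0) \<le> sqrt (L n)" using elim(4) by (rule real_le_rsqrt)
    have y1: "1 \<le> x1 * sqrt (L n)" using sL1 x1 by (simp add: field_simps)
    have y2: "1 \<le> (x1 - x0) * sqrt (L n)" using sL2 x by (simp add: field_simps)
    have t1: "real t \<le> x1 * sqrt (L n)" "x1 * sqrt (L n) < real t + 1"
      using y1 unfolding t_def by linarith+
    have t2: "x0 * sqrt (L n) \<le> real t" using t1 y2 by (simp add: algebra_simps)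
    have tge: "t \<ge> 1" using y1 unfolding t_def by (simp add: le_nat_floor)
    have "(real t)\<^sup>2 \<le> (x1 * sqrt (L n))\<^sup>2" using t1 by (intro power_mono) auto
    also have "\<dots> = x1\<^sup>2 * L n" using Lp by (simp add: power_mult_distrib)
    also have "\<dots> \<le> 2 * L n" using x Lp by (intro mult_right_mono) auto
    finally have tg: "real t \<in> grid" by (intro grid_memI elim(2) tge)
    define u where "u = \<mu> + real t * \<sigma>"
    have u1: "thr x0 n \<le> u" "u \<le> thr x1 n"
      unfolding u_def thr_def mu_def sg_def using t1 t2 \<sigma>_pos by auto
    have F1: "0 < F u"
    proof -
      have "0 < exp (- (x1\<^sup>2 / 2 + 1) * L n)" by simp
      also have "\<dots> \<le> F (thr x1 n)" by (rule elim(9))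
      also have "\<dots> \<le> F u" by (rule F_mono[OF u1(2)])
      finally show ?thesis .
    qed
    have F2: "F u \<le> exp (- \<beta>0 * L n)" using F_mono[OF u1(1)] elim(8) by linarith
    have F3: "F u < 1" using F2 elim(14) by linarith
    have Vp: "V u > 0" by (rule V_pos[OF F1 F3])
    have "V u \<le> real n * (F u + c0 * exp (- (2 * \<beta>0) * L n))" using elim(11) u1(1) by blast
    also have "\<dots> \<le> real n * (exp (- \<beta>0 * L n) + c0 * exp (- \<beta>0 * L n))"
      using F2 c0 \<beta>(3) Lp by (intro mult_left_mono add_mono) auto
    also have "\<dots> = (1 + c0) * (exp (L n) * exp (- \<beta>0 * L n))" unfolding exp_L[OF elim(1)] by (simp add: algebra_simps)
    also have "exp (L n) * exp (- \<beta>0 * L n) = (exp ((1 - \<beta>0) / 2 * L n))\<^sup>2"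
      unfolding power2_eq_square exp_add[symmetric] by (simp add: algebra_simps)
    finally have "sqrt (V u) \<le> sqrt ((1 + c0) * (exp ((1 - \<beta>0) / 2 * L n))\<^sup>2)" by (rule real_sqrt_le_mono)
    then have sV: "sqrt (V u) \<le> sqrt (1 + c0) * exp ((1 - \<beta>0) / 2 * L n)" by (simp add: real_sqrt_mult)
    define q where "q = exp (- \<beta>1 * L n)"
    have q: "q > 0" by (simp add: q_def)
    have sq: "exp (\<zeta> * L n) / 2 \<le> real (s n) * q"
    proof -
      have "exp (\<zeta> * L n) = exp ((1 - \<alpha>) * L n) * q"
        unfolding q_def exp_add[symmetric] \<zeta>_def by (simp add: algebra_simps)
      then show ?thesis using elim(7) q mult_right_mono[of "exp ((1 - \<alpha>) * L n) / 2" "real (s n)" q] by simp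
    qed
    have sep: "8 * (sqrt (L n) * sqrt (V u)) \<le> real (s n) * q"
    proof -
      have "8 * (sqrt (L n) * sqrt (V u)) \<le> 8 * (sqrt (L n) * (sqrt (1 + c0) * exp ((1 - \<beta>0) / 2 * L n)))"
        using Lp sV by (intro mult_left_mono) auto
      also have "\<dots> = (16 * sqrt (1 + c0) * (sqrt (L n) * exp (((1 - \<beta>0) / 2 - \<zeta>) * L n))) * (exp (\<zeta> * L n) / 2)"
      proof -
        have "exp ((1 - \<beta>0) / 2 * L n) = exp (((1 - \<beta>0) / 2 - \<zeta>) * L n) * exp (\<zeta> * L n)"
          unfolding exp_add[symmetric] by (simp add: algebra_simps)
        then show ?thesis by simp
      qed
      also have "\<dots> \<le> 1 * (exp (\<zeta> * L n) / 2)" using elim(13) by (rule mult_right_mono) simp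
      also have "\<dots> \<le> real (s n) * q" using sq by simp
      finally show ?thesis .
    qed
    have b2: "4 / (real (s n) * q) \<le> 8 * exp (- \<zeta> * L n)"
    proof -
      have "4 / (real (s n) * q) \<le> 4 / (exp (\<zeta> * L n) / 2)"
        using sq q elim(6) by (intro divide_left_mono mult_pos_pos) auto
      then show ?thesis by (simp add: exp_minus field_simps)
    qed
    have b3: "4 * F u / q \<le> 4 * exp ((\<beta>1 - \<beta>0) * L n)"
    proof -
      have "4 * F u / q \<le> 4 * exp (- \<beta>0 * L n) / q" using F2 q by (intro divide_right_mono) auto
      also have "exp (- \<beta>0 * L n) / q = exp ((\<beta>1 - \<beta>0) * L n)"
        unfolding q_def exp_diff[symmetric] by (simp add: algebra_simps)
      then have "4 * exp (- \<beta>0 * L n) / q = 4 * exp ((\<beta>1 - \<beta>0) * L n)"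
        by (simp only: times_divide_eq_right[symmetric])
      finally show ?thesis .
    qed
    show ?case
    proof (intro ballI)
      fix \<C> S assume C: "\<C> \<in> communities n k 1" and S: "S \<in> sparse_sets n"
      have S': "S \<subseteq> {1..n}" "card S = s n" "S \<noteq> {}" using S elim(6) by (auto simp: sparse_sets_def)
      have "Pr (bern (edges n) (altw n \<C> S (A n))) (\<lambda>x. \<not> HC n k (a n) (b n) (graph x) > sqrt (L n))
         \<le> 1 / L n + 4 / (card S * q) + 4 * F u / q"
      proof (rule HC_alt[OF C S'(1,3) _ _ elim(2) tg u_def q _ Vp])
        show "q \<le> Pr (bern (edges n) (altw n \<C> S (A n))) (\<lambda>x. cnt (cut n S i) x > u)" if "i \<in> S" for i
        proof -
          have "q \<le> Pr (bern (edges n) (altw n \<C> S (A n))) (\<lambda>x. cnt (cut n S i) x > thr x1 n)"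
            unfolding q_def using elim(10) C S that by blast
          also have "\<dots> \<le> Pr (bern (edges n) (altw n \<C> S (A n))) (\<lambda>x. cnt (cut n S i) x > u)"
            using u1(2) by (intro Pr_mono) auto
          finally show ?thesis .
        qed
      qed (use elim(5) sep S' in auto)
      also have "\<dots> \<le> 1 / L n + 8 * exp (- \<zeta> * L n) + 4 * exp ((\<beta>1 - \<beta>0) * L n)"
        using b2 b3 unfolding S'(2) by linarith
      also have "\<dots> \<le> \<epsilon>" by (rule elim(12))
      finally show "Pr (bern (edges n) (altw n \<C> S (A n))) (\<lambda>x. \<not> HC_test k a b n (graph x)) \<le> \<epsilon>"
        unfolding HC_test_def .
    qed
  qed
qed

lemma d_max_monotone:
  "\<forall>\<^sub>F n in FF. \<forall>x y. (\<forall>e. x e \<longrightarrow> y e) \<longrightarrow> d_max_test k a b c n (graph x) \<longrightarrow> d_max_test k a b c n (graph y)"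
  using ev_model
proof eventually_elim
  case (elim n)
  interpret balanced_block_model n k "a n" "b n" by fact
  show ?case
  proof (intro allI impI)
    fix x y :: "nat \<times> nat \<Rightarrow> bool" assume le: "\<forall>e. x e \<longrightarrow> y e" and T: "d_max_test k a b c n (graph x)"
    obtain i where i: "i \<in> {1..n}" "cnt (star n i) x > \<mu> + c n * \<sigma>"
      using T unfolding d_max_test_def d_max_graph by blast
    have "cnt (star n i) x \<le> cnt (star n i) y" by (rule cnt_mono) (use le in blast)
    then show "d_max_test k a b c n (graph y)"
      unfolding d_max_test_def d_max_graph using i by (intro bexI[of _ i]) auto
  qed
qed

lemma d_max_test_graph:
  assumes "model n"
  shows "d_max_test k a b c n (graph x) \<longleftrightarrow> (\<exists>i\<in>{1..n}. cnt (star n i) x > mu n + c n * sg n)"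
  unfolding d_max_test_def balanced_block_model.d_max_graph[OF assms] mu_def sg_def ..

lemma d_max_null_level:
  assumes x: "1 < x\<^sup>2 / 2" "0 < x" and \<epsilon>: "\<epsilon> > 0"
  shows "\<forall>\<^sub>F n in FF. \<forall>\<C>\<in>communities n k 1.
     Pr (bern (edges n) (nullw n \<C>)) (\<lambda>y. \<exists>i\<in>{1..n}. cnt (star n i) y > thr x n) \<le> \<epsilon>"
proof -
  obtain \<beta> where \<beta>: "1 < \<beta>" "\<beta> < x\<^sup>2 / 2" using x(1) dense by blast
  have lim: "((\<lambda>n. exp ((1 - \<beta>) * L n)) \<longlongrightarrow> 0) FF" using \<beta> by (intro exp_decay) auto
  show ?thesis
    using ev_model null_tail_upper[OF x(2) \<beta>(2)] ev_small[OF lim \<epsilon>]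
  proof eventually_elim
    case (elim n)
    interpret balanced_block_model n k "a n" "b n" by fact
    show ?case
    proof
      fix \<C> assume C: "\<C> \<in> communities n k 1"
      have "Pr (bern (edges n) (nullw n \<C>)) (\<lambda>y. \<exists>i\<in>{1..n}. cnt (star n i) y > thr x n)
          \<le> (\<Sum>i\<in>{1..n}. Pr (bern (edges n) (nullw n \<C>)) (\<lambda>y. cnt (star n i) y > thr x n))"
        by (rule Pr_Bex) simp
      also have "\<dots> = (\<Sum>i\<in>{1..n}. F (thr x n))" by (intro sum.cong refl Pr_exceed[OF C])
      also have "\<dots> = exp (L n) * F (thr x n)" unfolding exp_L[OF elim(1)] by simp
      also have "\<dots> \<le> exp (L n) * exp (- \<beta> * L n)" using elim(2) by (intro mult_left_mono) auto
      also have "\<dots> = exp ((1 - \<beta>) * L n)" unfolding exp_add[symmetric] by (simp add: algebra_simps)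
      also have "\<dots> \<le> \<epsilon>" by (rule elim(3))
      finally show "Pr (bern (edges n) (nullw n \<C>)) (\<lambda>y. \<exists>i\<in>{1..n}. cnt (star n i) y > thr x n) \<le> \<epsilon>" .
    qed
  qed
qed

lemma d_max_power:
  assumes x: "v < x" "(x - v)\<^sup>2 / 2 < 1 - \<alpha>" and \<epsilon>: "\<epsilon> > 0"
  shows "\<forall>\<^sub>F n in FF. \<forall>\<C>\<in>communities n k 1. \<forall>S\<in>sparse_sets n.
     Pr (bern (edges n) (altw n \<C> S (A n))) (\<lambda>y. \<not> (\<exists>i\<in>{1..n}. cnt (star n i) y > thr x n)) \<le> \<epsilon>"
proof -
  obtain \<beta> where \<beta>: "(x - v)\<^sup>2 / 2 < \<beta>" "\<beta> < 1 - \<alpha>" using x(2) dense by blast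
  have "((\<lambda>n. 8 * exp ((\<alpha> + \<beta> - 1) * L n)) \<longlongrightarrow> 8 * 0) FF" using \<beta> by (intro tendsto_intros exp_decay) auto
  then have lim: "((\<lambda>n. 8 * exp ((\<alpha> + \<beta> - 1) * L n)) \<longlongrightarrow> 0) FF" by simp
  show ?thesis
    using ev_model cut_tail_lower[OF x(1) \<beta>(1)] ev_small[OF lim \<epsilon>] ev_s_bounds ev_s_le
  proof eventually_elim
    case (elim n)
    interpret balanced_block_model n k "a n" "b n" by fact
    define q where "q = exp (- \<beta> * L n)"
    have q: "q > 0" by (simp add: q_def)
    show ?case
    proof (intro ballI)
      fix \<C> S assume C: "\<C> \<in> communities n k 1" and S: "S \<in> sparse_sets n"
      have S': "S \<subseteq> {1..n}" "card S = s n" "S \<noteq> {}" using S elim(5) by (auto simp: sparse_sets_def)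
      let ?M = "bern (edges n) (altw n \<C> S (A n))"
      have cq: "card S * q > 0" using q S' elim(5) by simp
      have "Pr ?M (\<lambda>y. \<not> (\<exists>i\<in>{1..n}. cnt (star n i) y > thr x n))
         \<le> Pr ?M (\<lambda>y. (\<Sum>i\<in>S. of_bool (cnt (cut n S i) y > thr x n)) \<le> card S * q / 2)"
      proof (rule Pr_mono)
        fix y assume ny: "\<not> (\<exists>i\<in>{1..n}. cnt (star n i) y > thr x n)"
        have "(\<Sum>i\<in>S. of_bool (cnt (cut n S i) y > thr x n)) = (\<Sum>i\<in>S. 0 :: real)"
        proof (rule sum.cong[OF refl])
          fix i assume i: "i \<in> S"
          then have "cut n S i \<subseteq> star n i" unfolding star_def by auto
          then have "cnt (cut n S i) y \<le> cnt (star n i) y" by (rule cnt_subset) (simp add: star_def)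
          moreover have "\<not> cnt (star n i) y > thr x n" using ny i S'(1) by blast
          ultimately show "of_bool (cnt (cut n S i) y > thr x n) = (0 :: real)" by simp
        qed
        then show "(\<Sum>i\<in>S. of_bool (cnt (cut n S i) y > thr x n)) \<le> card S * q / 2" using cq by simp
      qed
      also have "\<dots> \<le> 4 / (card S * q)"
        by (rule cut_exceedances_few[OF S'(1,3) q]) (use elim(2) C S in \<open>auto simp: q_def\<close>)
      also have "\<dots> \<le> 8 * exp ((\<alpha> + \<beta> - 1) * L n)"
      proof -
        have "exp (- ((\<alpha> + \<beta> - 1) * L n)) = exp ((1 - \<alpha>) * L n) * q"
          unfolding q_def exp_add[symmetric] by (simp add: algebra_simps)
        also have "\<dots> \<le> 2 * real (s n) * q" using elim(4) q by (intro mult_right_mono) auto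
        finally have "exp (- ((\<alpha> + \<beta> - 1) * L n)) / 2 \<le> card S * q" unfolding S'(2) by simp
        then have "4 / (card S * q) \<le> 4 / (exp (- ((\<alpha> + \<beta> - 1) * L n)) / 2)"
          by (intro frac_le) auto
        also have "4 / (exp (- w) / 2) = 8 * exp w" for w :: real by (simp add: exp_minus field_simps)
        finally show ?thesis .
      qed
      also have "\<dots> \<le> \<epsilon>" by (rule elim(3))
      finally show "Pr ?M (\<lambda>y. \<not> (\<exists>i\<in>{1..n}. cnt (star n i) y > thr x n)) \<le> \<epsilon>" .
    qed
  qed
qed

text \<open>Second moment method: the number of null exceedances has mean \<open>n powr (1 - x\<^sup>2 / 2 + o(1))\<close>, and its
standard deviation is of smaller order.\<close>

lemma null_max_exceeds:
  assumes x: "0 < x" "x\<^sup>2 / 2 < 1" and \<epsilon>: "\<epsilon> > 0"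
  shows "\<forall>\<^sub>F n in FF. \<forall>\<C>\<in>communities n k 1.
     Pr (bern (edges n) (nullw n \<C>)) (\<lambda>y. \<exists>i\<in>{1..n}. cnt (star n i) y > thr x n) \<ge> 1 - \<epsilon>"
proof -
  obtain c0 where c0: "c0 \<ge> 0" and vu: "\<forall>x \<beta>. 0 < x \<longrightarrow> \<beta> < x\<^sup>2 / 2 \<longrightarrow>
     (\<forall>\<^sub>F n in FF. \<forall>u\<ge>thr x n. varV n u \<le> real n * (tailF n u + c0 * exp (- (2 * \<beta>) * L n)))"
    using variance_upper by (elim exE conjE) (rule that)
  define \<delta> where "\<delta> = min ((1 - x\<^sup>2 / 2) / 2) (1 / 8)"
  have \<delta>: "\<delta> > 0" "\<delta> \<le> (1 - x\<^sup>2 / 2) / 2" "\<delta> \<le> 1 / 8"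
    using x unfolding \<delta>_def by (simp, intro min.cobounded1, intro min.cobounded2)
  define \<beta> \<beta>1 where "\<beta> = x\<^sup>2 / 2 - \<delta>" and "\<beta>1 = x\<^sup>2 / 2 + \<delta>"
  have \<beta>: "\<beta> < x\<^sup>2 / 2" and \<beta>1: "x\<^sup>2 / 2 < \<beta>1" using \<delta>(1) by (auto simp: \<beta>_def \<beta>1_def)
  have neg: "\<beta>1 - 1 < 0" using \<delta>(2) x(2) unfolding \<beta>1_def by argo
  have neg': "2 * (\<beta>1 - \<beta>) - 1 < 0" using \<delta>(3) by (simp add: \<beta>_def \<beta>1_def)
  have "((\<lambda>n. exp ((\<beta>1 - 1) * L n) + c0 * exp ((2 * (\<beta>1 - \<beta>) - 1) * L n)) \<longlongrightarrow> 0 + c0 * 0) FF"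
    by (intro tendsto_intros exp_decay neg neg')
  then have lim: "((\<lambda>n. exp ((\<beta>1 - 1) * L n) + c0 * exp ((2 * (\<beta>1 - \<beta>) - 1) * L n)) \<longlongrightarrow> 0) FF" by simp
  show ?thesis
    using ev_model null_tail_lower[OF x(1) \<beta>1] vu[rule_format, OF x(1) \<beta>] ev_small[OF lim \<epsilon>]
  proof eventually_elim
    case (elim n)
    interpret balanced_block_model n k "a n" "b n" by fact
    let ?u = "thr x n"
    define f where "f = exp (- \<beta>1 * L n)"
    have f: "f > 0" "f \<le> F ?u" using elim(2) by (auto simp: f_def)
    have Fp: "F ?u > 0" using f by linarith
    have nF: "real n * F ?u > 0" using Fp n_pos by simp
    show ?case
    proof
      fix \<C> assume C: "\<C> \<in> communities n k 1"
      let ?M = "bern (edges n) (nullw n \<C>)"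
      have "Pr ?M (\<lambda>y. \<not> (\<exists>i\<in>{1..n}. cnt (star n i) y > ?u)) \<le> Pr ?M (\<lambda>y. exceedances ?u y \<le> E ?M (exceedances ?u) - real n * F ?u)"
      proof (rule Pr_mono)
        fix y assume "\<not> (\<exists>i\<in>{1..n}. cnt (star n i) y > ?u)"
        then have "exceedances ?u y = 0" unfolding exceedances_def by (intro sum.neutral) auto
        then show "exceedances ?u y \<le> E ?M (exceedances ?u) - real n * F ?u" unfolding E_exceedances[OF C] by simp
      qed
      also have "\<dots> \<le> measure_pmf.variance ?M (exceedances ?u) / (real n * F ?u)\<^sup>2"
        by (rule Pr_chebyshev_lower(1)[OF _ nF]) simp
      also have "\<dots> = V ?u / (real n * F ?u)\<^sup>2" unfolding variance_exceedances[OF C] ..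
      also have "\<dots> \<le> real n * (F ?u + c0 * exp (- (2 * \<beta>) * L n)) / (real n * F ?u)\<^sup>2"
        by (intro divide_right_mono) (use elim(3) in auto)
      also have "\<dots> = (1 / real n) * (1 / F ?u) + (1 / real n) * (c0 * exp (- (2 * \<beta>) * L n) / (F ?u)\<^sup>2)"
        using n_pos Fp by (simp add: field_simps power2_eq_square)
      also have "\<dots> \<le> (1 / real n) * (1 / f) + (1 / real n) * (c0 * exp (- (2 * \<beta>) * L n) / f\<^sup>2)"
        using f c0 by (intro add_mono mult_left_mono frac_le power_mono) auto
      also have "(1 / real n) * (1 / f) = exp ((\<beta>1 - 1) * L n)"
      proof -
        have "exp ((\<beta>1 - 1) * L n) * (exp (L n) * f) = 1"
          unfolding f_def exp_add[symmetric] by (simp add: algebra_simps)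
        then show ?thesis unfolding exp_L[OF elim(1)] using f n_pos by (simp add: field_simps)
      qed
      also have "(1 / real n) * (c0 * exp (- (2 * \<beta>) * L n) / f\<^sup>2) = c0 * exp ((2 * (\<beta>1 - \<beta>) - 1) * L n)"
      proof -
        have "exp ((2 * (\<beta>1 - \<beta>) - 1) * L n) * (exp (L n) * (f * f)) = exp (- (2 * \<beta>) * L n)"
          unfolding f_def exp_add[symmetric] by (simp add: algebra_simps)
        then have "exp (- (2 * \<beta>) * L n) = exp ((2 * (\<beta>1 - \<beta>) - 1) * L n) * (real n * f\<^sup>2)"
          unfolding exp_L[OF elim(1)] power2_eq_square by simp
        then show ?thesis using f n_pos by simp
      qed
      also have "exp ((\<beta>1 - 1) * L n) + c0 * exp ((2 * (\<beta>1 - \<beta>) - 1) * L n) \<le> \<epsilon>" by (rule elim(4))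
      finally show "Pr ?M (\<lambda>y. \<exists>i\<in>{1..n}. cnt (star n i) y > thr x n) \<ge> 1 - \<epsilon>" unfolding Pr_not by linarith
    qed
  qed
qed

lemma alt_max_on_S:
  assumes x: "v < x" "1 - \<alpha> < (x - v)\<^sup>2 / 2" and \<epsilon>: "\<epsilon> > 0"
  shows "\<forall>\<^sub>F n in FF. \<forall>\<C>\<in>communities n k 1. \<forall>S\<in>sparse_sets n.
     Pr (bern (edges n) (altw n \<C> S (A n))) (\<lambda>y. \<exists>i\<in>S. cnt (star n i) y > thr x n) \<le> \<epsilon>"
proof -
  obtain \<beta> where \<beta>: "1 - \<alpha> < \<beta>" "\<beta> < (x - v)\<^sup>2 / 2" using x(2) dense by blast
  have "((\<lambda>n. 2 * exp ((1 - \<alpha> - \<beta>) * L n)) \<longlongrightarrow> 2 * 0) FF" using \<beta> by (intro tendsto_intros exp_decay) auto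
  then have lim: "((\<lambda>n. 2 * exp ((1 - \<alpha> - \<beta>) * L n)) \<longlongrightarrow> 0) FF" by simp
  show ?thesis
    using alt_tail_upper[OF x(1) \<beta>(2)] ev_small[OF lim \<epsilon>] ev_s_bounds
  proof eventually_elim
    case (elim n)
    show ?case
    proof (intro ballI)
      fix \<C> S assume C: "\<C> \<in> communities n k 1" and S: "S \<in> sparse_sets n"
      let ?M = "bern (edges n) (altw n \<C> S (A n))"
      have S': "finite S" "card S = s n" using S finite_subset by (auto simp: sparse_sets_def)
      have "Pr ?M (\<lambda>y. \<exists>i\<in>S. cnt (star n i) y > thr x n) \<le> (\<Sum>i\<in>S. Pr ?M (\<lambda>y. cnt (star n i) y > thr x n))"
        by (rule Pr_Bex[OF S'(1)])
      also have "\<dots> \<le> (\<Sum>i\<in>S. exp (- \<beta> * L n))" by (rule sum_mono) (use elim(1) C S in blast)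
      also have "\<dots> = real (s n) * exp (- \<beta> * L n)" using S' by simp
      also have "\<dots> \<le> 2 * exp ((1 - \<alpha>) * L n) * exp (- \<beta> * L n)" using elim(3) by (intro mult_right_mono) auto
      also have "\<dots> = 2 * exp ((1 - \<alpha> - \<beta>) * L n)" unfolding mult.assoc exp_add[symmetric] by (simp add: algebra_simps)
      also have "\<dots> \<le> \<epsilon>" by (rule elim(2))
      finally show "Pr ?M (\<lambda>y. \<exists>i\<in>S. cnt (star n i) y > thr x n) \<le> \<epsilon>" .
    qed
  qed
qed

text \<open>\<open>A\<close> is of order \<open>sqrt (L / a)\<close>, so the product is of order \<open>sqrt (L * a) / n\<close>, and \<open>a \<le> n / 2\<close>.\<close>

lemma ev_added_probability:
  "\<forall>\<^sub>F n in FF. A n * (a n / real n) \<le> sqrt (2 * real k * C) * (sqrt (L n) * exp (- (1 / 2) * L n))"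
  using ev_model ev_L_ge[of 1]
proof eventually_elim
  case (elim n)
  interpret balanced_block_model n k "a n" "b n" by fact
  have n: "real n > 0" using n_pos by simp
  have "a n / (4 * real k) \<le> var0 n" using \<sigma>_sq_ge var0_ge[OF elim(1)] unfolding sg_def by linarith
  then have "C * L n / var0 n \<le> C * L n / (a n / (4 * real k))"
    using C elim(2) ab k by (intro frac_le) auto
  then have "C * L n / var0 n * (a n / real n)\<^sup>2 \<le> C * L n / (a n / (4 * real k)) * (a n / real n)\<^sup>2"
    by (rule mult_right_mono) simp
  also have "\<dots> = 4 * real k * C * L n * (a n / real n) / real n"
    using ab by (simp add: field_simps power2_eq_square)
  also have "\<dots> \<le> 4 * real k * C * L n * (1 / 2) / real n"
    using p_bounds C elim(2) n by (intro divide_right_mono mult_left_mono) (auto simp: pa_def)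
  also have "\<dots> = 2 * real k * C * (L n * exp (- L n))"
    unfolding exp_minus exp_L[OF elim(1)] by (simp add: field_simps)
  finally have "sqrt (C * L n / var0 n * (a n / real n)\<^sup>2) \<le> sqrt (2 * real k * C * (L n * exp (- L n)))"
    by (rule real_sqrt_le_mono)
  moreover have "sqrt (C * L n / var0 n * (a n / real n)\<^sup>2) = A n * (a n / real n)"
    unfolding signal_def real_sqrt_mult[of _ "(a n / real n)\<^sup>2"] using ab n by simp
  moreover have "sqrt (exp (- L n)) = exp (- (1 / 2) * L n)"
    by (rule real_sqrt_unique) (auto simp: power2_eq_square exp_add[symmetric])
  ultimately show ?case by (simp add: real_sqrt_mult)
qed

text \<open>There are \<open>n * s\<close> pairs, an edge is added with probability \<open>n powr (- 1 / 2 + o(1))\<close> at most, and the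
vertex is above the threshold with probability \<open>n powr (- x\<^sup>2 / 2 + o(1))\<close>.\<close>

lemma added_edges_total:
  assumes x: "0 < x" "3 / 2 - \<alpha> < x\<^sup>2 / 2" and \<epsilon>: "\<epsilon> > 0"
  shows "\<forall>\<^sub>F n in FF. \<forall>\<C>\<in>communities n k 1. \<forall>S\<in>sparse_sets n.
     Pr (coupling (edges n) (nullw n \<C>) (altw n \<C> S (A n)))
        (\<lambda>z. \<exists>i\<in>{1..n} - S. \<exists>j\<in>S. snd (z (edge i j)) \<and> \<not> fst (z (edge i j)) \<and> cnt (star n i) (\<lambda>e. snd (z e)) > thr x n)
     \<le> \<epsilon>"
proof -
  obtain \<beta> where \<beta>: "3 / 2 - \<alpha> < \<beta>" "\<beta> < x\<^sup>2 / 2" using x(2) dense by blast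
  define c where "c = sqrt (2 * real k * C)"
  have c: "c \<ge> 0" using C by (simp add: c_def)
  have "((\<lambda>n. 6 * c * (sqrt (L n) * exp ((3 / 2 - \<alpha> - \<beta>) * L n))) \<longlongrightarrow> 6 * c * 0) FF"
    using \<beta> by (intro tendsto_intros sqrt_exp_decay) auto
  then have lim: "((\<lambda>n. 6 * c * (sqrt (L n) * exp ((3 / 2 - \<alpha> - \<beta>) * L n))) \<longlongrightarrow> 0) FF" by simp
  show ?thesis
    using ev_model added_edge_tail[OF x(1) \<beta>(2)] ev_small[OF lim \<epsilon>] ev_s_bounds ev_added_probability ev_L_ge[of 1] ev_A_range
  proof eventually_elim
    case (elim n)
    interpret balanced_block_model n k "a n" "b n" by fact
    show ?case
    proof (intro ballI)
      fix \<C> S assume C: "\<C> \<in> communities n k 1" and S: "S \<in> sparse_sets n"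
      let ?Q = "coupling (edges n) (nullw n \<C>) (altw n \<C> S (A n))"
      let ?B = "\<lambda>i j z. snd (z (edge i j)) \<and> \<not> fst (z (edge i j)) \<and> cnt (star n i) (\<lambda>e. snd (z e)) > thr x n"
      define r where "r = 3 * (A n * (a n / real n)) * exp (- \<beta> * L n)"
      have r0: "r \<ge> 0" unfolding r_def by (intro mult_nonneg_nonneg) (use elim(7) ab in auto)
      have S': "finite S" "card S = s n" using S finite_subset by (auto simp: sparse_sets_def)
      have "Pr ?Q (\<lambda>z. \<exists>i\<in>{1..n} - S. \<exists>j\<in>S. ?B i j z) \<le> (\<Sum>i\<in>{1..n} - S. Pr ?Q (\<lambda>z. \<exists>j\<in>S. ?B i j z))"
        by (rule Pr_Bex) simp
      also have "\<dots> \<le> (\<Sum>i\<in>{1..n} - S. \<Sum>j\<in>S. Pr ?Q (?B i j))" by (intro sum_mono Pr_Bex S')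
      also have "\<dots> \<le> (\<Sum>i\<in>{1..n} - S. \<Sum>j\<in>S. r)"
        unfolding r_def
        by (intro sum_mono bspec[OF bspec[OF bspec[OF bspec[OF elim(2) C] S]]])
      also have "\<dots> = real (card ({1..n} - S)) * (real (s n) * r)" using S' by simp
      also have "\<dots> \<le> real n * (real (s n) * r)"
      proof (rule mult_right_mono)
        have "card ({1..n} - S) \<le> card {1..n}" by (rule card_mono) auto
        then show "real (card ({1..n} - S)) \<le> real n" by simp
      qed (use r0 in simp)
      also have "\<dots> \<le> exp (L n) * (2 * exp ((1 - \<alpha>) * L n) *
          (3 * (c * (sqrt (L n) * exp (- (1 / 2) * L n))) * exp (- \<beta> * L n)))"
        unfolding exp_L[OF elim(1)]
      proof (intro mult_left_mono mult_mono[of "real (s n)"])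
        show "r \<le> 3 * (c * (sqrt (L n) * exp (- (1 / 2) * L n))) * exp (- \<beta> * L n)"
          unfolding r_def c_def using elim(5) by (intro mult_right_mono mult_left_mono) auto
      qed (use elim(4) r0 in auto)
      also have "\<dots> = 6 * c * (sqrt (L n) * exp ((3 / 2 - \<alpha> - \<beta>) * L n))"
      proof -
        have "exp ((3 / 2 - \<alpha> - \<beta>) * L n) = exp (L n) * (exp ((1 - \<alpha>) * L n) * (exp (- (1 / 2) * L n) * exp (- \<beta> * L n)))"
          unfolding exp_add[symmetric] by (simp add: algebra_simps)
        then show ?thesis by simp
      qed
      also have "\<dots> \<le> \<epsilon>" by (rule elim(3))
      finally show "Pr ?Q (\<lambda>z. \<exists>i\<in>{1..n} - S. \<exists>j\<in>S. ?B i j z) \<le> \<epsilon>" .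
    qed
  qed
qed

text \<open>Either the cutoff lies below the null maximum, and the test rejects under the null, or it is so high that
  neither the vertices of \<open>S\<close> nor the edges added elsewhere matter, and the test cannot tell the hypotheses apart.\<close>

lemma d_max_powerless:
  assumes x: "0 < x" "x\<^sup>2 / 2 < 1" "3 / 2 - \<alpha> < x\<^sup>2 / 2" "v < x" "1 - \<alpha> < (x - v)\<^sup>2 / 2"
  shows "powerless k a b s A (d_max_test k a b c)"
proof (rule powerlessI)
  fix \<epsilon> :: real assume "\<epsilon> > 0"
  then have \<epsilon>: "\<epsilon> / 2 > 0" by simp
  show "\<forall>\<^sub>F n in FF. \<exists>\<C>\<in>communities n k 1. \<exists>S\<in>sparse_sets n.
     Pr (bern (edges n) (nullw n \<C>)) (\<lambda>x. d_max_test k a b c n (graph x)) +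
     Pr (bern (edges n) (altw n \<C> S (A n))) (\<lambda>x. \<not> d_max_test k a b c n (graph x)) \<ge> 1 - \<epsilon>"
    using ev_model ev_sparse_sets null_max_exceeds[OF x(1,2) \<epsilon>] alt_max_on_S[OF x(4,5) \<epsilon>]
      added_edges_total[OF x(1,3) \<epsilon>] ev_A_range
  proof eventually_elim
    case (elim n)
    interpret balanced_block_model n k "a n" "b n" by fact
    have A: "0 \<le> A n" "A n \<le> 1 / 4" using elim(6) by auto
    let ?C = "ref_communities n k"
    obtain S where S: "S \<in> sparse_sets n" using elim(2) by blast
    let ?M0 = "bern (edges n) (nullw n ?C)" and ?M1 = "bern (edges n) (altw n ?C S (A n))"
    let ?Q = "coupling (edges n) (nullw n ?C) (altw n ?C S (A n))"
    define u where "u = mu n + c n * sg n"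
    have T: "d_max_test k a b c n (graph y) \<longleftrightarrow> (\<exists>i\<in>{1..n}. cnt (star n i) y > u)" for y
      unfolding d_max_test_graph[OF elim(1)] u_def ..
    have sg: "sg n > 0" using \<sigma>_pos by (simp add: sg_def)
    have "1 - \<epsilon> \<le> Pr ?M0 (\<lambda>y. \<exists>i\<in>{1..n}. cnt (star n i) y > u) + Pr ?M1 (\<lambda>y. \<not> (\<exists>i\<in>{1..n}. cnt (star n i) y > u))"
    proof (cases "u \<le> thr x n")
      case True
      have "1 - \<epsilon> / 2 \<le> Pr ?M0 (\<lambda>y. \<exists>i\<in>{1..n}. cnt (star n i) y > thr x n)" using elim(3) ref_in by blast
      also have "\<dots> \<le> Pr ?M0 (\<lambda>y. \<exists>i\<in>{1..n}. cnt (star n i) y > u)"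
        using True by (intro Pr_mono) (meson le_less_trans)
      finally show ?thesis using \<epsilon> measure_nonneg[of ?M1 "{y. \<not> (\<exists>i\<in>{1..n}. cnt (star n i) y > u)}"] by linarith
    next
      case False
      have Q0: "map_pmf (\<lambda>z j. fst (z j)) ?Q = ?M0" by (rule coupling_fst) simp
      have Q1: "map_pmf (\<lambda>z j. snd (z j)) ?Q = ?M1"
        by (rule coupling_snd[OF finite_edges]) (rule w1_coupled[OF A])
      define B1 where "B1 y \<longleftrightarrow> (\<exists>i\<in>S. cnt (star n i) y > thr x n)" for y
      define B2 where "B2 y \<longleftrightarrow> (\<exists>i\<in>{1..n}. cnt (star n i) y > u)" for y
      define B3 where "B3 z \<longleftrightarrow> (\<exists>i\<in>{1..n} - S. \<exists>j\<in>S. snd (z (edge i j)) \<and> \<not> fst (z (edge i j))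
          \<and> cnt (star n i) (\<lambda>e. snd (z e)) > thr x n)" for z :: "nat \<times> nat \<Rightarrow> bool \<times> bool"
      have "Pr ?M1 B2 = Pr ?Q (\<lambda>z. B2 (\<lambda>j. snd (z j)))" unfolding Q1[symmetric] Pr_map ..
      also have "\<dots> \<le> Pr ?Q (\<lambda>z. B1 (\<lambda>j. snd (z j)) \<or> (B2 (\<lambda>j. fst (z j)) \<or> B3 z))"
      proof (rule Pr_mono, rule ccontr)
        fix z assume z: "z \<in> set_pmf ?Q" and b2: "B2 (\<lambda>j. snd (z j))"
          and n: "\<not> (B1 (\<lambda>j. snd (z j)) \<or> (B2 (\<lambda>j. fst (z j)) \<or> B3 z))"
        obtain i where i: "i \<in> {1..n}" "cnt (star n i) (\<lambda>j. snd (z j)) > u" using b2 unfolding B2_def by blast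
        have it: "cnt (star n i) (\<lambda>j. snd (z j)) > thr x n" using i(2) False by linarith
        have iS: "i \<notin> S" using n it unfolding B1_def by blast
        have "snd (z (edge i j)) = fst (z (edge i j))" if j: "j \<in> {1..n} - {i}" for j
        proof (cases "j \<in> S")
          case True
          then have "\<not> (snd (z (edge i j)) \<and> \<not> fst (z (edge i j)))"
            using n it i(1) iS unfolding B3_def by blast
          then show ?thesis using coupling_mono[OF finite_edges z] by blast
        next
          case False
          show ?thesis
          proof (rule coupling_equal[OF finite_edges z])
            show "edge i j \<in> edges n" using i(1) j by (intro edge_in_edges) auto
            show "nullw n ?C (edge i j) = altw n ?C S (A n) (edge i j)"
              unfolding w1_edge[OF A] using iS False by simp
          qed
        qed
        then have "cnt (star n i) (\<lambda>j. snd (z j)) = cnt (star n i) (\<lambda>j. fst (z j))"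
          unfolding cnt_def sum_star by (intro sum.cong) auto
        then show False using i n unfolding B2_def by (metis (no_types, lifting))
      qed
      also have "\<dots> \<le> Pr ?Q (\<lambda>z. B1 (\<lambda>j. snd (z j))) + (Pr ?Q (\<lambda>z. B2 (\<lambda>j. fst (z j))) + Pr ?Q B3)"
        by (rule order_trans[OF Pr_disj add_left_mono[OF Pr_disj]])
      also have "Pr ?Q (\<lambda>z. B1 (\<lambda>j. snd (z j))) = Pr ?M1 B1" unfolding Q1[symmetric] Pr_map ..
      also have "Pr ?Q (\<lambda>z. B2 (\<lambda>j. fst (z j))) = Pr ?M0 B2" unfolding Q0[symmetric] Pr_map ..
      finally have "Pr ?M1 B2 \<le> Pr ?M1 B1 + (Pr ?M0 B2 + Pr ?Q B3)" .
      moreover have "Pr ?M1 B1 \<le> \<epsilon> / 2" unfolding B1_def by (rule bspec[OF bspec[OF elim(4) ref_in] S])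
      moreover have "Pr ?Q B3 \<le> \<epsilon> / 2" unfolding B3_def by (rule bspec[OF bspec[OF elim(5) ref_in] S])
      ultimately show ?thesis unfolding Pr_not B2_def by linarith
    qed
    then show ?case unfolding T using ref_in S by blast
  qed
qed

end


section \<open>Choice of the exponents\<close>

text \<open>A threshold \<open>t = x * sqrt (ln n)\<close> leaves \<open>n powr (1 - x\<^sup>2 / 2)\<close> null exceedances and
  \<open>n powr (1 - \<alpha> - (x - v)\<^sup>2 / 2)\<close> exceedances by signals. The ratio of the second to the square root of the
  first is largest at \<open>x = 2 * v\<close>, unless no null exceedance is left there, in which case \<open>x = sqrt 2\<close>.\<close>

lemma HC_exponents:
  fixes v \<alpha> :: real
  assumes v: "0 < v" "v < sqrt 2" and h1: "\<alpha> - 1 / 2 < v\<^sup>2 / 2"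
    and h2: "sqrt 2 < 2 * v \<Longrightarrow> (sqrt 2 - v)\<^sup>2 / 2 < 1 - \<alpha>"
  obtains x0 x1 \<beta>0 \<beta>1 where "0 < x0" "x0 < x1" "v < x1" "x1\<^sup>2 / 2 \<le> 1"
    "\<beta>0 < x0\<^sup>2 / 2" "(x1 - v)\<^sup>2 / 2 < \<beta>1" "0 < \<beta>0" "\<beta>1 < \<beta>0" "(1 - \<beta>0) / 2 < 1 - \<alpha> - \<beta>1"
proof -
  define x where "x = min (2 * v) (sqrt 2)"
  have x: "v < x" "0 < x" "x \<le> 2 * v" using v by (auto simp: x_def)
  have "x\<^sup>2 \<le> (sqrt 2)\<^sup>2" using x(2) by (intro power_mono) (auto simp: x_def)
  then have x2: "x\<^sup>2 / 2 \<le> 1" by simp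
  have key: "(1 - x\<^sup>2 / 2) / 2 < 1 - \<alpha> - (x - v)\<^sup>2 / 2"
  proof (cases "2 * v \<le> sqrt 2")
    case True
    then have "x = 2 * v" by (simp add: x_def)
    then show ?thesis using h1 by (simp add: power2_eq_square field_simps)
  next
    case False
    then have "x = sqrt 2" by (simp add: x_def)
    then show ?thesis using h2 False by simp
  qed
  have gap: "(x - v)\<^sup>2 / 2 < x\<^sup>2 / 2" using x v by (auto intro!: power_strict_mono)
  \<comment> \<open>The inequalities relating \<open>\<beta>0\<close>, \<open>\<beta>1\<close> and \<open>\<alpha>\<close> are strict at \<open>e = 0\<close>, hence persist for small \<open>e > 0\<close>.\<close>
  let ?b0 = "\<lambda>e. (x - e)\<^sup>2 / 2 - e" and ?b1 = "\<lambda>e. (x - v)\<^sup>2 / 2 + e"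
  have l0: "(?b0 \<longlongrightarrow> x\<^sup>2 / 2) (at_right 0)" by (auto intro!: tendsto_eq_intros)
  have l1: "(?b1 \<longlongrightarrow> (x - v)\<^sup>2 / 2) (at_right 0)" by (auto intro!: tendsto_eq_intros)
  have lx: "((\<lambda>e. x - e) \<longlongrightarrow> x) (at_right 0)" by (auto intro!: tendsto_eq_intros)
  have "((\<lambda>e. ?b0 e - ?b1 e) \<longlongrightarrow> x\<^sup>2 / 2 - (x - v)\<^sup>2 / 2) (at_right 0)" by (intro tendsto_diff l0 l1)
  then have e1: "\<forall>\<^sub>F e in at_right 0. 0 < ?b0 e - ?b1 e" by (rule order_tendstoD(1)) (use gap in simp)
  have "((\<lambda>e. (1 - \<alpha> - ?b1 e) - (1 - ?b0 e) / 2) \<longlongrightarrow> (1 - \<alpha> - (x - v)\<^sup>2 / 2) - (1 - x\<^sup>2 / 2) / 2) (at_right 0)"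
    by (intro tendsto_intros l0 l1) simp
  then have e2: "\<forall>\<^sub>F e in at_right 0. 0 < (1 - \<alpha> - ?b1 e) - (1 - ?b0 e) / 2"
    by (rule order_tendstoD(1)) (use key in simp)
  have e3: "\<forall>\<^sub>F e in at_right 0. 0 < ?b0 e" by (rule order_tendstoD(1)[OF l0]) (use x in simp)
  have e4: "\<forall>\<^sub>F e in at_right 0. 0 < x - e" by (rule order_tendstoD(1)[OF lx]) (use x in simp)
  have e5: "\<forall>\<^sub>F e in at_right 0. (0::real) < e" by (rule eventually_at_right_less)
  have "\<forall>\<^sub>F e in at_right 0. 0 < ?b0 e - ?b1 e \<and> 0 < (1 - \<alpha> - ?b1 e) - (1 - ?b0 e) / 2 \<and> 0 < ?b0 e \<and> 0 < x - e \<and> 0 < e"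
    using e1 e2 e3 e4 e5 by eventually_elim simp
  then obtain e where e: "0 < ?b0 e - ?b1 e" "0 < (1 - \<alpha> - ?b1 e) - (1 - ?b0 e) / 2" "0 < ?b0 e" "0 < x - e" "0 < e"
    using eventually_happens[of _ "at_right (0::real)"] by (auto simp: trivial_limit_at_right_real)
  show ?thesis
    by (rule that[of "x - e" x "?b0 e" "?b1 e"]) (use e x x2 in linarith)+
qed

context asymptotic_regime
begin

lemma HC_powerful:
  assumes C': "C \<le> C'" and v: "v < sqrt 2" and h1: "\<alpha> - 1 / 2 < v\<^sup>2 / 2"
    and h2: "sqrt 2 < 2 * v \<Longrightarrow> (sqrt 2 - v)\<^sup>2 / 2 < 1 - \<alpha>"
  shows "powerful k a b s (signal k a b C') (HC_test k a b)"
proof -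
  obtain x0 x1 \<beta>0 \<beta>1 where x: "0 < x0" "x0 < x1" "v < x1" "x1\<^sup>2 / 2 \<le> 1"
    "\<beta>0 < x0\<^sup>2 / 2" "(x1 - v)\<^sup>2 / 2 < \<beta>1" "0 < \<beta>0" "\<beta>1 < \<beta>0" "(1 - \<beta>0) / 2 < 1 - \<alpha> - \<beta>1"
    using HC_exponents[OF v_pos v h1 h2] by metis
  show ?thesis
    by (rule powerfulI[OF C' HC_monotone HC_null_level HC_power[OF x]])
qed

lemma d_max_powerful:
  assumes C': "C \<le> C'" and v: "v < sqrt 2" "(sqrt 2 - v)\<^sup>2 / 2 < 1 - \<alpha>"
  shows "\<exists>\<delta>>0. powerful k a b s (signal k a b C') (d_max_test k a b (\<lambda>n. sqrt (2 * (1 + \<delta>) * L n)))"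
proof -
  have "((\<lambda>x. (x - v)\<^sup>2 / 2) \<longlongrightarrow> (sqrt 2 - v)\<^sup>2 / 2) (at_right (sqrt 2))" by (intro tendsto_intros) simp
  then have "\<forall>\<^sub>F x in at_right (sqrt 2). (x - v)\<^sup>2 / 2 < 1 - \<alpha>" by (rule order_tendstoD(2)[OF _ v(2)])
  moreover have "\<forall>\<^sub>F x in at_right (sqrt 2). sqrt 2 < x" by (rule eventually_at_right_less)
  ultimately have "\<forall>\<^sub>F x in at_right (sqrt 2). (x - v)\<^sup>2 / 2 < 1 - \<alpha> \<and> sqrt 2 < x" by (rule eventually_conj)
  then obtain x where x: "(x - v)\<^sup>2 / 2 < 1 - \<alpha>" "sqrt 2 < x"
    using eventually_happens[of _ "at_right (sqrt 2)"] by (auto simp: trivial_limit_at_right_real)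
  have xp: "0 < x" using x(2) real_sqrt_ge_zero[of 2] by linarith
  have "(sqrt 2)\<^sup>2 < x\<^sup>2" using x(2) by (intro power_strict_mono) auto
  then have x2: "1 < x\<^sup>2 / 2" by simp
  define \<delta> where "\<delta> = x\<^sup>2 / 2 - 1"
  have c: "sqrt (2 * (1 + \<delta>) * L n) = x * sqrt (L n)" for n
    using xp unfolding \<delta>_def by (simp add: real_sqrt_mult)
  let ?T = "d_max_test k a b (\<lambda>n. x * sqrt (L n))"
  have T: "?T n (graph y) \<longleftrightarrow> (\<exists>i\<in>{1..n}. cnt (star n i) y > thr x n)" if "model n" for n y
    unfolding d_max_test_graph[OF that] thr_def ..
  have "powerful k a b s (signal k a b C') ?T"
  proof (rule powerfulI[OF C' d_max_monotone])
    fix \<epsilon> :: real assume \<epsilon>: "\<epsilon> > 0"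
    show "\<forall>\<^sub>F n in FF. \<forall>\<C>\<in>communities n k 1. Pr (bern (edges n) (nullw n \<C>)) (\<lambda>x. ?T n (graph x)) \<le> \<epsilon>"
      using ev_model d_max_null_level[OF x2 xp \<epsilon>] by eventually_elim (simp only: T)
    have vx: "v < x" using v x by linarith
    show "\<forall>\<^sub>F n in FF. \<forall>\<C>\<in>communities n k 1. \<forall>S\<in>sparse_sets n.
        Pr (bern (edges n) (altw n \<C> S (A n))) (\<lambda>x. \<not> ?T n (graph x)) \<le> \<epsilon>"
      using ev_model d_max_power[OF vx x(1) \<epsilon>] by eventually_elim (simp only: T)
  qed
  then have "powerful k a b s (signal k a b C') (d_max_test k a b (\<lambda>n. sqrt (2 * (1 + \<delta>) * L n)))" unfolding c .
  moreover have "\<delta> > 0" using x2 by (simp add: \<delta>_def)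
  ultimately show ?thesis by blast
qed

lemma d_max_powerless_all:
  assumes v: "v < sqrt 2" "1 - \<alpha> < (sqrt 2 - v)\<^sup>2 / 2"
  shows "powerless k a b s A (d_max_test k a b c)"
proof -
  let ?F = "at_left (sqrt 2)"
  have i: "((\<lambda>x. x) \<longlongrightarrow> sqrt 2) ?F" by (rule tendsto_ident_at)
  have "((\<lambda>x. (x - v)\<^sup>2 / 2) \<longlongrightarrow> (sqrt 2 - v)\<^sup>2 / 2) ?F" by (intro tendsto_intros) simp
  then have e1: "\<forall>\<^sub>F x in ?F. 1 - \<alpha> < (x - v)\<^sup>2 / 2" by (rule order_tendstoD(1)[OF _ v(2)])
  have "((\<lambda>x. x\<^sup>2 / 2) \<longlongrightarrow> (sqrt 2)\<^sup>2 / 2) ?F" by (intro tendsto_intros) simp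
  then have e2: "\<forall>\<^sub>F x in ?F. 3 / 2 - \<alpha> < x\<^sup>2 / 2" by (rule order_tendstoD(1)) (use \<alpha> in simp)
  have e3: "\<forall>\<^sub>F x in ?F. v < x" by (rule order_tendstoD(1)[OF i v(1)])
  have e4: "\<forall>\<^sub>F x in ?F. x < sqrt 2" by (auto simp: eventually_at_filter)
  have "\<forall>\<^sub>F x in ?F. 1 - \<alpha> < (x - v)\<^sup>2 / 2 \<and> 3 / 2 - \<alpha> < x\<^sup>2 / 2 \<and> v < x \<and> x < sqrt 2"
    using e1 e2 e3 e4 by eventually_elim simp
  then obtain x where x: "1 - \<alpha> < (x - v)\<^sup>2 / 2" "3 / 2 - \<alpha> < x\<^sup>2 / 2" "v < x" "x < sqrt 2"
    using eventually_happens[of _ ?F] by (auto simp: trivial_limit_at_left_real)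
  have xp: "0 < x" using x(3) v_pos by linarith
  have "x\<^sup>2 < (sqrt 2)\<^sup>2" using x(4) xp by (intro power_strict_mono) auto
  then have x2: "x\<^sup>2 / 2 < 1" by simp
  show ?thesis by (rule d_max_powerless[OF xp x2 x(2,3,1)])
qed

end

section \<open>The detection boundaries\<close>

theorem theorem3p5:
  fixes k :: nat and a b :: "nat \<Rightarrow> real" and s :: "nat \<Rightarrow> nat" and \<tau>a \<tau>b \<alpha> C :: real
  assumes k: "k \<ge> 1"
    and ab: "\<forall>\<^sub>F n in multiples k. 0 < b n \<and> b n < a n \<and> a n \<le> real n / 2"
    and ratio_pos: "0 < Liminf (multiples k) (\<lambda>n. ereal (b n / a n))"
    and ratio_less: "Limsup (multiples k) (\<lambda>n. ereal (b n / a n)) < 1"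
    and \<tau>a: "((\<lambda>n. a n / real n) \<longlongrightarrow> \<tau>a) (multiples k)"
    and \<tau>b: "((\<lambda>n. b n / real n) \<longlongrightarrow> \<tau>b) (multiples k)"
    and log_b: "((\<lambda>n. ln (real n) / b n) \<longlongrightarrow> 0) (multiples k)"
    and \<alpha>: "1 / 2 < \<alpha>" "\<alpha> < 1"
    \<comment> \<open>\<open>s n\<close> is \<open>n powr (1 - \<alpha>)\<close> rounded to an integer, up or down\<close>
    and s: "\<forall>\<^sub>F n in multiples k. \<bar>real (s n) - real n powr (1 - \<alpha>)\<bar> < 1"
    and C: "C > 0"
  shows
    "(C > C_HC k \<tau>a \<tau>b \<alpha> \<longrightarrow>
        powerful k a b s (signal k a b C) (HC_test k a b)) \<and>
     (\<alpha> \<ge> 3 / 4 \<and> C > C_max k \<tau>a \<tau>b \<alpha> \<longrightarrow>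
        (\<exists>\<delta>>0. powerful k a b s (signal k a b C)
           (d_max_test k a b (\<lambda>n. sqrt (2 * (1 + \<delta>) * ln (real n)))))) \<and>
     (((\<lambda>n. ln (real n) ^ 3 / a n) \<longlongrightarrow> 0) (multiples k) \<and>
      ((\<lambda>n. ln (real n) ^ 3 / b n) \<longlongrightarrow> 0) (multiples k) \<and>
      \<alpha> \<ge> 3 / 4 \<and> C < C_max k \<tau>a \<tau>b \<alpha> \<longrightarrow>
        (\<forall>c. powerless k a b s (signal k a b C) (d_max_test k a b c)))"
proof -
  have regime: "asymptotic_regime k a b s \<tau>a \<tau>b \<alpha> C'" if "C' > 0" for C'
    by unfold_locales (use k ab ratio_pos \<tau>a \<tau>b log_b \<alpha> s that in auto)
  define \<rho> where "\<rho> = rho k \<tau>a \<tau>b"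
  have \<rho>: "\<rho> > 0" unfolding \<rho>_def by (rule asymptotic_regime.rho_pos[OF regime[OF C]])
  define r where "r = sqrt (1 - \<alpha>)"
  have r: "0 < r" "r < 1" "r\<^sup>2 = 1 - \<alpha>" using \<alpha> by (auto simp: r_def)
  have Cmax: "C_max k \<tau>a \<tau>b \<alpha> = 2 * \<rho> * (1 - r)\<^sup>2" by (simp add: C_max_def \<rho>_def r_def)
  have CHC: "C_HC k \<tau>a \<tau>b \<alpha> = (if \<alpha> < 3 / 4 then 2 * \<rho> * (\<alpha> - 1 / 2) else 2 * \<rho> * (1 - r)\<^sup>2)"
    by (simp add: C_HC_def \<rho>_def r_def)
  have sq: "(1 - r)\<^sup>2 < 1" using r power_strict_mono[of "1 - r" 1 2] by simp
  have root2: "(sqrt 2 * y)\<^sup>2 = 2 * y\<^sup>2" for y :: real by (simp add: power_mult_distrib)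
  \<comment> \<open>Power is inherited from a weaker signal, so \<open>C\<close> may be lowered below \<open>2 * \<rho>\<close>, which keeps \<open>v\<close> below \<open>sqrt 2\<close>.\<close>
  have weaker: "\<exists>C'. 0 < C' \<and> B < C' \<and> C' \<le> C \<and> C' < 2 * \<rho>" if "B < C" "B < 2 * \<rho>" "0 \<le> B" for B
  proof -
    have "B < min C (2 * \<rho>)" using that by simp
    then obtain C' where "B < C'" "C' < min C (2 * \<rho>)" using dense by blast
    then show ?thesis using that by (intro exI[of _ C']) auto
  qed
  have shift: "0 < asymptotic_regime.v k \<tau>a \<tau>b C'" "(asymptotic_regime.v k \<tau>a \<tau>b C')\<^sup>2 = C' / \<rho>"
    if "C' > 0" for C'
    using asymptotic_regime.v_pos[OF regime[OF that]] asymptotic_regime.v_sq[OF regime[OF that]]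
    by (auto simp: \<rho>_def)
  have below: "v < sqrt 2" if "v\<^sup>2 = C' / \<rho>" "C' < 2 * \<rho>" for v C'
  proof (rule power2_less_imp_less)
    show "v\<^sup>2 < (sqrt 2)\<^sup>2" using that \<rho> by (simp add: divide_less_eq)
  qed simp
  have close: "(sqrt 2 - v)\<^sup>2 / 2 < 1 - \<alpha>" if "sqrt 2 * (1 - r) < v" "v < sqrt 2" for v
  proof -
    have "sqrt 2 - v < sqrt 2 * r" using that by (simp add: algebra_simps)
    then have "(sqrt 2 - v)\<^sup>2 < (sqrt 2 * r)\<^sup>2" using that by (intro power_strict_mono) auto
    then show ?thesis unfolding root2 r(3) by simp
  qed
  have above: "sqrt 2 * (1 - r) < v" if "v\<^sup>2 = C' / \<rho>" "2 * \<rho> * (1 - r)\<^sup>2 < C'" "0 < v" for v C'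
  proof (rule power2_less_imp_less)
    show "(sqrt 2 * (1 - r))\<^sup>2 < v\<^sup>2" unfolding root2 that(1) using that(2) \<rho> by (simp add: less_divide_eq mult_ac)
  qed (use that in simp)
  have part1: "powerful k a b s (signal k a b C) (HC_test k a b)" if HC: "C > C_HC k \<tau>a \<tau>b \<alpha>"
  proof -
    have B: "C_HC k \<tau>a \<tau>b \<alpha> < 2 * \<rho>" "0 \<le> C_HC k \<tau>a \<tau>b \<alpha>" unfolding CHC using \<rho> \<alpha> sq by auto
    obtain C' where C': "0 < C'" "C_HC k \<tau>a \<tau>b \<alpha> < C'" "C' \<le> C" "C' < 2 * \<rho>"
      using weaker[OF HC B] by blast
    interpret asymptotic_regime k a b s \<tau>a \<tau>b \<alpha> C' by (rule regime[OF C'(1)])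
    note v = shift[OF C'(1)]
    have v2: "v < sqrt 2" by (rule below[OF v(2) C'(4)])
    show ?thesis
    proof (rule HC_powerful[OF C'(3) v2])
      show "\<alpha> - 1 / 2 < v\<^sup>2 / 2"
      proof (cases "\<alpha> < 3 / 4")
        case True
        then show ?thesis using C'(2) \<rho> unfolding CHC v(2) by (simp add: less_divide_eq mult_ac)
      next
        case False
        then have "2 * (1 - r)\<^sup>2 < v\<^sup>2" using C'(2) \<rho> unfolding CHC v(2) by (simp add: less_divide_eq mult_ac)
        moreover have "(1 - r)\<^sup>2 - (\<alpha> - 1 / 2) = 2 * (r - 1 / 2)\<^sup>2"
          using r(3) by (simp add: power2_eq_square field_simps)
        ultimately show ?thesis using zero_le_power2[of "r - 1 / 2"] by linarith
      qed
      show "(sqrt 2 - v)\<^sup>2 / 2 < 1 - \<alpha>" if large: "sqrt 2 < 2 * v"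
      proof (rule close[OF _ v2])
        show "sqrt 2 * (1 - r) < v"
        proof (cases "\<alpha> < 3 / 4")
          case True
          have "(1 / 2)\<^sup>2 < r\<^sup>2" using True unfolding r(3) by (simp add: power2_eq_square)
          then have "1 / 2 < r" using r(1) by (intro power2_less_imp_less[of "1 / 2" r]) auto
          then have "sqrt 2 * (1 - r) \<le> sqrt 2 * (1 / 2)" by (intro mult_left_mono) auto
          then show ?thesis using large by argo
        next
          case False
          then show ?thesis using above[OF v(2) _ v(1)] C'(2) unfolding CHC by simp
        qed
      qed
    qed
  qed
  have part2: "\<exists>\<delta>>0. powerful k a b s (signal k a b C) (d_max_test k a b (\<lambda>n. sqrt (2 * (1 + \<delta>) * ln (real n))))"
    if large: "C > C_max k \<tau>a \<tau>b \<alpha>"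
  proof -
    have B: "C_max k \<tau>a \<tau>b \<alpha> < 2 * \<rho>" "0 \<le> C_max k \<tau>a \<tau>b \<alpha>" unfolding Cmax using \<rho> sq by auto
    obtain C' where C': "0 < C'" "C_max k \<tau>a \<tau>b \<alpha> < C'" "C' \<le> C" "C' < 2 * \<rho>"
      using weaker[OF large B] by blast
    interpret asymptotic_regime k a b s \<tau>a \<tau>b \<alpha> C' by (rule regime[OF C'(1)])
    note v = shift[OF C'(1)]
    have v2: "v < sqrt 2" by (rule below[OF v(2) C'(4)])
    have "sqrt 2 * (1 - r) < v" by (rule above[OF v(2) _ v(1)]) (use C'(2) in \<open>simp add: Cmax\<close>)
    from d_max_powerful[OF C'(3) v2 close[OF this v2]] show ?thesis .
  qed
  have part3: "powerless k a b s (signal k a b C) (d_max_test k a b c)" if small: "C < C_max k \<tau>a \<tau>b \<alpha>" for c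
  proof -
    interpret asymptotic_regime k a b s \<tau>a \<tau>b \<alpha> C by (rule regime[OF C])
    note v = shift[OF C]
    have "v < sqrt 2 * (1 - r)"
    proof (rule power2_less_imp_less)
      show "v\<^sup>2 < (sqrt 2 * (1 - r))\<^sup>2"
        unfolding root2 v(2) using small \<rho> unfolding Cmax by (simp add: divide_less_eq mult_ac)
    qed (use r in simp)
    then have d: "sqrt 2 * r < sqrt 2 - v" by (simp add: algebra_simps)
    then have "(sqrt 2 * r)\<^sup>2 < (sqrt 2 - v)\<^sup>2" using r by (intro power_strict_mono) auto
    then have far: "1 - \<alpha> < (sqrt 2 - v)\<^sup>2 / 2" unfolding root2 r(3) by simp
    have "0 \<le> sqrt 2 * r" using r by simp
    then have "v < sqrt 2" using d by linarith
    from d_max_powerless_all[OF this far] show ?thesis .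
  qed
  show ?thesis using part1 part2 part3 by blast
qed

end
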